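(* Let $\Sigma\subseteq\mathbb{R}^n$ be a harmonic surface spanning a rectifiable curve $\Gamma$, and let $\tau:\mathbb{U}\to\Sigma$ be a harmonic parametrization of $\Sigma$. Then for every $s\in[0,2\pi]$ $$\int_{-1}^1|\partial_r\tau(re^{is})|\,dr\le\frac12\int_0^{2\pi}|\partial_t\tau(e^{it})|\,dt,$$ where the right-hand integral is understood as $\lim_{\rho\to1^-}\int_0^{2\pi}|\partial_t\tau(\rho e^{it})|\,dt$. In other words, the length of the image under $\tau$ of an arbitrary diameter $d$ of the unit disk is at most one half of the perimeter $|\Gamma|$ of $\Sigma$.
   Context: $\mathbb{U}=\{z\in\mathbb{C}:|z|<1\}$ is the unit disk and $\mathbb{T}$ is the unit circle. A Jordan surface $\Sigma\subseteq\mathbb{R}^n$ is a set $\Sigma=\Phi(\overline{\mathbb{U}})$, where $\Phi$ is a homeomorphism of the closed unit disk onto its image; it spans the Jordan curve $\Gamma=\Phi(\mathbb{T})$, and $|\Gamma|$ is the length of $\Gamma$. A harmonic surface is a Jordan surface $\Sigma$ for which there is a homeomorphism $\tau$ of $\mathbb{U}$ onto $\Phi(\mathbb{U})=\Sigma\setminus\Gamma$ with harmonic coordinate functions; such a $\tau$ is called a harmonic parametrization (it need not extend continuously to $\overline{\mathbb{U}}$). $\partial_t\tau(\rho e^{it})$ is the derivative of $t\mapsto\tau(\rho e^{it})$, and $\partial_r\tau(re^{is})$, $-1<r<1$, is the derivative of $r\mapsto\tau(re^{is})$. $|\cdot|$ is the Euclidean norm in $\mathbb{R}^n$ or the length of a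 curve. *)

theory Defs
  imports "HOL-Analysis.Analysis"
begin

text \<open>Complex arguments are real-differentiated: direction \<^term>\<open>1\<close> gives the partial
  derivative in $x$, direction \<^term>\<open>\<i>\<close> the one in $y$.\<close>

definition partial_deriv :: "complex \<Rightarrow> (complex \<Rightarrow> real) \<Rightarrow> complex \<Rightarrow> real" where
  "partial_deriv v u z = frechet_derivative u (at z) v"

definition C1_on :: "(complex \<Rightarrow> real) \<Rightarrow> complex set \<Rightarrow> bool" where
  "C1_on u S \<longleftrightarrow> (\<forall>z\<in>S. u differentiable (at z)) \<and>
     continuous_on S (partial_deriv 1 u) \<and> continuous_on S (partial_deriv \<i> u)"

definition C2_on :: "(complex \<Rightarrow> real) \<Rightarrow> complex set \<Rightarrow> bool" where
  "C2_on u S \<longleftrightarrow> C1_on u S \<and> C1_on (partial_deriv 1 u) S \<and> C1_on (partial_deriv \<i> u) S"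

text \<open>Intended for open \<^term>\<open>S\<close>.\<close>

definition harmonic_on :: "(complex \<Rightarrow> real) \<Rightarrow> complex set \<Rightarrow> bool" where
  "harmonic_on u S \<longleftrightarrow> C2_on u S \<and>
     (\<forall>z\<in>S. partial_deriv 1 (partial_deriv 1 u) z + partial_deriv \<i> (partial_deriv \<i> u) z = 0)"

text \<open>The surface is the set \<^term>\<open>\<Sigma>\<close>; the spanned Jordan curve is \<^term>\<open>\<Phi> ` sphere 0 1\<close>.\<close>

definition jordan_surface :: "(complex \<Rightarrow> real^'n) \<Rightarrow> (real^'n) set \<Rightarrow> bool" where
  "jordan_surface \<Phi> \<Sigma> \<longleftrightarrow> (\<exists>\<Psi>. homeomorphism (cball 0 1) \<Sigma> \<Phi> \<Psi>)"

text \<open>No continuity of \<^term>\<open>\<tau>\<close> up to the boundary is required, and its values outside the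
  open disk are irrelevant.\<close>

definition harmonic_parametrization ::
    "(complex \<Rightarrow> real^'n) \<Rightarrow> (real^'n) set \<Rightarrow> (complex \<Rightarrow> real^'n) \<Rightarrow> bool" where
  "harmonic_parametrization \<Phi> \<Sigma> \<tau> \<longleftrightarrow>
     (\<exists>\<sigma>. homeomorphism (ball 0 1) (\<Sigma> - \<Phi> ` sphere 0 1) \<tau> \<sigma>) \<and>
     (\<forall>i. harmonic_on (\<lambda>z. \<tau> z $ i) (ball 0 1))"

definition harmonic_surface :: "(complex \<Rightarrow> real^'n) \<Rightarrow> (real^'n) set \<Rightarrow> bool" where
  "harmonic_surface \<Phi> \<Sigma> \<longleftrightarrow>
     jordan_surface \<Phi> \<Sigma> \<and> (\<exists>\<tau>. harmonic_parametrization \<Phi> \<Sigma> \<tau>)"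

text \<open>Supremum of the lengths of inscribed polygons with vertices at parameters
  $t_0 \le \dots \le t_k$ in \<^term>\<open>I\<close>, possibly \<^term>\<open>\<infinity>\<close>; \<^term>\<open>I\<close> may be
  a non-compact interval.\<close>

definition curve_length :: "real set \<Rightarrow> (real \<Rightarrow> 'a::metric_space) \<Rightarrow> ennreal" where
  "curve_length I g =
     (SUP (k, t) \<in> {(k::nat, t::nat \<Rightarrow> real). mono_on {..k} t \<and> t ` {..k} \<subseteq> I}.
        \<Sum>i<k. ennreal (dist (g (t i)) (g (t (Suc i)))))"

text \<open>Length of the Jordan curve \<^term>\<open>\<Phi> ` sphere 0 1\<close>, traversed once; \<^term>\<open>\<Phi>\<close> is
  injective on the circle, so only the endpoints of the parameter interval are identified.\<close>

definition boundary_length :: "(complex \<Rightarrow> real^'n) \<Rightarrow> ennreal" where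
  "boundary_length \<Phi> = curve_length {0..2*pi} (\<lambda>t. \<Phi> (cis t))"

definition circle_deriv_integral :: "(complex \<Rightarrow> real^'n) \<Rightarrow> real \<Rightarrow> real" where
  "circle_deriv_integral \<tau> \<rho> =
     integral {0..2*pi} (\<lambda>t. norm (vector_derivative (\<lambda>t. \<tau> (rcis \<rho> t)) (at t)))"

definition radial_speed :: "(complex \<Rightarrow> real^'n) \<Rightarrow> real \<Rightarrow> real \<Rightarrow> real" where
  "radial_speed \<tau> s r = norm (vector_derivative (\<lambda>r. \<tau> (rcis r s)) (at r))"

end

theory Submission
  imports Defs "HOL-Complex_Analysis.Complex_Analysis"
begin

text \<open>
  Each coordinate of \<open>\<tau>\<close> is the real part of a holomorphic function \<open>F\<^sub>i\<close>, so that
  \<open>\<partial>\<^sub>t \<tau>\<close> and \<open>\<partial>\<^sub>r \<tau>\<close> have the coordinates \<open>Re (\<i> z F\<^sub>i'(z))\<close> and \<open>Re (e\<^sup>i\<^sup>s F\<^sub>i'(z))\<close>: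
  up to the factor \<open>r\<close>, the one is a conjugate function of the other. The theorem splits into an
  inequality of Fejer-Riesz type inside the disk and the comparison of the limit \<open>L\<close> of the lengths
  of the curves \<open>\<tau>({|z| = \<rho>})\<close> with \<open>|\<Gamma>|\<close>.

  For the first part, the conjugate Poisson formula on a circle of radius \<open>R < 1\<close> writes \<open>\<partial>\<^sub>r \<tau>\<close> at
  the point \<open>a e\<^sup>i\<^sup>s\<close> as the integral of \<open>\<partial>\<^sub>t \<tau>\<close> over the circle against, up to sign, the kernel
  \<open>R sin \<theta> / (\<pi> (R\<^sup>2 - 2 R a cos \<theta> + a\<^sup>2))\<close>. For fixed \<open>\<theta>\<close> the absolute value of this kernel
  integrates over the diameter \<open>-R < a < R\<close> to the angle \<open>\<pi>/2\<close> under which a diameter is seen from a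
  point of the circle, divided by \<open>\<pi>\<close> (\<open>conjugate_kernel_integral_le\<close>). Fubini yields the constant
  \<open>1/2\<close> (\<open>diameter_integral_le\<close>).

  For the second part, \<open>\<tau>\<close> need not extend to the circle, and yet \<open>L \<le> |\<Gamma>|\<close> is claimed. The map
  \<open>h = \<Phi>\<^sup>-\<^sup>1 \<circ> \<tau>\<close> is a homeomorphism of the open disk. A general such homeomorphism may behave wildly
  near the circle, but harmonicity of \<open>\<tau> = \<Phi> \<circ> h\<close> tames it: the cluster sets of \<open>h\<close> at two distinct
  boundary points have no arc in common (\<open>no_common_cluster_arc\<close>). Otherwise three small subarcs of
  the common arc would yield curves that cross one of the two sides between these boundary points,
  arbitrarily close to the circle, on which \<open>\<tau>\<close> is almost constant, with three different constants.
  Two of the curves cross the same side, and the maximum principle in the region cut off by such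
  a curve forces \<open>\<tau>\<close> at a point of the radius to the middle of the side to be close to both constants.
  Cluster sets are connected subsets of the circle, so all but countably many are single points,
  and \<open>h\<close> has radial limits off a countable set of angles
  (\<open>countable_nonsingleton_cluster_sets\<close>).

  Along \<open>k\<close> equally spaced good radii the endpoints of the images of the radii are vertices of a
  polygon whose length is at most \<open>|\<Gamma>|\<close>: the cluster sets of the \<open>k\<close> sectors are arcs that join
  consecutive vertices and overlap at vertices only (\<open>spoke_ends_polygon_le_boundary_length\<close>).
  For \<open>\<eta> = 2\<pi>/k\<close> the integral of \<open>|\<tau>(\<rho> e\<^sup>i\<^sup>(\<^sup>t\<^sup>+\<^sup>\<eta>\<^sup>)) - \<tau>(\<rho> e\<^sup>i\<^sup>t)|\<close> over \<open>0 \<le> t \<le> 2\<pi>\<close> increases with \<open>\<rho>\<close> by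
  the Poisson formula, and by dominated convergence its limit is the integral over \<open>[0, \<eta>]\<close> of the lengths of such polygons
  (\<open>mean_chord_le_perimeter\<close>). Division by \<open>\<eta>\<close> and \<open>\<eta> \<rightarrow> 0\<close> turn the chords into
  \<open>|\<partial>\<^sub>t \<tau>|\<close> and give \<open>L \<le> |\<Gamma>|\<close>.
\<close>

section \<open>Vectors tested against vectors of norm at most one\<close>

text \<open>Estimates for \<open>\<tau>\<close> are reduced by this lemma to scalar ones: \<open>c \<bullet> \<tau>\<close> is again the real part of
  a holomorphic function, and the worst \<open>c\<close> is the direction of \<open>x\<close> itself.\<close>

lemma norm_le_if_inner_le:
  fixes x :: "'a::real_inner"
  assumes "\<And>c. norm c \<le> 1 \<Longrightarrow> c \<bullet> x \<le> B"
  shows "norm x \<le> B"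
proof -
  have "sgn x \<bullet> x = norm x"
    by (cases "x = 0") (auto simp: sgn_div_norm power2_norm_eq_inner[symmetric] power2_eq_square)
  with assms[of "sgn x"] show ?thesis by (simp add: norm_sgn)
qed

lemma inner_le_norm_if_norm_le_1: "norm c \<le> 1 \<Longrightarrow> c \<bullet> x \<le> norm x" for x :: "'a::real_inner"
  using norm_cauchy_schwarz[of c x] mult_right_mono[of "norm c" 1 "norm x"] by simp

lemma inner_Re_components:
  fixes c :: "real^'n"
  shows "c \<bullet> (\<chi> i. Re (F i)) = Re (\<Sum>i\<in>UNIV. of_real (c $ i) * F i)"
  by (simp add: inner_vec_def)

lemma compact_closure_in_cball:
  fixes S :: "'a::heine_borel set"
  shows "S \<subseteq> cball a r \<Longrightarrow> compact (closure S)"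
  by (simp add: compact_closure bounded_subset[OF bounded_cball])

section \<open>Harmonic functions on the disk are real parts\<close>

lemma partial_has_real_derivative:
  assumes "u differentiable (at (p + of_real x * v))"
  shows "((\<lambda>x. u (p + of_real x * v)) has_real_derivative partial_deriv v u (p + of_real x * v)) (at x)"
proof -
  let ?D = "frechet_derivative u (at (p + of_real x * v))"
  have D: "(u has_derivative ?D) (at (p + of_real x * v))"
    using assms frechet_derivative_works by blast
  interpret D: bounded_linear ?D using D by (rule has_derivative_bounded_linear)
  have "((\<lambda>x. p + of_real x * v) has_derivative (\<lambda>y. of_real y * v)) (at x)"
    by (auto intro!: derivative_eq_intros)
  from diff_chain_at[OF this, of u ?D] D
  have "((\<lambda>x. u (p + of_real x * v)) has_derivative (\<lambda>y. ?D (of_real y * v))) (at x)"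
    by (simp add: o_def)
  moreover have "?D (of_real y * v) = ?D v * y" for y
    using D.scaleR[of y v] by (simp add: scaleR_conv_of_real)
  ultimately show ?thesis
    by (simp add: has_field_derivative_def partial_deriv_def mult_commute_abs)
qed

text \<open>The mean value theorem applied first in direction \<open>v\<close> to the difference in direction \<open>w\<close>, then in
  direction \<open>w\<close> to the derivative. The second difference is symmetric in \<open>v\<close> and \<open>w\<close>, which is how
  the mixed partial derivatives are compared.\<close>

lemma second_difference_mean_value:
  assumes h: "h > 0"
    and u: "\<And>x y. 0 \<le> x \<Longrightarrow> x \<le> h \<Longrightarrow> 0 \<le> y \<Longrightarrow> y \<le> h \<Longrightarrow>
        u differentiable (at (p + of_real x * v + of_real y * w)) \<and>
        partial_deriv v u differentiable (at (p + of_real x * v + of_real y * w))"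
  obtains x y where "0 \<le> x" "x \<le> h" "0 \<le> y" "y \<le> h"
    "u (p + of_real h * v + of_real h * w) - u (p + of_real h * v) - u (p + of_real h * w) + u p =
       h * h * partial_deriv w (partial_deriv v u) (p + of_real x * v + of_real y * w)"
proof -
  define \<phi> where "\<phi> x = u (p + of_real h * w + of_real x * v) - u (p + of_real x * v)" for x
  define \<phi>' where "\<phi>' x = partial_deriv v u (p + of_real h * w + of_real x * v) - partial_deriv v u (p + of_real x * v)" for x
  have d1: "(\<phi> has_real_derivative \<phi>' x) (at x)" if "0 \<le> x" "x \<le> h" for x
  proof -
    have "p + of_real h * w + of_real x * v = p + of_real x * v + of_real h * w"
      by simp
    then have "u differentiable (at (p + of_real h * w + of_real x * v))"
      by (rule ssubst[where P="\<lambda>z. u differentiable (at z)"]) (rule conjunct1[OF u]; use that h in simp)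
    moreover have "u differentiable (at (p + of_real x * v))"
      using u[of x 0] that h by auto
    ultimately show ?thesis
      unfolding \<phi>_def \<phi>'_def by (intro DERIV_diff partial_has_real_derivative)
  qed
  obtain x where x: "0 < x" "x < h" "\<phi> h - \<phi> 0 = (h - 0) * \<phi>' x"
    using MVT2[OF h, of \<phi> \<phi>'] d1 by auto
  define \<psi> where "\<psi> y = partial_deriv v u (p + of_real x * v + of_real y * w)" for y
  have d2: "(\<psi> has_real_derivative partial_deriv w (partial_deriv v u) (p + of_real x * v + of_real y * w)) (at y)" if "0 \<le> y" "y \<le> h" for y
    unfolding \<psi>_def by (intro partial_has_real_derivative) (use u[of x y] that x in auto)
  obtain y where y: "0 < y" "y < h" "\<psi> h - \<psi> 0 = (h - 0) * partial_deriv w (partial_deriv v u) (p + of_real x * v + of_real y * w)"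
    using MVT2[OF h, of \<psi> "\<lambda>y. partial_deriv w (partial_deriv v u) (p + of_real x * v + of_real y * w)", OF d2]
    by metis
  have "\<phi>' x = \<psi> h - \<psi> 0"
    unfolding \<phi>'_def \<psi>_def by (simp add: add.assoc add.commute[of "of_real x * v"])
  with x y have "\<phi> h - \<phi> 0 = h * h * partial_deriv w (partial_deriv v u) (p + of_real x * v + of_real y * w)"
    by simp
  moreover have "\<phi> h - \<phi> 0 =
      u (p + of_real h * v + of_real h * w) - u (p + of_real h * v) - u (p + of_real h * w) + u p"
    unfolding \<phi>_def by (simp add: add.assoc add.commute[of "of_real h * v"])
  ultimately show ?thesis using x y that[of x y] by simp
qed

text \<open>By the preceding lemma both derivatives occur, at points arbitrarily close to \<open>p\<close>, as the same
  second difference quotient; continuity takes them to \<open>p\<close>.\<close>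

lemma mixed_partial_derivs_commute:
  assumes S: "open S" "p \<in> S" and u: "C2_on u S"
  shows "partial_deriv \<i> (partial_deriv 1 u) p = partial_deriv 1 (partial_deriv \<i> u) p"
proof (rule ccontr)
  let ?f = "partial_deriv \<i> (partial_deriv 1 u)" and ?g = "partial_deriv 1 (partial_deriv \<i> u)"
  assume ne: "?f p \<noteq> ?g p"
  define e where "e = dist (?f p) (?g p) / 2"
  have e: "e > 0" using ne by (simp add: e_def)
  have cf: "continuous_on S ?f" and cg: "continuous_on S ?g"
    using u by (auto simp: C2_on_def C1_on_def)
  obtain d1 where d1: "d1 > 0" "\<And>z. z \<in> S \<Longrightarrow> dist z p < d1 \<Longrightarrow> dist (?f z) (?f p) < e"
    using cf S e unfolding continuous_on_iff by metis
  obtain d2 where d2: "d2 > 0" "\<And>z. z \<in> S \<Longrightarrow> dist z p < d2 \<Longrightarrow> dist (?g z) (?g p) < e"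
    using cg S e unfolding continuous_on_iff by metis
  obtain d3 where d3: "d3 > 0" "ball p d3 \<subseteq> S"
    using S openE by blast
  define h where "h = min d1 (min d2 d3) / 3"
  have h: "h > 0" "3 * h \<le> d1" "3 * h \<le> d2" "3 * h \<le> d3"
    using d1 d2 d3 by (auto simp: h_def)
  have near: "dist (p + of_real x * v + of_real y * w) p < 3 * h"
    if "0 \<le> x" "x \<le> h" "0 \<le> y" "y \<le> h" "norm v = 1" "norm w = 1" for x y v w
  proof -
    have "dist (p + of_real x * v + of_real y * w) p = norm (of_real x * v + of_real y * w)"
      by (simp add: dist_norm algebra_simps)
    also have "\<dots> \<le> x + y"
      using that by (intro order_trans[OF norm_triangle_ineq]) (simp add: norm_mult)
    finally show ?thesis using that h by linarith
  qed
  have inS: "z \<in> S" if "dist z p < 3 * h" for z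
    using that d3 h by (auto simp: dist_commute subset_iff)
  have dif: "u differentiable (at z)" "partial_deriv 1 u differentiable (at z)"
    "partial_deriv \<i> u differentiable (at z)" if "z \<in> S" for z
    using u that by (auto simp: C2_on_def C1_on_def)
  have inS': "p + of_real x * v + of_real y * w \<in> S"
    if "0 \<le> x" "x \<le> h" "0 \<le> y" "y \<le> h" "norm v = 1" "norm w = 1" for x y v w
    by (rule inS[OF near[OF that]])
  obtain x y where xy: "0 \<le> x" "x \<le> h" "0 \<le> y" "y \<le> h"
    "u (p + of_real h * 1 + of_real h * \<i>) - u (p + of_real h * 1) - u (p + of_real h * \<i>) + u p =
       h * h * ?f (p + of_real x * 1 + of_real y * \<i>)"
  proof (rule second_difference_mean_value[OF h(1), of u p 1 \<i>])
    fix x y :: real assume "0 \<le> x" "x \<le> h" "0 \<le> y" "y \<le> h"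
    then have "p + of_real x * 1 + of_real y * \<i> \<in> S" by (intro inS') auto
    then show "u differentiable (at (p + of_real x * 1 + of_real y * \<i>)) \<and>
        partial_deriv 1 u differentiable (at (p + of_real x * 1 + of_real y * \<i>))"
      using dif by blast
  qed
  obtain x' y' where xy': "0 \<le> x'" "x' \<le> h" "0 \<le> y'" "y' \<le> h"
    "u (p + of_real h * \<i> + of_real h * 1) - u (p + of_real h * \<i>) - u (p + of_real h * 1) + u p =
       h * h * ?g (p + of_real x' * \<i> + of_real y' * 1)"
  proof (rule second_difference_mean_value[OF h(1), of u p \<i> 1])
    fix x y :: real assume "0 \<le> x" "x \<le> h" "0 \<le> y" "y \<le> h"
    then have "p + of_real x * \<i> + of_real y * 1 \<in> S" by (intro inS') auto
    then show "u differentiable (at (p + of_real x * \<i> + of_real y * 1)) \<and>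
        partial_deriv \<i> u differentiable (at (p + of_real x * \<i> + of_real y * 1))"
      using dif by blast
  qed
  have eq: "?f (p + of_real x * 1 + of_real y * \<i>) = ?g (p + of_real x' * \<i> + of_real y' * 1)"
  proof -
    have "h * h * ?f (p + of_real x * 1 + of_real y * \<i>) = h * h * ?g (p + of_real x' * \<i> + of_real y' * 1)"
      unfolding xy(5)[symmetric] xy'(5)[symmetric]
      by (simp only: add.commute add.left_commute)
    then show ?thesis using h(1) by simp
  qed
  have n1: "dist (p + of_real x * 1 + of_real y * \<i>) p < 3 * h" using near[of x y 1 \<i>] xy by simp
  have n2: "dist (p + of_real x' * \<i> + of_real y' * 1) p < 3 * h" using near[of x' y' \<i> 1] xy' by simp
  let ?z = "p + of_real x * 1 + of_real y * \<i>" and ?z' = "p + of_real x' * \<i> + of_real y' * 1"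
  have "dist (?f ?z) (?f p) < e"
    by (rule d1(2)[OF inS[OF n1]]) (use n1 h(2) in linarith)
  moreover have "dist (?g ?z') (?g p) < e"
    by (rule d2(2)[OF inS[OF n2]]) (use n2 h(3) in linarith)
  ultimately have "dist (?f p) (?g p) < e + e"
    unfolding eq dist_real_def by arith
  then show False by (simp add: e_def)
qed

text \<open>The function \<open>u\<^sub>x - \<i> u\<^sub>y\<close> satisfies the Cauchy-Riemann equations: one of them is the Laplace
  equation, the other the symmetry of the mixed derivatives. Its primitive on the disk has the real
  part \<open>u\<close> up to a constant.\<close>

lemma harmonic_on_ball_is_Re_holomorphic:
  assumes "harmonic_on u (ball 0 1)"
  obtains F where "F holomorphic_on ball 0 1" "\<And>z. z \<in> ball 0 1 \<Longrightarrow> u z = Re (F z)"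
proof -
  let ?B = "ball 0 1 :: complex set"
  define a where "a = partial_deriv 1 u"
  define b where "b = partial_deriv \<i> u"
  have C2: "C2_on u ?B" and lap: "\<And>z. z \<in> ?B \<Longrightarrow> partial_deriv 1 a z + partial_deriv \<i> b z = 0"
    using assms by (auto simp: harmonic_on_def a_def b_def)
  have du: "u differentiable (at z)" and da: "a differentiable (at z)" and db: "b differentiable (at z)"
    if "z \<in> ?B" for z using C2 that by (auto simp: C2_on_def C1_on_def a_def b_def)
  have mix: "partial_deriv \<i> a z = partial_deriv 1 b z" if "z \<in> ?B" for z
    using mixed_partial_derivs_commute[OF open_ball that C2] by (simp add: a_def b_def)
  have der: "(f has_derivative (\<lambda>v. Re v * partial_deriv 1 f z + Im v * partial_deriv \<i> f z)) (at z)"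
    if "f differentiable (at z)" for f :: "complex \<Rightarrow> real" and z
  proof -
    let ?D = "frechet_derivative f (at z)"
    have D: "(f has_derivative ?D) (at z)" using that frechet_derivative_works by blast
    interpret D: bounded_linear ?D using D by (rule has_derivative_bounded_linear)
    have "?D = (\<lambda>v. Re v * ?D 1 + Im v * ?D \<i>)"
    proof
      fix v
      have "v = Re v *\<^sub>R 1 + Im v *\<^sub>R \<i>" by (simp add: complex_eq_iff)
      then have "?D v = ?D (Re v *\<^sub>R 1 + Im v *\<^sub>R \<i>)" by (rule arg_cong[where f="?D"])
      also have "\<dots> = Re v * ?D 1 + Im v * ?D \<i>" by (simp only: D.add D.scaleR real_scaleR_def)
      finally show "?D v = Re v * ?D 1 + Im v * ?D \<i>" .
    qed
    from has_derivative_eq_rhs[OF D this] show ?thesis unfolding partial_deriv_def .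
  qed
  define g where "g z = complex_of_real (a z) - \<i> * complex_of_real (b z)" for z
  have "(g has_field_derivative Complex (partial_deriv 1 a z) (- partial_deriv 1 b z)) (at z)" if "z \<in> ?B" for z
  proof -
    have D: "(g has_derivative (\<lambda>v. complex_of_real (Re v * partial_deriv 1 a z + Im v * partial_deriv \<i> a z) -
        \<i> * complex_of_real (Re v * partial_deriv 1 b z + Im v * partial_deriv \<i> b z))) (at z)"
      unfolding g_def using der[OF da[OF that]] der[OF db[OF that]]
      by (intro derivative_intros) auto
    have l: "partial_deriv \<i> b z = - partial_deriv 1 a z" using lap[OF that] by linarith
    have "(\<lambda>v. complex_of_real (Re v * partial_deriv 1 a z + Im v * partial_deriv \<i> a z) -
        \<i> * complex_of_real (Re v * partial_deriv 1 b z + Im v * partial_deriv \<i> b z)) =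
       (*) (Complex (partial_deriv 1 a z) (- partial_deriv 1 b z))"
      unfolding l mix[OF that] by (rule ext) (simp add: complex_eq_iff algebra_simps)
    from has_derivative_eq_rhs[OF D this] show ?thesis unfolding has_field_derivative_def .
  qed
  then have "g holomorphic_on ?B" unfolding holomorphic_on_open[OF open_ball] by blast
  then obtain G where G: "\<And>z. z \<in> ?B \<Longrightarrow> (G has_field_derivative g z) (at z within ?B)"
    using holomorphic_convex_primitive'[OF convex_ball open_ball] by blast
  define F where "F z = G z + of_real (u 0 - Re (G 0))" for z
  have F: "(F has_field_derivative g z) (at z within ?B)" if "z \<in> ?B" for z
    unfolding F_def using DERIV_add[OF G[OF that] DERIV_const] by simp
  have "((\<lambda>z. u z - Re (F z)) has_derivative (\<lambda>_. 0)) (at z within ?B)" if "z \<in> ?B" for z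
  proof -
    have D: "((\<lambda>z. u z - Re (F z)) has_derivative
       (\<lambda>v. (Re v * a z + Im v * b z) - Re (g z * v))) (at z within ?B)"
      using F[OF that] has_derivative_at_withinI[OF der[OF du[OF that]]]
      unfolding has_field_derivative_def a_def b_def
      by (intro derivative_intros)
    have "(\<lambda>v. (Re v * a z + Im v * b z) - Re (g z * v)) = (\<lambda>_. 0)"
      by (rule ext) (simp add: g_def algebra_simps)
    from has_derivative_eq_rhs[OF D this] show ?thesis .
  qed
  then obtain c where c: "\<And>z. z \<in> ?B \<Longrightarrow> u z - Re (F z) = c"
    using has_derivative_zero_constant[OF convex_ball, of 0 1 "\<lambda>z. u z - Re (F z)"] by blast
  have "c = 0" using c[of 0] by (simp add: F_def)
  show ?thesis
  proof
    show "F holomorphic_on ?B" using F unfolding holomorphic_on_def field_differentiable_def by blast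
    show "u z = Re (F z)" if "z \<in> ?B" for z using c[OF that] unfolding \<open>c = 0\<close> by linarith
  qed
qed

section \<open>Poisson and conjugate Poisson integrals\<close>

text \<open>Cauchy's formula with \<open>dw = \<i> w dt\<close>. Both kernels below come out of it by a suitable choice of
  the holomorphic factor \<open>\<psi>\<close>.\<close>

lemma Cauchy_integral_circle_angle:
  fixes \<psi> :: "complex \<Rightarrow> complex"
  assumes \<psi>: "\<psi> holomorphic_on cball 0 R" and a: "norm a < R"
  shows "((\<lambda>t. \<psi> (rcis R t) * rcis R t / (rcis R t - a)) has_integral 2 * pi * \<psi> a) {0..2*pi}"
proof -
  have "((\<lambda>u. \<psi> u / (u - a)) has_contour_integral (2 * of_real pi * \<i> * \<psi> a)) (part_circlepath 0 R 0 (2*pi))"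
    unfolding circlepath_def[symmetric] using a
    by (intro Cauchy_integral_circlepath_simple \<psi>) auto
  then have "((\<lambda>t. \<psi> (0 + R * cis t) / (0 + R * cis t - a) * R * \<i> * cis t) has_integral
        (2 * of_real pi * \<i> * \<psi> a)) {0..2*pi}"
    by (subst (asm) has_contour_integral_part_circlepath_iff) auto
  from has_integral_mult_right[OF this, of "-\<i>"] show ?thesis
    by (rule has_integral_eq_rhs[OF has_integral_eq, rotated]) (auto simp: rcis_def field_simps)
qed

lemma norm_rcis_diff_squared:
  "(cmod (rcis R t - of_real a))\<^sup>2 = R\<^sup>2 - 2 * R * a * cos t + a\<^sup>2"
proof -
  have "(cmod (rcis R t - of_real a))\<^sup>2 = (R * cos t - a)\<^sup>2 + (R * sin t)\<^sup>2"
    by (simp add: cmod_power2)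
  also have "\<dots> = (R\<^sup>2 * (sin t)\<^sup>2 + R\<^sup>2 * (cos t)\<^sup>2) - 2 * R * a * cos t + a\<^sup>2"
    by (simp add: power2_diff power_mult_distrib)
  finally show ?thesis unfolding distrib_left[symmetric] by simp
qed

lemma kernel_denominator_pos:
  fixes R a t :: real
  assumes "\<bar>a\<bar> < R"
  shows "R\<^sup>2 - 2 * R * a * cos t + a\<^sup>2 > 0"
proof -
  have "rcis R t \<noteq> of_real a"
  proof
    assume "rcis R t = of_real a"
    then have "cmod (rcis R t) = \<bar>a\<bar>" by simp
    with assms show False by simp
  qed
  then show ?thesis unfolding norm_rcis_diff_squared[symmetric] by simp
qed

text \<open>On the circle \<open>|w| = R\<close> the real denominator \<open>|w - a|\<^sup>2\<close> equals
  \<open>(w - a) (R\<^sup>2 - a w) / w\<close>, whose second factor has, for \<open>|a| < R\<close>, no zero in the closed disk of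
  radius \<open>R\<close>. Hence both kernels are
  holomorphic expressions in \<open>w\<close> with the Cauchy kernel as their only pole.\<close>

lemma kernel_denominator_factors:
  "complex_of_real (R\<^sup>2 - 2 * R * a * cos t + a\<^sup>2) * rcis R t =
     (rcis R t - of_real a) * (of_real (R\<^sup>2) - of_real a * rcis R t)"
proof -
  have c: "cis t * cnj (cis t) = 1" by (simp add: cis_cnj cis_mult)
  have "complex_of_real (R\<^sup>2 - 2 * R * a * cos t + a\<^sup>2) =
     (rcis R t - of_real a) * cnj (rcis R t - of_real a)"
    unfolding norm_rcis_diff_squared[symmetric] complex_norm_square by simp
  also have "\<dots> * rcis R t = (rcis R t - of_real a) * (of_real (R\<^sup>2) * (cis t * cnj (cis t)) - of_real a * rcis R t)"
    by (simp add: rcis_def algebra_simps power2_eq_square)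
  finally show ?thesis unfolding c by simp
qed

text \<open>Normalized by \<open>2\<pi>\<close>, so that its integral over a period is one.\<close>

definition poisson_kernel :: "real \<Rightarrow> real \<Rightarrow> real \<Rightarrow> real" where
  "poisson_kernel R a t = (R\<^sup>2 - a\<^sup>2) / (2 * pi * (R\<^sup>2 - 2 * R * a * cos t + a\<^sup>2))"

lemma continuous_on_poisson_kernel:
  fixes f :: "'x::t2_space \<Rightarrow> real"
  assumes "\<bar>a\<bar> < R" "continuous_on A f"
  shows "continuous_on A (\<lambda>x. poisson_kernel R a (f x))"
  unfolding poisson_kernel_def
proof (intro continuous_on_divide continuous_intros assms ballI)
  fix x
  have "2 * pi * (R\<^sup>2 - 2 * R * a * cos (f x) + a\<^sup>2) > 0"
    by (intro mult_pos_pos kernel_denominator_pos assms) auto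
  then show "2 * pi * (R\<^sup>2 - 2 * R * a * cos (f x) + a\<^sup>2) \<noteq> 0" by linarith
qed

lemma continuous_on_conjugate_kernel:
  fixes f g :: "'x::t2_space \<Rightarrow> real"
  assumes "\<And>x. x \<in> A \<Longrightarrow> \<bar>f x\<bar> < R" "continuous_on A f" "continuous_on A g"
  shows "continuous_on A (\<lambda>x. R * \<bar>sin (g x)\<bar> / (R\<^sup>2 - 2 * R * f x * cos (g x) + (f x)\<^sup>2))"
proof (intro continuous_on_divide continuous_intros assms ballI)
  fix x assume "x \<in> A"
  then have "R\<^sup>2 - 2 * R * f x * cos (g x) + (f x)\<^sup>2 > 0"
    by (intro kernel_denominator_pos assms)
  then show "R\<^sup>2 - 2 * R * f x * cos (g x) + (f x)\<^sup>2 \<noteq> 0" by linarith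
qed

lemma poisson_kernel_pos: "\<bar>a\<bar> < R \<Longrightarrow> poisson_kernel R a t > 0"
  unfolding poisson_kernel_def using kernel_denominator_pos[of a R t]
  by (intro divide_pos_pos mult_pos_pos pi_gt_zero) (auto simp: abs_le_square_iff[symmetric] not_le[symmetric])

lemma circle_reflection_nonzero:
  fixes w :: complex
  assumes "\<bar>a\<bar> < R" "norm w \<le> R"
  shows "of_real (R\<^sup>2) - of_real a * w \<noteq> 0"
proof
  assume "of_real (R\<^sup>2) - of_real a * w = 0"
  then have "of_real a * w = of_real (R\<^sup>2)" by simp
  from arg_cong[where f=norm, OF this] have "\<bar>a\<bar> * norm w = R\<^sup>2"
    by (simp only: norm_mult norm_of_real) simp
  moreover have "\<bar>a\<bar> * norm w \<le> \<bar>a\<bar> * R" using assms by (intro mult_left_mono) auto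
  moreover have "\<bar>a\<bar> * R < R * R" using assms by (intro mult_strict_right_mono) auto
  ultimately show False by (simp add: power2_eq_square)
qed

lemma poisson_formula_real_point:
  assumes g: "g holomorphic_on cball 0 R" and a: "\<bar>a\<bar> < R"
  shows "((\<lambda>t. poisson_kernel R a t * Re (g (rcis R t))) has_integral Re (g (of_real a))) {0..2*pi}"
proof -
  have R: "R > 0" using a by linarith
  define \<psi> where "\<psi> w = g w * of_real (R\<^sup>2 - a\<^sup>2) / (of_real (R\<^sup>2) - of_real a * w)" for w
  have nz: "of_real (R\<^sup>2) - of_real a * w \<noteq> 0" if "norm w \<le> R" for w :: complex
    by (rule circle_reflection_nonzero[OF a that])
  have "\<psi> holomorphic_on cball 0 R"
    unfolding \<psi>_def using nz by (intro holomorphic_intros g) auto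
  from Cauchy_integral_circle_angle[OF this, of "of_real a"] a
  have "((\<lambda>t. \<psi> (rcis R t) * rcis R t / (rcis R t - of_real a)) has_integral 2 * pi * \<psi> (of_real a)) {0..2*pi}"
    by simp
  also have "(\<lambda>t. \<psi> (rcis R t) * rcis R t / (rcis R t - of_real a)) =
     (\<lambda>t. g (rcis R t) * of_real (2 * pi * poisson_kernel R a t))"
  proof
    fix t
    let ?w = "rcis R t" and ?D = "R\<^sup>2 - 2 * R * a * cos t + a\<^sup>2"
    have e: "complex_of_real ?D * ?w = (?w - of_real a) * (of_real (R\<^sup>2) - of_real a * ?w)"
      by (rule kernel_denominator_factors)
    have w: "?w \<noteq> 0" using R by (simp add: rcis_eq_zero_iff)
    have "\<psi> ?w * ?w / (?w - of_real a) =
        g ?w * of_real (R\<^sup>2 - a\<^sup>2) * ?w / ((?w - of_real a) * (of_real (R\<^sup>2) - of_real a * ?w))"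
      by (simp add: \<psi>_def field_simps)
    also have "\<dots> = g ?w * of_real (R\<^sup>2 - a\<^sup>2) / of_real ?D"
      unfolding e[symmetric] using w by simp
    also have "\<dots> = g ?w * of_real (2 * pi * poisson_kernel R a t)"
      unfolding poisson_kernel_def by simp
    finally show "\<psi> ?w * ?w / (?w - of_real a) = g ?w * of_real (2 * pi * poisson_kernel R a t)" .
  qed
  also have "\<psi> (of_real a) = g (of_real a)"
  proof -
    have "\<bar>a\<bar>\<^sup>2 < R\<^sup>2" using a by (intro power_strict_mono) auto
    then have ne: "complex_of_real (R\<^sup>2 - a\<^sup>2) \<noteq> 0" by (simp only: of_real_eq_0_iff) simp
    have "of_real (R\<^sup>2) - of_real a * of_real a = complex_of_real (R\<^sup>2 - a\<^sup>2)"
      by (simp add: power2_eq_square)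
    then show ?thesis using ne unfolding \<psi>_def by simp
  qed
  finally have "((\<lambda>t. g (rcis R t) * of_real (2 * pi * poisson_kernel R a t)) has_integral 2 * pi * g (of_real a)) {0..2*pi}" .
  from has_integral_mult_right[OF has_integral_linear[OF this bounded_linear_Re], of "1 / (2*pi)"]
  show ?thesis by (simp add: o_def field_simps)
qed

text \<open>On the circle \<open>2 \<i> R sin t = (w\<^sup>2 - R\<^sup>2) / w\<close>, so the kernel again extends holomorphically and
  Cauchy's formula evaluates the integral. The formula expresses \<open>Re H\<close> through \<open>Im (w H)\<close>;
  for \<open>H = F'\<close> these are a radial and (up to sign) an angular derivative of \<open>Re F\<close>.\<close>

lemma conjugate_poisson_formula_real_point:
  assumes H: "H holomorphic_on cball 0 R" and a: "\<bar>a\<bar> < R"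
  shows "((\<lambda>t. R * sin t / (R\<^sup>2 - 2 * R * a * cos t + a\<^sup>2) * Im (rcis R t * H (rcis R t)))
     has_integral pi * Re (H (of_real a))) {0..2*pi}"
proof -
  have R: "R > 0" using a by linarith
  define \<psi> where "\<psi> w = H w * (w\<^sup>2 - of_real (R\<^sup>2)) / (of_real (R\<^sup>2) - of_real a * w)" for w
  have nz: "of_real (R\<^sup>2) - of_real a * w \<noteq> 0" if "norm w \<le> R" for w :: complex
    by (rule circle_reflection_nonzero[OF a that])
  have "\<psi> holomorphic_on cball 0 R"
    unfolding \<psi>_def using nz by (intro holomorphic_intros H) auto
  from Cauchy_integral_circle_angle[OF this, of "of_real a"] a
  have "((\<lambda>t. \<psi> (rcis R t) * rcis R t / (rcis R t - of_real a)) has_integral 2 * pi * \<psi> (of_real a)) {0..2*pi}"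
    by simp
  also have "(\<lambda>t. \<psi> (rcis R t) * rcis R t / (rcis R t - of_real a)) =
     (\<lambda>t. 2 * \<i> * (of_real (R * sin t / (R\<^sup>2 - 2 * R * a * cos t + a\<^sup>2)) * (rcis R t * H (rcis R t))))"
  proof
    fix t
    let ?w = "rcis R t" and ?D = "R\<^sup>2 - 2 * R * a * cos t + a\<^sup>2"
    have e: "complex_of_real ?D * ?w = (?w - of_real a) * (of_real (R\<^sup>2) - of_real a * ?w)"
      by (rule kernel_denominator_factors)
    have w: "?w \<noteq> 0" using R by (simp add: rcis_eq_zero_iff)
    have "?w\<^sup>2 - of_real (R\<^sup>2) = ?w\<^sup>2 - ?w * cnj ?w"
      by (subst complex_norm_square[symmetric]) simp
    also have "\<dots> = ?w * (?w - cnj ?w)" by (simp add: power2_eq_square algebra_simps)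
    also have "?w - cnj ?w = 2 * \<i> * of_real (R * sin t)"
      by (simp add: complex_eq_iff)
    finally have w2: "?w\<^sup>2 - of_real (R\<^sup>2) = ?w * (2 * \<i> * of_real (R * sin t))" .
    have "\<psi> ?w * ?w / (?w - of_real a) =
        H ?w * (?w\<^sup>2 - of_real (R\<^sup>2)) * ?w / ((?w - of_real a) * (of_real (R\<^sup>2) - of_real a * ?w))"
      by (simp add: \<psi>_def field_simps)
    also have "\<dots> = H ?w * (?w\<^sup>2 - of_real (R\<^sup>2)) / of_real ?D"
      unfolding e[symmetric] using w by simp
    also have "\<dots> = 2 * \<i> * (of_real (R * sin t / ?D) * (?w * H ?w))"
      unfolding w2 of_real_divide by (simp only: times_divide_eq_right times_divide_eq_left mult_ac)
    finally show "\<psi> ?w * ?w / (?w - of_real a) = 2 * \<i> * (of_real (R * sin t / ?D) * (?w * H ?w))" .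
  qed
  also have "\<psi> (of_real a) = - H (of_real a)"
  proof -
    have "\<bar>a\<bar>\<^sup>2 < R\<^sup>2" using a by (intro power_strict_mono) auto
    then have ne: "complex_of_real (R\<^sup>2 - a\<^sup>2) \<noteq> 0" by (simp only: of_real_eq_0_iff) simp
    have e1: "of_real (R\<^sup>2) - of_real a * of_real a = complex_of_real (R\<^sup>2 - a\<^sup>2)"
      by (simp add: power2_eq_square)
    have e2: "(of_real a)\<^sup>2 - of_real (R\<^sup>2) = - complex_of_real (R\<^sup>2 - a\<^sup>2)"
      by simp
    show ?thesis unfolding \<psi>_def e1 e2 using ne by (simp del: of_real_diff of_real_power)
  qed
  finally have "((\<lambda>t. 2 * \<i> * (of_real (R * sin t / (R\<^sup>2 - 2 * R * a * cos t + a\<^sup>2)) * (rcis R t * H (rcis R t))))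
      has_integral 2 * pi * - H (of_real a)) {0..2*pi}" .
  from has_integral_mult_right[OF this, of "1 / (2 * \<i>)"]
  have "((\<lambda>t. of_real (R * sin t / (R\<^sup>2 - 2 * R * a * cos t + a\<^sup>2)) * (rcis R t * H (rcis R t)))
      has_integral \<i> * of_real pi * H (of_real a)) {0..2*pi}"
    by (simp add: field_simps)
  from has_integral_linear[OF this bounded_linear_Im]
  have "((\<lambda>t. Im (of_real (R * sin t / (R\<^sup>2 - 2 * R * a * cos t + a\<^sup>2)) * (rcis R t * H (rcis R t))))
      has_integral Im (\<i> * of_real pi * H (of_real a))) {0..2*pi}"
    by (simp only: o_def)
  moreover have "Im (of_real k * z) = k * Im z" for k z by simp
  ultimately show ?thesis by (simp only: mult.assoc Im_i_times) simp
qed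

text \<open>For \<open>t \<ge> 0\<close> the interval \<open>[0, t + p]\<close> is split in two ways; a negative shift is undone by a
  positive one.\<close>

lemma integral_periodic_shift:
  fixes f :: "real \<Rightarrow> real"
  assumes cont: "continuous_on UNIV f" and per: "\<And>x. f (x + p) = f x" and p: "p \<ge> 0"
  shows "integral {0..p} (\<lambda>x. f (x + t)) = integral {0..p} f"
proof -
  have main: "integral {0..p} (\<lambda>x. f (x + t)) = integral {0..p} f"
    if cont: "continuous_on UNIV f" and per: "\<And>x. f (x + p) = f x" and t: "t \<ge> 0" for f :: "real \<Rightarrow> real" and t
  proof -
    have int: "f integrable_on {a..b}" for a b
      by (intro integrable_continuous_interval continuous_on_subset[OF cont]) auto
    have "integral {0..p} f + integral {p..t+p} f = integral {0..t+p} f"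
      using p t by (intro Henstock_Kurzweil_Integration.integral_combine int) auto
    moreover have "integral {0..t} f + integral {t..t+p} f = integral {0..t+p} f"
      using p t by (intro Henstock_Kurzweil_Integration.integral_combine int) auto
    moreover have "integral {p..t+p} f = integral {0..t} f"
      using integral_shift_real_ivl[of p p "t+p" f] per by simp
    moreover have "integral {t..t+p} f = integral {0..p} (\<lambda>x. f (x + t))"
      using integral_shift_real_ivl[of t t "t+p" f] by simp
    ultimately show ?thesis by simp
  qed
  show ?thesis
  proof (cases "t \<ge> 0")
    case True
    then show ?thesis using main[OF cont per] by blast
  next
    case False
    have "integral {0..p} (\<lambda>x. f ((x + -t) + t)) = integral {0..p} (\<lambda>x. f (x + t))"
    proof (rule main[where f="\<lambda>x. f (x + t)" and t="-t"])
      show "continuous_on UNIV (\<lambda>x. f (x + t))"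
        by (intro continuous_on_compose2[OF cont] continuous_intros) auto
      show "f (x + p + t) = f (x + t)" for x using per[of "x + t"] by (simp add: add_ac)
    qed (use False in auto)
    then show ?thesis by simp
  qed
qed

lemma rcis_add_2pi: "rcis R (t + 2 * pi) = rcis R t"
  by (simp add: rcis_def complex_eq_iff)

lemma rcis_mult_cis: "rcis R t * cis s = rcis R (t + s)"
  by (simp add: rcis_def cis_mult)

context
  fixes F :: "'n::finite \<Rightarrow> complex \<Rightarrow> complex" and V :: "complex \<Rightarrow> real^'n"
  assumes F: "\<And>i. F i holomorphic_on ball 0 1"
    and V: "\<And>z. norm z < 1 \<Longrightarrow> V z = (\<chi> i. Re (F i z))"
begin

lemma continuous_on_Re_components: "continuous_on (ball 0 1) V"
proof -
  have "continuous_on (ball 0 1) (\<lambda>z. \<chi> i. Re (F i z))"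
    using F by (intro continuous_intros holomorphic_on_imp_continuous_on)
  then show ?thesis by (rule continuous_on_eq) (use V in auto)
qed

lemma continuous_on_norm_circle:
  assumes "\<bar>R\<bar> < 1"
  shows "continuous_on UNIV (\<lambda>t. norm (V (rcis R t)))"
  using assms
  by (intro continuous_on_norm continuous_on_compose2[OF continuous_on_Re_components])
     (auto simp: rcis_def cis_conv_exp intro!: continuous_intros simp: norm_mult)

text \<open>The Poisson formula at the real point \<open>a\<close> is applied to the rotated function
  \<open>w \<mapsto> c \<bullet> V(w e\<^sup>i\<^sup>t)\<close>.\<close>

lemma norm_le_poisson_integral:
  assumes a: "\<bar>a\<bar> < R" and R: "R < 1"
  shows "norm (V (rcis a t)) \<le> integral {0..2*pi} (\<lambda>\<theta>. poisson_kernel R a \<theta> * norm (V (rcis R (\<theta> + t))))"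
proof (rule norm_le_if_inner_le)
  fix c :: "real^'n" assume c: "norm c \<le> 1"
  define g where "g w = (\<Sum>i\<in>UNIV. of_real (c $ i) * F i (w * cis t))" for w
  have "g holomorphic_on cball 0 R" unfolding g_def
    using R by (intro holomorphic_intros holomorphic_on_compose_gen[OF _ F, unfolded o_def]) (auto simp: norm_mult)
  from poisson_formula_real_point[OF this a]
  have I: "((\<lambda>\<theta>. poisson_kernel R a \<theta> * Re (g (rcis R \<theta>))) has_integral Re (g (of_real a))) {0..2*pi}" .
  have Re_g: "Re (g (rcis r \<theta>)) = c \<bullet> V (rcis r (\<theta> + t))" if "\<bar>r\<bar> < 1" for r \<theta>
    using that V[of "rcis r (\<theta> + t)"] by (simp add: g_def inner_Re_components rcis_mult_cis)
  have "c \<bullet> V (rcis a t) = Re (g (of_real a))"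
    using Re_g[of a 0] a R by simp
  also have "\<dots> \<le> integral {0..2*pi} (\<lambda>\<theta>. poisson_kernel R a \<theta> * norm (V (rcis R (\<theta> + t))))"
  proof (rule has_integral_le[OF I integrable_integral])
    show "(\<lambda>\<theta>. poisson_kernel R a \<theta> * norm (V (rcis R (\<theta> + t)))) integrable_on {0..2*pi}"
      using a R
      by (intro integrable_continuous_interval continuous_intros continuous_on_poisson_kernel
          continuous_on_compose2[OF continuous_on_norm_circle[of R]]) auto
    show "poisson_kernel R a \<theta> * Re (g (rcis R \<theta>)) \<le> poisson_kernel R a \<theta> * norm (V (rcis R (\<theta> + t)))" for \<theta>
      using poisson_kernel_pos[OF a, of \<theta>] Re_g[of R \<theta>] a R inner_le_norm_if_norm_le_1[OF c]
      by (intro mult_left_mono) auto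
  qed
  finally show "c \<bullet> V (rcis a t) \<le> \<dots>" .
qed

text \<open>Fubini, as the Poisson kernel has total mass one and the inner integral over a full period does
  not depend on the shift \<open>\<theta>\<close>.\<close>

lemma circle_mean_norm_mono:
  assumes a: "0 \<le> a" "a < R" and R: "R < 1"
  shows "integral {0..2*pi} (\<lambda>t. norm (V (rcis a t))) \<le> integral {0..2*pi} (\<lambda>t. norm (V (rcis R t)))"
proof -
  define N where "N t = norm (V (rcis R t))" for t
  define P where "P = poisson_kernel R a"
  have aR: "\<bar>a\<bar> < R" using a by simp
  have cN: "continuous_on A (\<lambda>x. N (f x))" if "continuous_on A f" for f :: "'x::t2_space \<Rightarrow> real" and A
    unfolding N_def using a R by (intro continuous_on_compose2[OF continuous_on_norm_circle that]) auto
  have cP: "continuous_on A (\<lambda>x. P (f x))" if "continuous_on A f" for f :: "'x::t2_space \<Rightarrow> real" and A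
    unfolding P_def by (rule continuous_on_poisson_kernel[OF aR that])
  have c2: "continuous_on (cbox (0, 0) (2*pi, 2*pi)) (\<lambda>(t, \<theta>). P \<theta> * N (\<theta> + t))"
    unfolding case_prod_unfold by (intro continuous_intros cN cP)
  have ii: "(\<lambda>t. integral {0..2*pi} (\<lambda>\<theta>. P \<theta> * N (\<theta> + t))) integrable_on {0..2*pi}"
    using integral_integrable_2dim[OF c2] by simp
  have "integral {0..2*pi} (\<lambda>t. norm (V (rcis a t))) \<le> integral {0..2*pi} (\<lambda>t. integral {0..2*pi} (\<lambda>\<theta>. P \<theta> * N (\<theta> + t)))"
    using norm_le_poisson_integral[OF aR R] a R unfolding P_def N_def
    by (intro integral_le ii[unfolded P_def N_def] integrable_continuous_interval
        continuous_on_subset[OF continuous_on_norm_circle]) auto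
  also have "\<dots> = integral {0..2*pi} (\<lambda>\<theta>. integral {0..2*pi} (\<lambda>t. P \<theta> * N (\<theta> + t)))"
    using integral_swap_continuous[OF c2] by simp
  also have "\<dots> = integral {0..2*pi} (\<lambda>\<theta>. P \<theta> * integral {0..2*pi} N)"
  proof -
    have "integral {0..2*pi} (\<lambda>t. N (t + \<theta>)) = integral {0..2*pi} N" for \<theta>
      using cN[OF continuous_on_id, of UNIV]
      by (intro integral_periodic_shift) (simp_all add: N_def rcis_add_2pi)
    then show ?thesis by (simp add: add.commute)
  qed
  also have "\<dots> = integral {0..2*pi} N * integral {0..2*pi} P"
    by (simp add: mult.commute)
  also have "integral {0..2*pi} P = 1"
    using integral_unique[OF poisson_formula_real_point[of "\<lambda>_. 1", OF _ aR]] by (simp add: P_def)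
  finally show ?thesis by (simp add: N_def)
qed

end

text \<open>The vector \<open>D\<close> is the radial derivative at \<open>a e\<^sup>i\<^sup>s\<close> and \<open>T\<close> the angular derivative; rotation by
  \<open>s\<close> moves the point to the real axis.\<close>

lemma norm_le_conjugate_poisson_integral:
  fixes F :: "'n::finite \<Rightarrow> complex \<Rightarrow> complex" and D :: "real^'n"
  assumes F: "\<And>i. F i holomorphic_on ball 0 1"
    and a: "\<bar>a\<bar> < R" and R: "R < 1"
    and D: "D = (\<chi> i. Re (cis s * deriv (F i) (rcis a s)))"
    and T: "\<And>z. norm z < 1 \<Longrightarrow> T z = (\<chi> i. Re (\<i> * z * deriv (F i) z))"
  shows "norm D \<le> integral {0..2*pi}
     (\<lambda>\<theta>. R * \<bar>sin \<theta>\<bar> / (R\<^sup>2 - 2 * R * a * cos \<theta> + a\<^sup>2) * norm (T (rcis R (\<theta> + s)))) / pi"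
proof (rule norm_le_if_inner_le)
  fix c :: "real^'n" assume c: "norm c \<le> 1"
  let ?K = "\<lambda>\<theta>. R * sin \<theta> / (R\<^sup>2 - 2 * R * a * cos \<theta> + a\<^sup>2)"
  have R0: "R > 0" using a by linarith
  have dF: "deriv (F i) holomorphic_on ball 0 1" for i by (intro holomorphic_deriv F) auto
  define H where "H w = (\<Sum>i\<in>UNIV. of_real (c $ i) * (cis s * deriv (F i) (w * cis s)))" for w
  have "H holomorphic_on cball 0 R" unfolding H_def
    using R by (intro holomorphic_intros holomorphic_on_compose_gen[OF _ dF, unfolded o_def]) (auto simp: norm_mult)
  from conjugate_poisson_formula_real_point[OF this a]
  have I: "((\<lambda>\<theta>. ?K \<theta> * Im (rcis R \<theta> * H (rcis R \<theta>))) has_integral pi * Re (H (of_real a))) {0..2*pi}" .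
  have Im_H: "Im (rcis R \<theta> * H (rcis R \<theta>)) = - (c \<bullet> T (rcis R (\<theta> + s)))" for \<theta>
  proof -
    let ?w = "rcis R (\<theta> + s)"
    have "rcis R \<theta> * H (rcis R \<theta>) = (\<Sum>i\<in>UNIV. of_real (c $ i) * (?w * deriv (F i) ?w))"
      unfolding H_def sum_distrib_left rcis_mult_cis[symmetric] by (simp add: mult_ac)
    then have "Im (rcis R \<theta> * H (rcis R \<theta>)) = - Re (\<i> * (\<Sum>i\<in>UNIV. of_real (c $ i) * (?w * deriv (F i) ?w)))"
      by simp
    also have "\<i> * (\<Sum>i\<in>UNIV. of_real (c $ i) * (?w * deriv (F i) ?w)) =
        (\<Sum>i\<in>UNIV. of_real (c $ i) * (\<i> * ?w * deriv (F i) ?w))"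
      unfolding sum_distrib_left by (simp add: mult_ac)
    also have "Re \<dots> = c \<bullet> T ?w"
    proof -
      have Tw: "T ?w = (\<chi> i. Re (\<i> * ?w * deriv (F i) ?w))" by (rule T) (use R R0 in simp)
      show ?thesis unfolding Tw by (rule inner_Re_components[symmetric])
    qed
    finally show ?thesis .
  qed
  have cT: "continuous_on UNIV (\<lambda>t. norm (T (rcis R t)))"
  proof -
    have "continuous_on (ball 0 1) (\<lambda>z. \<chi> i. Re (\<i> * z * deriv (F i) z))"
      using dF by (intro continuous_intros holomorphic_on_imp_continuous_on)
    then have cT: "continuous_on (ball 0 1) T" by (rule continuous_on_eq) (use T in auto)
    show ?thesis using R R0
      by (intro continuous_on_norm continuous_on_compose2[OF cT])
         (auto simp: rcis_def cis_conv_exp intro!: continuous_intros simp: norm_mult)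
  qed
  have absK: "\<bar>?K \<theta>\<bar> = R * \<bar>sin \<theta>\<bar> / (R\<^sup>2 - 2 * R * a * cos \<theta> + a\<^sup>2)" for \<theta>
    using kernel_denominator_pos[OF a, of \<theta>] R0 by (simp add: abs_mult)
  have "pi * (c \<bullet> D) = pi * Re (H (of_real a))"
    unfolding D H_def inner_Re_components by (simp add: rcis_def)
  also have "\<dots> \<le> integral {0..2*pi} (\<lambda>\<theta>. \<bar>?K \<theta>\<bar> * norm (T (rcis R (\<theta> + s))))"
  proof (rule has_integral_le[OF I integrable_integral])
    show "(\<lambda>\<theta>. \<bar>?K \<theta>\<bar> * norm (T (rcis R (\<theta> + s)))) integrable_on {0..2*pi}"
      unfolding absK using a
      by (intro integrable_continuous_interval continuous_on_mult continuous_on_conjugate_kernel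
          continuous_on_compose2[OF cT]) (auto intro!: continuous_intros)
    show "?K \<theta> * Im (rcis R \<theta> * H (rcis R \<theta>)) \<le> \<bar>?K \<theta>\<bar> * norm (T (rcis R (\<theta> + s)))" for \<theta>
    proof -
      have "\<bar>c \<bullet> T (rcis R (\<theta> + s))\<bar> \<le> norm (T (rcis R (\<theta> + s)))"
        using inner_le_norm_if_norm_le_1[OF c, of "T (rcis R (\<theta> + s))"] inner_le_norm_if_norm_le_1[of "-c" "T (rcis R (\<theta> + s))"] c
        by (simp add: abs_le_iff)
      then have "\<bar>?K \<theta> * Im (rcis R \<theta> * H (rcis R \<theta>))\<bar> \<le> \<bar>?K \<theta>\<bar> * norm (T (rcis R (\<theta> + s)))"
        unfolding Im_H abs_mult abs_minus by (rule mult_left_mono) auto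
      then show ?thesis by linarith
    qed
  qed
  finally show "c \<bullet> D \<le> integral {0..2*pi}
     (\<lambda>\<theta>. R * \<bar>sin \<theta>\<bar> / (R\<^sup>2 - 2 * R * a * cos \<theta> + a\<^sup>2) * norm (T (rcis R (\<theta> + s)))) / pi"
    unfolding absK by (simp add: field_simps)
qed

text \<open>An antiderivative is \<open>arctan ((a - R cos \<theta>) / (R |sin \<theta>|))\<close>. At the ends \<open>a = R\<close> and \<open>a = -R\<close> the arguments
  have the absolute values \<open>(1 - cos \<theta>) / |sin \<theta>|\<close> and \<open>(1 + cos \<theta>) / |sin \<theta>|\<close>, which are
  reciprocal, and \<open>arctan x + arctan (1/x) = \<pi>/2\<close>: a diameter is seen under a right angle.\<close>

lemma conjugate_kernel_integral_le:
  assumes r: "0 < r" "r < R"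
  shows "integral {-r..r} (\<lambda>a. R * \<bar>sin \<theta>\<bar> / (R\<^sup>2 - 2 * R * a * cos \<theta> + a\<^sup>2)) \<le> pi / 2"
proof (cases "sin \<theta> = 0")
  case True then show ?thesis by simp
next
  case False
  define S where "S = \<bar>sin \<theta>\<bar>"
  define C where "C = cos \<theta>"
  have S: "S > 0" using False by (simp add: S_def)
  have SC: "S\<^sup>2 + C\<^sup>2 = 1" by (simp add: S_def C_def)
  have R: "R > 0" using r by linarith
  define A where "A a = arctan ((a - R * C) / (R * S))" for a
  have "((\<lambda>a. R * S / (R\<^sup>2 - 2 * R * a * C + a\<^sup>2)) has_integral (A r - A (-r))) {-r..r}"
  proof (rule fundamental_theorem_of_calculus)
    fix a assume "a \<in> {-r..r}"
    have "(A has_real_derivative (1 / (R * S)) * inverse (1 + ((a - R * C) / (R * S))\<^sup>2)) (at a within {-r..r})"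
      unfolding A_def using R S by (auto intro!: derivative_eq_intros simp: field_simps)
    also have "(1 / (R * S)) * inverse (1 + ((a - R * C) / (R * S))\<^sup>2) = R * S / ((R * S)\<^sup>2 + (a - R * C)\<^sup>2)"
      using R S by (simp add: field_simps power2_eq_square)
    also have "(R * S)\<^sup>2 + (a - R * C)\<^sup>2 = R\<^sup>2 * (S\<^sup>2 + C\<^sup>2) - 2 * R * a * C + a\<^sup>2"
      by (simp add: power2_eq_square algebra_simps)
    finally show "(A has_vector_derivative R * S / (R\<^sup>2 - 2 * R * a * C + a\<^sup>2)) (at a within {-r..r})"
      unfolding SC by (simp add: has_real_derivative_iff_has_vector_derivative)
  qed (use r in auto)
  then have "integral {-r..r} (\<lambda>a. R * S / (R\<^sup>2 - 2 * R * a * C + a\<^sup>2)) = A r - A (-r)"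
    by (rule integral_unique)
  also have "\<dots> \<le> A R - A (-R)"
    using r R S unfolding A_def by (intro diff_mono arctan_monotone' divide_right_mono) auto
  also have "A R = arctan ((1 - C) / S)"
    using R mult_divide_mult_cancel_left[of R "1 - C" S] unfolding A_def by (simp add: right_diff_distrib)
  also have "A (-R) = - arctan ((1 + C) / S)"
    using R mult_divide_mult_cancel_left[of R "- 1 - C" S] unfolding A_def arctan_minus[symmetric]
    by (simp add: right_diff_distrib minus_divide_left)
  also have "arctan ((1 + C) / S) = pi / 2 - arctan ((1 - C) / S)"
  proof -
    have "C < 1"
    proof (rule ccontr)
      assume "\<not> C < 1"
      then have "1\<^sup>2 \<le> C\<^sup>2" by (intro power_mono) auto
      then show False using SC S by (smt (verit) zero_less_power one_power2)
    qed
    then have pos: "(1 - C) / S > 0" using S by simp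
    have "(1 + C) * (1 - C) = S * S"
      using SC by (simp add: power2_eq_square algebra_simps)
    then have "(1 + C) / S = 1 / ((1 - C) / S)"
      using S \<open>C < 1\<close> by (simp add: field_simps)
    then show ?thesis using arctan_inverse[of "(1 - C) / S"] pos by simp
  qed
  finally show ?thesis by (simp add: S_def C_def)
qed

text \<open>The bound \<open>\<pi>/2\<close> of the kernel integral over the diameter and the factor \<open>1/\<pi>\<close> of the conjugate
  Poisson formula combine to the constant \<open>1/2\<close>.\<close>

lemma diameter_integral_le:
  fixes F :: "'n::finite \<Rightarrow> complex \<Rightarrow> complex" and D :: "real \<Rightarrow> real^'n"
  assumes F: "\<And>i. F i holomorphic_on ball 0 1"
    and D: "\<And>a. \<bar>a\<bar> < 1 \<Longrightarrow> D a = (\<chi> i. Re (cis s * deriv (F i) (rcis a s)))"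
    and T: "\<And>z. norm z < 1 \<Longrightarrow> T z = (\<chi> i. Re (\<i> * z * deriv (F i) z))"
    and r: "0 < r" "r < R" "R < 1"
  shows "integral {-r..r} (\<lambda>a. norm (D a)) \<le> 1/2 * integral {0..2*pi} (\<lambda>t. norm (T (rcis R t)))"
proof -
  define N where "N t = norm (T (rcis R t))" for t
  define K where "K a \<theta> = R * \<bar>sin \<theta>\<bar> / (R\<^sup>2 - 2 * R * a * cos \<theta> + a\<^sup>2)" for a \<theta>
  have dF: "deriv (F i) holomorphic_on ball 0 1" for i by (intro holomorphic_deriv F) auto
  have hT: "(\<lambda>z. \<i> * z * deriv (F i) z) holomorphic_on ball 0 1" for i
    by (intro holomorphic_intros F) auto
  have cN: "continuous_on A (\<lambda>x. N (f x))" if "continuous_on A f" for f :: "'x::t2_space \<Rightarrow> real" and A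
    unfolding N_def
    by (rule continuous_on_compose2[OF continuous_on_norm_circle[OF hT T] that]) (use r in auto)
  have cK: "continuous_on A (\<lambda>x. K (f x) (g x))"
    if "continuous_on A f" "continuous_on A g" "\<And>x. x \<in> A \<Longrightarrow> f x \<in> {-r..r}"
    for f g :: "'x::t2_space \<Rightarrow> real" and A
    unfolding K_def using that r by (intro continuous_on_conjugate_kernel) force+
  have cD: "continuous_on {-r..r} D"
  proof -
    have "continuous_on {-r..r} (\<lambda>a. \<chi> i. Re (cis s * deriv (F i) (rcis a s)))"
      using r unfolding rcis_def
      by (intro continuous_intros continuous_on_compose2[OF holomorphic_on_imp_continuous_on[OF dF]])
         (auto simp: norm_mult)
    then show ?thesis by (rule continuous_on_eq) (use D r in auto)
  qed
  have c2: "continuous_on (cbox (-r, 0) (r, 2*pi)) (\<lambda>(a, \<theta>). K a \<theta> * N (\<theta> + s))"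
    unfolding case_prod_unfold by (intro continuous_intros cN cK) (auto simp: cbox_Pair_iff)
  have c2': "continuous_on (cbox (0, -r) (2*pi, r)) (\<lambda>(\<theta>, a). K a \<theta> * N (\<theta> + s))"
    unfolding case_prod_unfold by (intro continuous_intros cN cK) (auto simp: cbox_Pair_iff)
  have ii: "(\<lambda>a. integral {0..2*pi} (\<lambda>\<theta>. K a \<theta> * N (\<theta> + s))) integrable_on {-r..r}"
    using integral_integrable_2dim[OF c2] by simp
  have "integral {-r..r} (\<lambda>a. norm (D a)) \<le> integral {-r..r} (\<lambda>a. integral {0..2*pi} (\<lambda>\<theta>. K a \<theta> * N (\<theta> + s)) / pi)"
  proof (rule integral_le)
    show "(\<lambda>a. norm (D a)) integrable_on {-r..r}"
      by (intro integrable_continuous_interval continuous_on_norm cD)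
    show "(\<lambda>a. integral {0..2*pi} (\<lambda>\<theta>. K a \<theta> * N (\<theta> + s)) / pi) integrable_on {-r..r}"
      using integrable_linear[OF ii bounded_linear_divide[of pi]] by (simp add: o_def)
    show "norm (D a) \<le> integral {0..2*pi} (\<lambda>\<theta>. K a \<theta> * N (\<theta> + s)) / pi" if "a \<in> {-r..r}" for a
      unfolding K_def N_def
      by (rule norm_le_conjugate_poisson_integral[OF F _ _ D T]) (use that r in auto)
  qed
  also have "\<dots> = integral {-r..r} (\<lambda>a. integral {0..2*pi} (\<lambda>\<theta>. K a \<theta> * N (\<theta> + s))) / pi"
    by simp
  finally have le1: "integral {-r..r} (\<lambda>a. norm (D a)) \<le>
      integral {-r..r} (\<lambda>a. integral {0..2*pi} (\<lambda>\<theta>. K a \<theta> * N (\<theta> + s))) / pi" .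
  have "integral {-r..r} (\<lambda>a. integral {0..2*pi} (\<lambda>\<theta>. K a \<theta> * N (\<theta> + s))) =
     integral {0..2*pi} (\<lambda>\<theta>. integral {-r..r} (\<lambda>a. K a \<theta> * N (\<theta> + s)))"
    using integral_swap_continuous[OF c2] by simp
  also have "\<dots> \<le> integral {0..2*pi} (\<lambda>\<theta>. pi / 2 * N (\<theta> + s))"
  proof (rule integral_le)
    show "(\<lambda>\<theta>. integral {-r..r} (\<lambda>a. K a \<theta> * N (\<theta> + s))) integrable_on {0..2*pi}"
      using integral_integrable_2dim[OF c2'] by simp
    show "(\<lambda>\<theta>. pi / 2 * N (\<theta> + s)) integrable_on {0..2*pi}"
      by (intro integrable_continuous_interval continuous_intros cN)
    show "integral {-r..r} (\<lambda>a. K a \<theta> * N (\<theta> + s)) \<le> pi / 2 * N (\<theta> + s)" for \<theta>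
    proof -
      have "integral {-r..r} (\<lambda>a. K a \<theta> * N (\<theta> + s)) = integral {-r..r} (\<lambda>a. K a \<theta>) * N (\<theta> + s)"
        by simp
      also have "\<dots> \<le> pi / 2 * N (\<theta> + s)"
        using conjugate_kernel_integral_le[OF r(1,2), of \<theta>] unfolding K_def
        by (intro mult_right_mono) (auto simp: N_def)
      finally show ?thesis .
    qed
  qed
  also have "integral {0..2*pi} (\<lambda>\<theta>. pi / 2 * N (\<theta> + s)) = pi / 2 * integral {0..2*pi} N"
  proof -
    have "integral {0..2*pi} (\<lambda>t. N (t + s)) = integral {0..2*pi} N"
      using cN[OF continuous_on_id, of UNIV]
      by (intro integral_periodic_shift) (simp_all add: N_def rcis_add_2pi)
    then show ?thesis by simp
  qed
  finally have "integral {-r..r} (\<lambda>a. integral {0..2*pi} (\<lambda>\<theta>. K a \<theta> * N (\<theta> + s))) / pi \<le>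
      (pi / 2 * integral {0..2*pi} N) / pi"
    by (intro divide_right_mono) auto
  from order_trans[OF le1 this] show ?thesis by (simp add: N_def[abs_def])
qed

section \<open>Connected subsets of the circle\<close>

lemma Re_mult_cis: "Re (cis w * cis (- m)) = cos (w - m)"
  by (simp add: cis_mult)

lemma unit_vector_with_Re_eq_cos:
  assumes "norm z = 1" "Re (z * cis (- m)) = cos d"
  shows "z = cis (m + d) \<or> z = cis (m - d)"
proof -
  let ?w = "z * cis (- m)"
  have n: "(Re ?w)\<^sup>2 + (Im ?w)\<^sup>2 = 1"
    using assms(1) by (simp only: cmod_power2[symmetric] norm_mult) simp
  have "(sin d)\<^sup>2 + (cos d)\<^sup>2 = 1" by simp
  then have "(Im ?w)\<^sup>2 = (sin d)\<^sup>2" using n unfolding assms(2) by linarith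
  then have "Im ?w = sin d \<or> Im ?w = - sin d" by (simp only: power2_eq_iff)
  then have "?w = cis d \<or> ?w = cis (- d)" using assms(2) by (auto simp: complex_eq_iff)
  then have "?w * cis m = cis d * cis m \<or> ?w * cis m = cis (- d) * cis m" by auto
  moreover have "?w * cis m = z" by (simp add: mult.assoc cis_mult)
  ultimately show ?thesis by (simp add: cis_mult add.commute)
qed

text \<open>If a point \<open>cis u\<close> of one arc and a point \<open>cis v\<close> of the other were missing, the line through
  these two points would meet the circle nowhere else and hence separate \<open>A\<close>, as \<open>cis x\<close> and \<open>cis y\<close> lie on
  different sides of it.\<close>

lemma connected_on_circle_contains_arc:
  assumes A: "connected A" "A \<subseteq> sphere 0 1"
    and x: "cis x \<in> A" and y: "cis y \<in> A" and xy: "x \<le> y" "y \<le> x + 2 * pi"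
  shows "cis ` {x..y} \<subseteq> A \<or> cis ` {y..x + 2 * pi} \<subseteq> A"
proof (rule ccontr)
  assume "\<not> ?thesis"
  then have "\<not> cis ` {x..y} \<subseteq> A" "\<not> cis ` {y..x + 2 * pi} \<subseteq> A" by auto
  then obtain u v where u: "x \<le> u" "u \<le> y" "cis u \<notin> A" and v: "y \<le> v" "v \<le> x + 2 * pi" "cis v \<notin> A"
    unfolding image_subset_iff by (meson atLeastAtMost_iff)
  have "cis (x + 2 * pi) = cis x" by (simp add: complex_eq_iff)
  then have strict: "x < u" "u < y" "y < v" "v < x + 2 * pi"
    using u v x y by (auto simp: less_le)
  define m where "m = (u + v) / 2"
  define d where "d = (v - u) / 2"
  have md: "m + d = v" "m - d = u" by (auto simp: m_def d_def field_simps)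
  have d: "0 < d" "d < pi" using strict by (auto simp: d_def)
  let ?L = "\<lambda>z. Re (z * cis (- m))"
  have "cos d < cos \<bar>y - m\<bar>"
    using strict d md by (intro cos_monotone_0_pi) auto
  then have Ly: "cos d < ?L (cis y)" unfolding Re_mult_cis by (simp only: cos_abs_real)
  have Lx: "?L (cis x) < cos d"
  proof (cases "m - x \<le> pi")
    case True
    then have "cos (m - x) < cos d" using strict d md by (intro cos_monotone_0_pi) auto
    then show ?thesis unfolding Re_mult_cis by (subst cos_minus[symmetric]) simp
  next
    case False
    have "cos (x + 2 * pi - m) < cos d" using strict d md False by (intro cos_monotone_0_pi) auto
    moreover have "cos (x + 2 * pi - m) = cos (x - m)"
      using cos_periodic[of "x - m"] by (simp add: algebra_simps)
    ultimately show ?thesis unfolding Re_mult_cis by simp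
  qed
  have con: "connected (?L ` A)"
    by (intro connected_continuous_image A continuous_intros)
  then have "cos d \<in> ?L ` A"
    by (intro connectedD_interval[OF con imageI[OF x] imageI[OF y]] less_imp_le Lx Ly)
  then obtain z where z: "z \<in> A" "?L z = cos d" by auto
  then have "z = cis v \<or> z = cis u"
    using unit_vector_with_Re_eq_cos[of z m d] A md by auto
  with z u v show False by auto
qed

section \<open>The maximum principle inside a crosscut\<close>

text \<open>Fashoda's theorem after clamping: the first path may leave the rectangle through its left and
  right sides, the second one through its bottom and top. Clamping the offending coordinate puts
  both paths into the rectangle, and at a crossing point neither clamp is active, because the
  other path satisfies the strict bounds there.\<close>

lemma paths_cross_in_rectangle:
  fixes \<theta> \<rho> \<phi> r :: "real \<Rightarrow> real"
  assumes cont: "continuous_on {0..1} \<theta>" "continuous_on {0..1} \<rho>" "continuous_on {0..1} \<phi>" "continuous_on {0..1} r"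
    and \<theta>: "\<theta> 0 \<le> \<alpha>" "\<beta> \<le> \<theta> 1"
    and \<phi>: "\<And>s. s \<in> {0..1} \<Longrightarrow> \<alpha> < \<phi> s \<and> \<phi> s < \<beta>"
    and r: "r 0 \<le> a" "b \<le> r 1"
    and \<rho>: "\<And>s. s \<in> {0..1} \<Longrightarrow> a < \<rho> s \<and> \<rho> s < b"
  obtains s s' where "s \<in> {0..1}" "s' \<in> {0..1}" "\<theta> s = \<phi> s'" "\<rho> s = r s'"
proof -
  have ab: "\<alpha> < \<beta>" "a < b" using \<phi>[of 0] \<rho>[of 0] by auto
  define vec2 where "vec2 x y = (\<chi> i. if i = 1 then x else y :: real^2)" for x y :: real
  have vec2_nth: "vec2 x y $ 1 = x" "vec2 x y $ 2 = y" for x y by (auto simp: vec2_def)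
  have vec2_eq: "vec2 x y = vec2 x' y' \<longleftrightarrow> x = x' \<and> y = y'" for x y x' y'
    by (auto simp: vec_eq_iff forall_2 vec2_nth)
  have cont2: "continuous_on {0..1} (\<lambda>s. vec2 (f s) (g s))"
    if "continuous_on {0..1} f" "continuous_on {0..1} g" for f g :: "real \<Rightarrow> real"
    unfolding vec2_def
  proof (rule continuous_on_vec_lambda)
    show "continuous_on {0..1} (\<lambda>s. if i = 1 then f s else g s)" for i :: 2
      using that by (cases "i = 1") auto
  qed
  define f where "f s = vec2 (max \<alpha> (min \<beta> (\<theta> s))) (\<rho> s)" for s
  define g where "g s = vec2 (\<phi> s) (max a (min b (r s)))" for s
  have box: "vec2 x y \<in> cbox (vec2 \<alpha> a) (vec2 \<beta> b) \<longleftrightarrow> \<alpha> \<le> x \<and> x \<le> \<beta> \<and> a \<le> y \<and> y \<le> b" for x y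
    by (auto simp: mem_box_cart forall_2 vec2_nth)
  obtain z where z: "z \<in> path_image f" "z \<in> path_image g"
  proof (rule fashoda[of f g "vec2 \<alpha> a" "vec2 \<beta> b"])
    show "path f" unfolding path_def f_def by (intro cont2 continuous_intros cont)
    show "path g" unfolding path_def g_def by (intro cont2 continuous_intros cont)
    show "path_image f \<subseteq> cbox (vec2 \<alpha> a) (vec2 \<beta> b)"
    proof
      fix z assume "z \<in> path_image f"
      then obtain s where "s \<in> {0..1}" "z = f s" unfolding path_image_def by blast
      then show "z \<in> cbox (vec2 \<alpha> a) (vec2 \<beta> b)"
        using \<rho>[of s] ab unfolding f_def by (simp only: box) auto
    qed
    show "path_image g \<subseteq> cbox (vec2 \<alpha> a) (vec2 \<beta> b)"
    proof
      fix z assume "z \<in> path_image g"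
      then obtain s where "s \<in> {0..1}" "z = g s" unfolding path_image_def by blast
      then show "z \<in> cbox (vec2 \<alpha> a) (vec2 \<beta> b)"
        using \<phi>[of s] ab unfolding g_def by (simp only: box) auto
    qed
  qed (use \<theta> r ab in \<open>auto simp: pathstart_def pathfinish_def f_def g_def vec2_nth\<close>)
  then obtain s s' where s: "s \<in> {0..1}" "z = f s" "s' \<in> {0..1}" "z = g s'"
    unfolding path_image_def by blast
  then have "max \<alpha> (min \<beta> (\<theta> s)) = \<phi> s'" "\<rho> s = max a (min b (r s'))"
    unfolding f_def g_def by (metis vec2_eq)+
  then have "\<theta> s = \<phi> s'" "\<rho> s = r s'"
    using \<phi>[OF s(3)] \<rho>[OF s(1)] by (auto simp: max_def min_def split: if_splits)
  with s that show ?thesis by blast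
qed

lemma Arg_bounded_if_Re_gt_cos:
  assumes w: "norm w < 1" "cos \<eta> < Re w" and \<eta>: "0 < \<eta>" "\<eta> < pi / 2"
  shows "\<bar>Arg w\<bar> < \<eta>"
proof -
  have c: "0 < cos \<eta>" using \<eta> by (intro cos_gt_zero_pi) auto
  then have Re: "Re w > 0" using w by linarith
  have e: "Re w = norm w * cos (Arg w)"
    using arg_cong[OF rcis_cmod_Arg[of w], of Re] by (simp only: Re_rcis)
  have "cos (Arg w) > 0"
    using Re unfolding e by (simp add: zero_less_mult_iff)
  then have "Re w \<le> cos (Arg w)"
    unfolding e using w mult_right_mono[of "norm w" 1 "cos (Arg w)"] by simp
  then have lt: "cos \<eta> < cos \<bar>Arg w\<bar>" using w by (simp only: cos_abs_real)
  show ?thesis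
  proof (rule ccontr)
    assume "\<not> ?thesis"
    then have "cos \<bar>Arg w\<bar> \<le> cos \<eta>"
      using \<eta> Arg_bounded[of w] by (intro cos_monotone_0_pi_le) auto
    with lt show False by simp
  qed
qed

text \<open>A curve close to the circle crosses the sector \<open>|arg z - t| \<le> \<eta>\<close>, and \<open>Re F \<le> c\<close> holds on the curve. In
  the part of the sector below the curve, \<open>Re F\<close> is compared with \<open>c\<close> plus the barrier
  \<open>K (1 - Re (z e\<^sup>-\<^sup>i\<^sup>t))\<close>. The barrier is harmonic and nonnegative, is small on the radius near
  \<open>e\<^sup>i\<^sup>t\<close>, and outside the circular cap \<open>Re (z e\<^sup>-\<^sup>i\<^sup>t) > cos \<eta>\<close> it is at least the oscillation \<open>2 M\<close> of
  \<open>Re F\<close>. A component \<open>\<Omega>\<close> of the set where the comparison fails therefore lies in the cap, cannot get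
  past the curve, and so is compactly contained in the disk, where the maximum principle applies.\<close>

lemma Re_le_inside_crosscut:
  fixes \<theta> \<rho> :: "real \<Rightarrow> real"
  assumes F: "F holomorphic_on ball 0 1" and M: "\<And>z. norm z < 1 \<Longrightarrow> \<bar>Re (F z)\<bar> \<le> M" "M > 0"
    and cont: "continuous_on {0..1} \<theta>" "continuous_on {0..1} \<rho>"
    and \<rho>: "\<And>s. s \<in> {0..1} \<Longrightarrow> r0 < \<rho> s \<and> \<rho> s < 1"
    and c: "\<And>s. s \<in> {0..1} \<Longrightarrow> Re (F (rcis (\<rho> s) (\<theta> s))) \<le> c"
    and \<eta>: "0 < \<eta>" "\<eta> < pi / 2"
    and \<theta>: "\<theta> 0 \<le> t - \<eta>" "t + \<eta> \<le> \<theta> 1"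
    and r: "0 \<le> r" "r \<le> r0"
  shows "Re (F (rcis r t)) \<le> c + 2 * M / (1 - cos \<eta>) * (1 - r)"
proof (rule ccontr)
  define K where "K = 2 * M / (1 - cos \<eta>)"
  have c1: "cos \<eta> < 1" using cos_monotone_0_pi[of 0 \<eta>] \<eta> by simp
  have K: "K > 0" "K * (1 - cos \<eta>) = 2 * M" using c1 M by (auto simp: K_def)
  define f where "f z = F z - of_real K * (1 - z * cis (- t))" for z
  have holf: "f holomorphic_on ball 0 1" unfolding f_def by (intro holomorphic_intros F)
  have Re_f: "Re (f z) = Re (F z) - K * (1 - Re (z * cis (- t)))" for z by (simp add: f_def)
  define O' where "O' = {z \<in> ball 0 1. c < Re (f z)}"
  define z0 where "z0 = rcis r t"
  have r1: "r < 1" "r0 < 1" using \<rho>[of 0] r by auto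
  assume "\<not> ?thesis"
  then have "c < Re (f z0)" unfolding Re_f z0_def K_def[symmetric]
    by (simp add: rcis_def mult.assoc cis_mult)
  then have z0: "z0 \<in> O'" using r r1 by (simp add: O'_def z0_def)
  have "open (ball 0 1 \<inter> (\<lambda>z. Re (f z)) -` {c<..})"
    by (intro continuous_open_preimage continuous_intros holomorphic_on_imp_continuous_on[OF holf]) auto
  also have "ball 0 1 \<inter> (\<lambda>z. Re (f z)) -` {c<..} = O'" by (auto simp: O'_def)
  finally have opO: "open O'" .
  \<comment> \<open>A bound below \<open>- M\<close> would be violated on the curve; so \<open>Re F - c \<le> 2 M\<close>, which puts \<open>O'\<close>
    into the cap.\<close>
  have cM: "c \<ge> - M" using c[of 0] M(1)[of "rcis (\<rho> 0) (\<theta> 0)"] \<rho>[of 0] r by auto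
  have cap: "cos \<eta> < Re (z * cis (- t))" if "z \<in> O'" for z
  proof -
    have "norm z < 1" "c < Re (F z) - K * (1 - Re (z * cis (- t)))"
      using that by (auto simp: O'_def Re_f)
    with M(1)[of z] cM have "K * (1 - Re (z * cis (- t))) < 2 * M" by linarith
    then show ?thesis unfolding K(2)[symmetric] using K(1) by simp
  qed
  define \<Omega> where "\<Omega> = connected_component_set O' z0"
  have \<Omega>: "open \<Omega>" "connected \<Omega>" "z0 \<in> \<Omega>" "\<Omega> \<subseteq> O'"
    using opO z0 by (auto simp: \<Omega>_def open_connected_component connected_component_refl
        intro: connected_component_in dest: connected_component_in)
  obtain s1 where s1: "s1 \<in> {0..1}" "\<And>s. s \<in> {0..1} \<Longrightarrow> \<rho> s \<le> \<rho> s1"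
    using continuous_attains_sup[OF compact_Icc _ cont(2)] by auto
  \<comment> \<open>A radius between the curve and the unit circle.\<close>
  define b where "b = (\<rho> s1 + 1) / 2"
  have b: "\<rho> s1 < b" "b < 1" using \<rho>[OF s1(1)] by (auto simp: b_def)
  have \<Omega>b: "norm z < b" if z: "z \<in> \<Omega>" for z
  proof (rule ccontr)
    assume nb: "\<not> norm z < b"
    obtain g where g: "path g" "path_image g \<subseteq> \<Omega>" "pathstart g = z0" "pathfinish g = z"
      using connected_open_path_connected[OF \<Omega>(1,2)] \<Omega>(3) z unfolding path_connected_def by metis
    have cg: "continuous_on {0..1} g" using g(1) by (simp add: path_def)
    have gO: "g s \<in> O'" if "s \<in> {0..1}" for s
      using g(2) \<Omega>(4) that unfolding path_image_def by blast
    have gcap: "cos \<eta> < Re (g s * cis (- t))" "norm (g s * cis (- t)) < 1" if "s \<in> {0..1}" for s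
      using cap[OF gO[OF that]] gO[OF that] by (auto simp: O'_def norm_mult)
    have cpos: "0 < cos \<eta>" using \<eta> by (intro cos_gt_zero_pi) auto
    \<comment> \<open>A path in \<open>\<Omega>\<close> from \<open>z0\<close> to the circle of radius \<open>b\<close> stays in the cap, so the principal argument gives
      continuous polar coordinates, in which it has to meet the curve.\<close>
    define \<phi> where "\<phi> s = t + Arg (g s * cis (- t))" for s
    obtain s s' where s: "s \<in> {0..1}" "s' \<in> {0..1}" "\<theta> s = \<phi> s'" "\<rho> s = norm (g s')"
    proof (rule paths_cross_in_rectangle[of \<theta> \<rho> \<phi> "\<lambda>s. norm (g s)" "t - \<eta>" "t + \<eta>" r0 b])
      have "continuous_on {0..1} (\<lambda>s. Arg (g s * cis (- t)))"
      proof (rule continuous_on_compose2[OF continuous_on_Arg])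
        show "continuous_on {0..1} (\<lambda>s. g s * cis (- t))" by (intro continuous_intros cg)
        show "(\<lambda>s. g s * cis (- t)) ` {0..1} \<subseteq> - \<real>\<^sub>\<le>\<^sub>0"
        proof
          fix w assume "w \<in> (\<lambda>s. g s * cis (- t)) ` {0..1}"
          then have "Re w > 0" using gcap(1) cpos by force
          then show "w \<in> - \<real>\<^sub>\<le>\<^sub>0" by (simp add: complex_nonpos_Reals_iff)
        qed
      qed
      then show "continuous_on {0..1} \<phi>" unfolding \<phi>_def by (intro continuous_on_add continuous_on_const)
      show "t - \<eta> < \<phi> s \<and> \<phi> s < t + \<eta>" if "s \<in> {0..1}" for s
        using Arg_bounded_if_Re_gt_cos[OF gcap(2)[OF that] gcap(1)[OF that] \<eta>] by (auto simp: \<phi>_def)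
      show "norm (g 0) \<le> r0" using g(3) r by (simp add: pathstart_def z0_def)
      show "b \<le> norm (g 1)" using g(4) nb by (simp add: pathfinish_def)
      show "r0 < \<rho> s \<and> \<rho> s < b" if "s \<in> {0..1}" for s
        using \<rho>[OF that] s1(2)[OF that] b by auto
    qed (use cont cg \<theta> in \<open>auto intro!: continuous_intros\<close>)
    have "rcis (\<rho> s) (\<theta> s) = rcis (norm (g s' * cis (- t))) (Arg (g s' * cis (- t))) * cis t"
      unfolding s \<phi>_def by (simp add: rcis_def norm_mult mult.assoc cis_mult add.commute)
    also have "\<dots> = g s'" unfolding rcis_cmod_Arg by (simp add: mult.assoc cis_mult)
    finally have "Re (F (g s')) \<le> c" using c[OF s(1)] by simp
    moreover have "Re (g s' * cis (- t)) \<le> 1"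
      using complex_Re_le_cmod[of "g s' * cis (- t)"] gcap(2)[OF s(2)] by linarith
    then have "K * (1 - Re (g s' * cis (- t))) \<ge> 0" using K by (intro mult_nonneg_nonneg) auto
    ultimately have "Re (f (g s')) \<le> c" unfolding Re_f by linarith
    with gO[OF s(2)] show False by (simp add: O'_def)
  qed
  have cl: "closure \<Omega> \<subseteq> ball 0 1"
  proof -
    have "\<Omega> \<subseteq> cball 0 b"
    proof
      fix z assume "z \<in> \<Omega>"
      from \<Omega>b[OF this] show "z \<in> cball 0 b" by simp
    qed
    then have "closure \<Omega> \<subseteq> cball 0 b" by (intro closure_minimal) auto
    then show ?thesis using b by auto
  qed
  have "Re (f z0) \<le> c"
  proof (rule maximum_real_frontier[of f \<Omega>])
    show "f holomorphic_on interior \<Omega>"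
      using cl closure_subset interior_subset by (intro holomorphic_on_subset[OF holf]) blast
    show "continuous_on (closure \<Omega>) f"
      by (rule continuous_on_subset[OF holomorphic_on_imp_continuous_on[OF holf] cl])
    show "bounded \<Omega>" using \<Omega>b by (intro bounded_subset[OF bounded_ball[of 0 b]]) auto
    fix z assume z: "z \<in> frontier \<Omega>"
    then have "z \<in> frontier O'" unfolding \<Omega>_def using frontier_of_connected_component_subset by blast
    then have "z \<notin> O'" using opO by (simp add: frontier_def interior_open)
    moreover have "z \<in> ball 0 1" using z cl by (auto simp: frontier_def)
    ultimately show "Re (f z) \<le> c" by (auto simp: O'_def)
  qed (use \<Omega> in auto)
  with z0 show False by (simp add: O'_def)
qed

section \<open>Cluster sets of a homeomorphism of the disk\<close>

lemma homeomorphism_diskD: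
  fixes h g :: "complex \<Rightarrow> complex"
  assumes "homeomorphism (ball 0 1) (ball 0 1) h g"
  shows "norm z < 1 \<Longrightarrow> norm (h z) < 1" "norm z < 1 \<Longrightarrow> g (h z) = z"
    "norm w < 1 \<Longrightarrow> norm (g w) < 1" "norm w < 1 \<Longrightarrow> h (g w) = w"
    "continuous_on (ball 0 1) h" "continuous_on (ball 0 1) g"
proof -
  show "norm (h z) < 1" if "norm z < 1"
    using homeomorphism_image1[OF assms] imageI[of z "ball 0 1" h] that by simp
  show "norm (g w) < 1" if "norm w < 1"
    using homeomorphism_image2[OF assms] imageI[of w "ball 0 1" g] that by simp
qed (use assms in \<open>auto simp: homeomorphism_def\<close>)

text \<open>A homeomorphism of the open disk maps boundary points to boundary points in the sense of limits:
  the preimage of a smaller closed disk is compact.\<close>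

lemma homeomorphism_disk_proper:
  fixes h g :: "complex \<Rightarrow> complex"
  assumes h: "homeomorphism (ball 0 1) (ball 0 1) h g" and \<rho>: "\<rho> < 1"
  obtains \<rho>' where "0 \<le> \<rho>'" "\<rho>' < 1" "\<And>z. norm z < 1 \<Longrightarrow> \<rho>' < norm z \<Longrightarrow> \<rho> < norm (h z)"
proof (cases "\<rho> < 0")
  case True
  then show ?thesis by (intro that[of 0]) (auto intro: less_le_trans)
next
  case False
  have g: "continuous_on (cball 0 \<rho>) g"
    using \<rho> by (intro continuous_on_subset[OF homeomorphism_diskD(6)[OF h]]) auto
  have "continuous_on (cball 0 \<rho>) (\<lambda>w. norm (g w))" using g by (intro continuous_intros)
  then obtain w where w: "w \<in> cball 0 \<rho>" "\<And>w'. w' \<in> cball 0 \<rho> \<Longrightarrow> norm (g w') \<le> norm (g w)"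
    using continuous_attains_sup[OF compact_cball[of "0::complex" \<rho>], of "\<lambda>w. norm (g w)"] False by auto
  show ?thesis
  proof (rule that[of "norm (g w)"])
    show "norm (g w) < 1" using homeomorphism_diskD(3)[OF h, of w] w \<rho> by simp
    fix z :: complex assume z: "norm z < 1" "norm (g w) < norm z"
    have "g (h z) = z" using homeomorphism_diskD(2)[OF h z(1)] .
    then have "h z \<notin> cball 0 \<rho>" using w(2)[of "h z"] z(2) by auto
    then show "\<rho> < norm (h z)" by simp
  qed auto
qed

text \<open>Shrinking neighbourhoods are indexed by natural numbers, so that the set is a nested
  intersection of a sequence.\<close>

definition cluster_set :: "(complex \<Rightarrow> complex) \<Rightarrow> complex \<Rightarrow> complex set" where
  "cluster_set h \<zeta> = (\<Inter>n::nat. closure (h ` (ball \<zeta> (inverse (real (Suc n))) \<inter> ball 0 1)))"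

lemma cluster_set_approach:
  assumes "b \<in> cluster_set h \<zeta>" "e > 0" "d > 0"
  obtains z where "norm z < 1" "dist z \<zeta> < e" "dist (h z) b < d"
proof -
  obtain n where n: "inverse (real (Suc n)) < e" using reals_Archimedean[OF assms(2)] by auto
  have "b \<in> closure (h ` (ball \<zeta> (inverse (real (Suc n))) \<inter> ball 0 1))"
    using assms(1) unfolding cluster_set_def by blast
  then obtain z where "z \<in> ball \<zeta> (inverse (real (Suc n))) \<inter> ball 0 1" "dist (h z) b < d"
    unfolding closure_approachable using assms(3) by blast
  with n that[of z] show ?thesis by (auto simp: dist_commute)
qed

text \<open>A nested intersection of compact connected sets, since a disk intersected with the unit disk is
  convex.\<close>

lemma connected_cluster_set:
  assumes h: "homeomorphism (ball 0 1) (ball 0 1) h g"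
  shows "connected (cluster_set h \<zeta>)"
  unfolding cluster_set_def
proof (rule connected_nest)
  fix n :: nat
  let ?S = "ball \<zeta> (inverse (real (Suc n))) \<inter> ball 0 1"
  note c = homeomorphism_diskD(5)[OF h]
  have "h ` ?S \<subseteq> cball 0 1"
    using homeomorphism_diskD(1)[OF h] by (intro image_subsetI) (simp add: less_imp_le)
  then show "compact (closure (h ` ?S))"
    by (rule compact_closure_in_cball)
  have "connected (h ` ?S)"
    by (intro connected_continuous_image continuous_on_subset[OF c] convex_connected convex_Int) auto
  then show "connected (closure (h ` ?S))" by (rule connected_imp_connected_closure)
next
  fix m n :: nat assume "m \<le> n"
  then have "inverse (real (Suc n)) \<le> inverse (real (Suc m))" by (intro le_imp_inverse_le) auto
  then have "ball \<zeta> (inverse (real (Suc n))) \<subseteq> ball \<zeta> (inverse (real (Suc m)))" by (rule subset_ball)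
  then show "closure (h ` (ball \<zeta> (inverse (real (Suc n))) \<inter> ball 0 1)) \<subseteq>
        closure (h ` (ball \<zeta> (inverse (real (Suc m))) \<inter> ball 0 1))"
    by (intro closure_mono) auto
qed

lemma cluster_set_subset_circle:
  assumes h: "homeomorphism (ball 0 1) (ball 0 1) h g" and \<zeta>: "norm \<zeta> = 1"
  shows "cluster_set h \<zeta> \<subseteq> sphere 0 1"
proof
  fix b assume b: "b \<in> cluster_set h \<zeta>"
  note him = homeomorphism_diskD(1)[OF h]
  have le: "norm b \<le> 1"
  proof (rule ccontr)
    assume "\<not> norm b \<le> 1"
    then obtain z where "norm z < 1" "dist (h z) b < norm b - 1"
      using cluster_set_approach[OF b, of 1 "norm b - 1"] by auto
    with him[of z] show False using norm_triangle_ineq3[of b "h z"] by (simp add: dist_norm norm_minus_commute)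
  qed
  have ge: "norm b \<ge> 1"
  proof (rule ccontr)
    assume nb: "\<not> norm b \<ge> 1"
    define \<rho> where "\<rho> = (norm b + 1) / 2"
    have \<rho>: "norm b < \<rho>" "\<rho> < 1" using nb by (auto simp: \<rho>_def)
    obtain \<rho>' where \<rho>': "\<rho>' < 1" "\<And>z. norm z < 1 \<Longrightarrow> \<rho>' < norm z \<Longrightarrow> \<rho> < norm (h z)"
      using homeomorphism_disk_proper[OF h \<rho>(2)] by metis
    obtain z where z: "norm z < 1" "dist z \<zeta> < 1 - \<rho>'" "dist (h z) b < \<rho> - norm b"
      using cluster_set_approach[OF b, of "1 - \<rho>'" "\<rho> - norm b"] \<rho> \<rho>' by auto
    have "\<rho>' < norm z"
      using z(2) \<zeta> norm_triangle_ineq3[of z \<zeta>] by (simp add: dist_norm)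
    from \<rho>'(2)[OF z(1) this] z(3) show False
      using norm_triangle_ineq3[of b "h z"] by (simp add: dist_norm norm_minus_commute)
  qed
  show "b \<in> sphere 0 1" using le ge by simp
qed

section \<open>Radial limits off a countable set of angles\<close>

text \<open>Angles are determined only modulo \<open>2\<pi>\<close>; the integer \<open>k\<close> records the winding of a continuous
  lift.\<close>

lemma angle_close_if_dist_small:
  assumes "\<eta> > 0"
  obtains e where "e > 0" "\<And>r \<theta>. r > 0 \<Longrightarrow> dist (rcis r \<theta>) (cis t) < e \<Longrightarrow> \<exists>k::int. \<bar>\<theta> - t - 2 * pi * of_int k\<bar> < \<eta>"
proof -
  have "isCont Arg 1" by (rule continuous_at_Arg) auto
  then obtain e where e: "e > 0" "\<And>w. dist w 1 < e \<Longrightarrow> \<bar>Arg w\<bar> < \<eta>"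
    using assms unfolding continuous_at_eps_delta by (auto simp: dist_real_def)
  show ?thesis
  proof (rule that[OF e(1)])
    fix r \<theta> :: real assume r: "r > 0" and d: "dist (rcis r \<theta>) (cis t) < e"
    let ?w = "rcis r (\<theta> - t)"
    have "dist ?w 1 = norm ((rcis r \<theta> - cis t) * cis (- t))"
      by (simp add: dist_norm left_diff_distrib rcis_def cis_mult mult.assoc)
    also have "\<dots> = dist (rcis r \<theta>) (cis t)" by (simp add: norm_mult dist_norm)
    finally have "dist ?w 1 < e" using d by simp
    then have A: "\<bar>Arg ?w\<bar> < \<eta>" by (rule e)
    have "cis (Arg ?w) = sgn ?w" using r by (intro cis_Arg) (simp add: rcis_eq_zero_iff)
    also have "\<dots> = cis (\<theta> - t)" using r by (simp add: sgn_div_norm rcis_def norm_mult scaleR_conv_of_real)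
    finally have "sin (Arg ?w) = sin (\<theta> - t) \<and> cos (Arg ?w) = cos (\<theta> - t)"
      by (simp add: complex_eq_iff)
    then obtain k :: int where "\<theta> - t = Arg ?w + 2 * pi * of_int k"
      using sin_cos_eq_iff[of "\<theta> - t" "Arg ?w"] by (auto simp: mult_ac)
    then show "\<exists>k::int. \<bar>\<theta> - t - 2 * pi * of_int k\<bar> < \<eta>" using A by (intro exI[of _ k]) simp
  qed
qed

lemma polar_lift_of_path:
  assumes p: "continuous_on {0..1} p" "\<And>s. s \<in> {0..1} \<Longrightarrow> p s \<noteq> 0"
  obtains \<theta> :: "real \<Rightarrow> real" where "continuous_on {0..1} \<theta>" "\<And>s. s \<in> {0..1} \<Longrightarrow> p s = rcis (norm (p s)) (\<theta> s)"
proof -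
  obtain l where l: "continuous_on {0..1} l" "\<And>s. s \<in> {0..1} \<Longrightarrow> p s = exp (l s)"
    using continuous_logarithm_on_contractible[OF p(1) convex_imp_contractible p(2)] by auto
  show ?thesis
  proof (rule that[of "\<lambda>s. Im (l s)"])
    show "continuous_on {0..1} (\<lambda>s. Im (l s))" by (intro continuous_intros l)
    show "p s = rcis (norm (p s)) (Im (l s))" if "s \<in> {0..1}" for s
      unfolding l(2)[OF that] by (simp add: exp_eq_polar rcis_def norm_mult)
  qed
qed

text \<open>By compactness one of the nested sets that define the cluster set is already contained in any given
  neighbourhood of \<open>a\<close>.\<close>

lemma radial_limit_if_singleton_cluster_set:
  assumes h: "homeomorphism (ball 0 1) (ball 0 1) h g" and C: "cluster_set h (cis t) = {a}"
  shows "((\<lambda>r. h (rcis r t)) \<longlongrightarrow> a) (at_left 1)"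
  unfolding tendsto_def
proof (intro allI impI)
  fix S assume S: "open S" "a \<in> S"
  let ?C = "\<lambda>n::nat. closure (h ` (ball (cis t) (inverse (real (Suc n))) \<inter> ball 0 1))"
  have "\<exists>n. ?C n \<subseteq> S"
  proof (rule ccontr)
    assume no: "\<not> ?thesis"
    have "(\<Inter>n. ?C n - S) \<noteq> {}"
    proof (rule compact_nest)
      fix n
      have "h ` (ball (cis t) (inverse (real (Suc n))) \<inter> ball 0 1) \<subseteq> cball 0 1"
        using homeomorphism_diskD(1)[OF h] by (intro image_subsetI) (simp add: less_imp_le)
      then have "compact (?C n)" by (rule compact_closure_in_cball)
      then show "compact (?C n - S)" using S by (intro compact_diff)
      show "?C n - S \<noteq> {}" using no by blast
    next
      fix m n :: nat assume "m \<le> n"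
      then have "inverse (real (Suc n)) \<le> inverse (real (Suc m))" by (intro le_imp_inverse_le) auto
      then have "ball (cis t) (inverse (real (Suc n))) \<subseteq> ball (cis t) (inverse (real (Suc m)))" by (rule subset_ball)
      then have "?C n \<subseteq> ?C m" by (intro closure_mono) auto
      then show "?C n - S \<subseteq> ?C m - S" by blast
    qed
    then have "cluster_set h (cis t) - S \<noteq> {}" unfolding cluster_set_def by blast
    then show False using C S by auto
  qed
  then obtain n where n: "?C n \<subseteq> S" ..
  have "h (rcis r t) \<in> S" if r: "1 - inverse (real (Suc n)) < r" "0 < r" "r < 1" for r
  proof -
    have "dist (cis t) (rcis r t) = norm ((1 - of_real r) * cis t)"
      by (simp add: dist_norm rcis_def left_diff_distrib)
    also have "\<dots> = 1 - r"
      using r by (simp add: norm_mult) (metis abs_of_pos diff_gt_0_iff_gt norm_of_real of_real_1 of_real_diff)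
    finally have "rcis r t \<in> ball (cis t) (inverse (real (Suc n))) \<inter> ball 0 1" using r by simp
    then have "h (rcis r t) \<in> ?C n" by (intro subsetD[OF closure_subset] imageI)
    with n show ?thesis by blast
  qed
  moreover have "eventually (\<lambda>r. r \<in> {max 0 (1 - inverse (real (Suc n)))<..<1}) (at_left (1::real))"
    by (intro eventually_at_leftI[of "max 0 (1 - inverse (real (Suc n)))"]) auto
  ultimately show "eventually (\<lambda>r. h (rcis r t) \<in> S) (at_left 1)"
    by (auto elim!: eventually_mono)
qed

lemma bounded_parametrization:
  fixes h :: "complex \<Rightarrow> complex" and \<Phi> \<tau> :: "complex \<Rightarrow> 'a::real_normed_vector"
  assumes h: "homeomorphism (ball 0 1) (ball 0 1) h g" and \<Phi>: "continuous_on (cball 0 1) \<Phi>"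
    and \<tau>: "\<And>z. norm z < 1 \<Longrightarrow> \<tau> z = \<Phi> (h z)"
  obtains M where "M > 0" "\<And>z. norm z < 1 \<Longrightarrow> norm (\<tau> z) \<le> M"
proof -
  have "bounded (\<Phi> ` cball 0 1)" by (intro compact_imp_bounded compact_continuous_image \<Phi>) auto
  then obtain M where M: "M > 0" "\<And>w. w \<in> cball 0 1 \<Longrightarrow> norm (\<Phi> w) \<le> M"
    unfolding bounded_pos by auto
  show ?thesis
  proof (rule that[OF M(1)])
    fix z :: complex assume "norm z < 1"
    then show "norm (\<tau> z) \<le> M" using homeomorphism_diskD(1)[OF h, of z] M(2)[of "h z"] \<tau>[of z] by simp
  qed
qed

context
  fixes h g :: "complex \<Rightarrow> complex" and \<Phi> \<tau> :: "complex \<Rightarrow> real^'n" and F :: "'n \<Rightarrow> complex \<Rightarrow> complex"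
  assumes h: "homeomorphism (ball 0 1) (ball 0 1) h g"
    and \<Phi>: "continuous_on (cball 0 1) \<Phi>" "inj_on \<Phi> (cball 0 1)"
    and \<tau>: "\<And>z. norm z < 1 \<Longrightarrow> \<tau> z = \<Phi> (h z)"
    and F: "\<And>i. F i holomorphic_on ball 0 1" "\<And>z. norm z < 1 \<Longrightarrow> \<tau> z = (\<chi> i. Re (F i z))"
begin

text \<open>Since \<open>b\<close> is a cluster value at both points, the preimage of a short chord near \<open>b\<close> runs close to
  the circle from the direction \<open>t\<close> to the direction \<open>t'\<close>, and \<open>\<tau>\<close> is almost \<open>\<Phi> b\<close> on it. Depending on its
  winding it crosses the sector around \<open>(t + t')/2\<close> or the opposite one around \<open>(t + t')/2 - \<pi>\<close>. The
  crosscut lemma, applied to \<open>c \<bullet> \<tau>\<close> for all \<open>c\<close> of norm at most one, then locates \<open>\<tau>\<close> on the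
  central radius of that sector.\<close>

lemma close_to_common_cluster_value:
  assumes t: "t < t'" "t' < t + 2 * pi"
    and b: "b \<in> cluster_set h (cis t)" "b \<in> cluster_set h (cis t')"
    and M: "M > 0" "\<And>z. norm z < 1 \<Longrightarrow> norm (\<tau> z) \<le> M"
    and \<eta>: "0 < \<eta>" "2 * \<eta> \<le> (t' - t) / 2" "2 * \<eta> \<le> pi - (t' - t) / 2"
    and \<epsilon>: "\<epsilon> > 0" and r: "0 < r" "r < 1" "2 * M / (1 - cos \<eta>) * (1 - r) \<le> \<epsilon>"
  shows "norm (\<tau> (rcis r ((t + t') / 2)) - \<Phi> b) \<le> 2 * \<epsilon> \<or> norm (\<tau> (rcis r ((t + t') / 2 - pi)) - \<Phi> b) \<le> 2 * \<epsilon>"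
proof -
  have b1: "norm b = 1" using cluster_set_subset_circle[OF h, of "cis t"] b by auto
  have \<eta>2: "\<eta> < pi / 2" using \<eta> t by simp
  obtain \<delta> where \<delta>: "\<delta> > 0" "\<And>w. w \<in> cball 0 1 \<Longrightarrow> dist w b < \<delta> \<Longrightarrow> dist (\<Phi> w) (\<Phi> b) < \<epsilon>"
    using \<Phi>(1) \<epsilon> b1 unfolding continuous_on_iff by (metis mem_cball_0 order_refl)
  obtain \<rho>' where \<rho>': "\<rho>' < 1" "\<And>w. norm w < 1 \<Longrightarrow> \<rho>' < norm w \<Longrightarrow> r < norm (g w)"
    using homeomorphism_disk_proper[OF homeomorphism_symD[OF h] r(2)] by metis
  define \<delta>' where "\<delta>' = min \<delta> (1 - \<rho>')"
  have \<delta>': "\<delta>' > 0" "\<delta>' \<le> \<delta>" "\<delta>' \<le> 1 - \<rho>'" using \<delta> \<rho>' by (auto simp: \<delta>'_def)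
  obtain e where e: "e > 0" "\<And>r \<theta>. r > 0 \<Longrightarrow> dist (rcis r \<theta>) (cis t) < e \<Longrightarrow> \<exists>k::int. \<bar>\<theta> - t - 2 * pi * of_int k\<bar> < \<eta>"
    using angle_close_if_dist_small[OF \<eta>(1)] by metis
  obtain e' where e': "e' > 0" "\<And>r \<theta>. r > 0 \<Longrightarrow> dist (rcis r \<theta>) (cis t') < e' \<Longrightarrow> \<exists>k::int. \<bar>\<theta> - t' - 2 * pi * of_int k\<bar> < \<eta>"
    using angle_close_if_dist_small[OF \<eta>(1)] by metis
  obtain z where z: "norm z < 1" "dist z (cis t) < e" "dist (h z) b < \<delta>'"
    using cluster_set_approach[OF b(1) e(1) \<delta>'(1)] by metis
  obtain z' where z': "norm z' < 1" "dist z' (cis t') < e'" "dist (h z') b < \<delta>'"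
    using cluster_set_approach[OF b(2) e'(1) \<delta>'(1)] by metis
  \<comment> \<open>The preimage of the chord from \<open>h z\<close> to \<open>h z'\<close> stays close to the circle, because the
    chord stays close to the boundary point \<open>b\<close>.\<close>
  define q where "q = linepath (h z) (h z')"
  have q: "norm (q s) < 1" "dist (q s) b < \<delta>'" if s: "s \<in> {0..1}" for s
  proof -
    have "closed_segment (h z) (h z') \<subseteq> ball 0 1 \<inter> ball b \<delta>'"
      using homeomorphism_diskD(1)[OF h z(1)] homeomorphism_diskD(1)[OF h z'(1)] z(3) z'(3)
      by (intro closed_segment_subset convex_Int) (auto simp: dist_commute)
    moreover have "q s \<in> closed_segment (h z) (h z')"
      using s unfolding q_def path_image_linepath[symmetric] path_image_def by blast
    ultimately have "q s \<in> ball 0 1 \<inter> ball b \<delta>'" by blast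
    then show "norm (q s) < 1" "dist (q s) b < \<delta>'" by (auto simp: dist_commute)
  qed
  have q_big: "\<rho>' < norm (q s)" if s: "s \<in> {0..1}" for s
    using q(2)[OF s] \<delta>'(3) b1 norm_triangle_ineq3[of "q s" b] by (simp add: dist_norm)
  define p where "p s = g (q s)" for s
  have p: "norm (p s) < 1" "r < norm (p s)" "h (p s) = q s" if "s \<in> {0..1}" for s
    using homeomorphism_diskD(3,4)[OF h q(1)[OF that]] \<rho>'(2)[OF q(1)[OF that] q_big[OF that]] by (auto simp: p_def)
  have cp: "continuous_on {0..1} p" unfolding p_def q_def
  proof (rule continuous_on_compose2[of "ball 0 1" g])
    show "continuous_on (ball 0 1) g" by (rule homeomorphism_diskD(6)[OF h])
    show "linepath (h z) (h z') ` {0..1} \<subseteq> ball 0 1" using q(1) by (auto simp: q_def)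
  qed (rule continuous_on_linepath)
  have p01: "p 0 = z" "p 1 = z'" using homeomorphism_diskD(2)[OF h] z z' by (auto simp: p_def q_def linepath_def)
  have near: "norm (\<tau> (p s) - \<Phi> b) \<le> \<epsilon>" if "s \<in> {0..1}" for s
    using \<delta>(2)[of "q s"] q[OF that] p[OF that] \<delta>' \<tau>[of "p s"] by (simp add: dist_norm)
  obtain \<theta> where \<theta>: "continuous_on {0..1} \<theta>" "\<And>s. s \<in> {0..1} \<Longrightarrow> p s = rcis (norm (p s)) (\<theta> s)"
    using polar_lift_of_path[OF cp] p r by (metis less_trans norm_zero less_irrefl)
  have pos: "norm (p 0) > 0" "norm (p 1) > 0" using p[of 0] p[of 1] r by auto
  obtain k :: int where k: "\<bar>\<theta> 0 - t - 2 * pi * of_int k\<bar> < \<eta>"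
    using e(2)[OF pos(1), of "\<theta> 0"] \<theta>(2)[of 0] z(2) p01 by auto
  obtain k' :: int where k': "\<bar>\<theta> 1 - t' - 2 * pi * of_int k'\<bar> < \<eta>"
    using e'(2)[OF pos(2), of "\<theta> 1"] \<theta>(2)[of 1] z'(2) p01 by auto
  have inside: "norm (\<tau> (rcis r t0) - \<Phi> b) \<le> 2 * \<epsilon>"
    if cont: "continuous_on {0..1} \<theta>'" "continuous_on {0..1} \<rho>"
      and cross: "\<theta>' 0 \<le> t0 - \<eta>" "t0 + \<eta> \<le> \<theta>' 1"
      and on_path: "\<And>s. s \<in> {0..1} \<Longrightarrow> \<exists>s'\<in>{0..1}. rcis (\<rho> s) (\<theta>' s) = p s' \<and> \<rho> s = norm (p s')" for \<theta>' \<rho> :: "real \<Rightarrow> real" and t0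
  proof (rule norm_le_if_inner_le)
    fix c :: "real^'n" assume c: "norm c \<le> 1"
    define G where "G z = (\<Sum>i\<in>UNIV. of_real (c $ i) * F i z)" for z
    have Re_G: "Re (G z) = c \<bullet> \<tau> z" if "norm z < 1" for z
      using F(2)[OF that] by (simp add: G_def inner_Re_components)
    have "Re (G (rcis r t0)) \<le> (c \<bullet> \<Phi> b + \<epsilon>) + 2 * M / (1 - cos \<eta>) * (1 - r)"
    proof (rule Re_le_inside_crosscut[where r0=r and \<theta>=\<theta>' and \<rho>=\<rho>])
      show "G holomorphic_on ball 0 1" unfolding G_def by (intro holomorphic_intros F)
      show "\<bar>Re (G z)\<bar> \<le> M" if "norm z < 1" for z
        unfolding Re_G[OF that]
        using M(2)[OF that] inner_le_norm_if_norm_le_1[OF c, of "\<tau> z"] inner_le_norm_if_norm_le_1[of "-c" "\<tau> z"] c by (simp add: abs_le_iff)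
      fix s :: real assume "s \<in> {0..1}"
      from on_path[OF this] obtain s' where s': "s' \<in> {0..1}" "rcis (\<rho> s) (\<theta>' s) = p s'" "\<rho> s = norm (p s')" by blast
      show "r < \<rho> s \<and> \<rho> s < 1" using s' p by simp
      have "c \<bullet> (\<tau> (p s') - \<Phi> b) \<le> \<epsilon>"
        using inner_le_norm_if_norm_le_1[OF c, of "\<tau> (p s') - \<Phi> b"] near[OF s'(1)] by linarith
      then show "Re (G (rcis (\<rho> s) (\<theta>' s))) \<le> c \<bullet> \<Phi> b + \<epsilon>"
        unfolding s'(2) using Re_G[of "p s'"] p[OF s'(1)] by (simp add: inner_diff_right)
    qed (use cont cross \<eta> \<eta>2 M r in auto)
    then show "c \<bullet> (\<tau> (rcis r t0) - \<Phi> b) \<le> 2 * \<epsilon>"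
      using Re_G[of "rcis r t0"] r by (simp add: inner_diff_right)
  qed
  have rot: "rcis x (y - 2 * pi * of_int k) = rcis x y" for x y
  proof -
    have "cis (y - 2 * pi * of_int k) = cis y * inverse (cis (2 * pi * of_int k))"
      by (simp add: cis_divide[symmetric] divide_inverse)
    also have "cis (2 * pi * of_int k) = 1" by (intro cis_multiple_2pi) auto
    finally show ?thesis by (simp add: rcis_def)
  qed
  consider "k' \<ge> k" | "k' \<le> k - 1" by linarith
  then show ?thesis
  proof cases
    case 1
    have "norm (\<tau> (rcis r ((t + t') / 2)) - \<Phi> b) \<le> 2 * \<epsilon>"
    proof (rule inside[of "\<lambda>s. \<theta> s - 2 * pi * of_int k" "\<lambda>s. norm (p s)"])
      define w w' where "w = 2 * pi * real_of_int k" and "w' = 2 * pi * real_of_int k'"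
      have "w \<le> w'" using 1 by (simp add: w_def w'_def)
      moreover have "\<bar>\<theta> 1 - t' - w'\<bar> < \<eta>" using k' by (simp only: w'_def)
      ultimately have "(t + t') / 2 + \<eta> \<le> \<theta> 1 - w" using \<eta> by (simp add: abs_less_iff field_simps)
      then show "(t + t') / 2 + \<eta> \<le> \<theta> 1 - 2 * pi * of_int k" by (simp only: w_def)
      show "\<theta> 0 - 2 * pi * of_int k \<le> (t + t') / 2 - \<eta>"
        using k \<eta> by (simp add: field_simps abs_less_iff)
      show "\<exists>s'\<in>{0..1}. rcis (norm (p s)) (\<theta> s - 2 * pi * of_int k) = p s' \<and> norm (p s) = norm (p s')"
        if "s \<in> {0..1}" for s
        using \<theta>(2)[OF that] that unfolding rot by auto
    qed (intro continuous_intros \<theta> cp)+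
    then show ?thesis ..
  next
    case 2
    \<comment> \<open>The path runs the other way round the circle; reversed, it crosses the opposite sector.\<close>
    have rev: "continuous_on {0..1} (\<lambda>s. f (1 - s))" if "continuous_on {0..1} f" for f :: "real \<Rightarrow> 'z::topological_space"
      by (rule continuous_on_compose2[OF that]) (auto intro!: continuous_intros)
    have "norm (\<tau> (rcis r ((t + t') / 2 - pi)) - \<Phi> b) \<le> 2 * \<epsilon>"
    proof (rule inside[of "\<lambda>s. \<theta> (1 - s) - 2 * pi * of_int k" "\<lambda>s. norm (p (1 - s))"])
      have "2 * pi * of_int k' \<le> 2 * pi * (of_int (k - 1) :: real)"
        using 2 by (intro mult_left_mono) (simp_all only: of_int_le_iff, simp)
      then have k2: "2 * pi * of_int k' \<le> 2 * pi * (of_int k :: real) - 2 * pi"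
        by (simp add: right_diff_distrib)
      then show "\<theta> (1 - 0) - 2 * pi * of_int k \<le> (t + t') / 2 - pi - \<eta>"
        using k' \<eta> by (simp add: field_simps abs_less_iff)
      show "(t + t') / 2 - pi + \<eta> \<le> \<theta> (1 - 1) - 2 * pi * of_int k"
        using k \<eta> by (simp add: field_simps abs_less_iff)
      show "\<exists>s'\<in>{0..1}. rcis (norm (p (1 - s))) (\<theta> (1 - s) - 2 * pi * of_int k) = p s' \<and> norm (p (1 - s)) = norm (p s')"
        if "s \<in> {0..1}" for s
        using \<theta>(2)[of "1 - s"] that unfolding rot by (intro bexI[of _ "1 - s"]) auto
    qed (intro continuous_intros rev[OF \<theta>(1)] rev[OF cp])+
    then show ?thesis ..
  qed
qed

text \<open>Pigeonhole: among three distinct values of \<open>\<Phi>\<close> taken on the common arc, two are approximated by \<open>\<tau>\<close> at one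
  and the same of two points.\<close>

lemma no_common_cluster_arc:
  assumes t: "t < t'" "t' < t + 2 * pi" and xy: "x < y" "y \<le> x + 2 * pi"
    and b: "cis ` {x<..<y} \<subseteq> cluster_set h (cis t)" "cis ` {x<..<y} \<subseteq> cluster_set h (cis t')"
  shows False
proof -
  obtain M where M: "M > 0" "\<And>z. norm z < 1 \<Longrightarrow> norm (\<tau> z) \<le> M" using bounded_parametrization[OF h \<Phi>(1) \<tau>] by metis
  define X where "X j = x + (y - x) * (real j + 1) / 4" for j :: nat
  have X: "x < X j" "X j < y" if "j < 3" for j
  proof -
    show "x < X j" using xy by (simp add: X_def)
    have "(y - x) * (real j + 1) < (y - x) * 4" using xy that by (intro mult_strict_left_mono) auto
    then show "X j < y" by (simp add: X_def)
  qed
  define P where "P j = \<Phi> (cis (X j))" for j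
  have P_ne: "P j \<noteq> P k" if "j < k" "k < 3" for j k
  proof
    assume "P j = P k"
    then have "cis (X j) = cis (X k)" unfolding P_def by (rule inj_onD[OF \<Phi>(2)]) auto
    then have "sin (X j) = sin (X k) \<and> cos (X j) = cos (X k)" by (simp add: complex_eq_iff)
    then obtain m :: int where m: "X j = X k + 2 * m * pi" using sin_cos_eq_iff[of "X j" "X k"] by auto
    have "X j < X k" using that xy by (simp add: X_def divide_strict_right_mono mult_strict_left_mono)
    then have "real_of_int m * pi < 0" using m by (simp add: mult.commute)
    then have "m \<le> - 1" by (simp add: mult_less_0_iff)
    then have "real_of_int m \<le> - 1" by (metis of_int_1 of_int_le_iff of_int_minus)
    then have "2 * pi * real_of_int m \<le> 2 * pi * - 1" by (intro mult_left_mono) auto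
    then have "X k \<ge> X j + 2 * pi" using m by (simp add: mult_ac)
    then show False using X[of j] X[of k] that xy by simp
  qed
  define d where "d = min (dist (P 0) (P 1)) (min (dist (P 0) (P 2)) (dist (P 1) (P 2)))"
  have d: "d > 0" using P_ne[of 0 1] P_ne[of 0 2] P_ne[of 1 2] by (simp add: d_def)
  have d_le: "d \<le> dist (P 0) (P 1)" "d \<le> dist (P 0) (P 2)" "d \<le> dist (P 1) (P 2)" by (auto simp: d_def)
  \<comment> \<open>Two values within \<open>2 \<epsilon>\<close> of one point have distance at most \<open>4 \<epsilon> < d\<close>. The half-width \<open>\<eta>\<close> leaves
    a margin \<open>\<eta>\<close> to the directions \<open>t\<close> and \<open>t'\<close> on both sides, and \<open>r\<close> makes the barrier at most \<open>\<epsilon>\<close>.\<close>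
  define \<epsilon> where "\<epsilon> = d / 5"
  define \<eta> where "\<eta> = min ((t' - t) / 4) (pi / 2 - (t' - t) / 4)"
  have \<eta>: "0 < \<eta>" "2 * \<eta> \<le> (t' - t) / 2" "2 * \<eta> \<le> pi - (t' - t) / 2"
    using t by (auto simp: \<eta>_def min_def field_simps)
  have "\<eta> < pi" using \<eta> t by simp
  define K where "K = 2 * M / (1 - cos \<eta>)"
  have "cos \<eta> < 1" using cos_monotone_0_pi[of 0 \<eta>] \<eta> \<open>\<eta> < pi\<close> by simp
  then have K: "K > 0" using M by (simp add: K_def)
  define r where "r = max (1/2) (1 - \<epsilon> / K)"
  have \<epsilon>: "\<epsilon> > 0" using d by (simp add: \<epsilon>_def)
  have "K * (1 - r) \<le> K * (\<epsilon> / K)" using K by (intro mult_left_mono) (auto simp: r_def)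
  then have r: "0 < r" "r < 1" "K * (1 - r) \<le> \<epsilon>" using K \<epsilon> by (auto simp: r_def)
  let ?u = "\<tau> (rcis r ((t + t') / 2))" and ?v = "\<tau> (rcis r ((t + t') / 2 - pi))"
  have either: "norm (?u - P j) \<le> 2 * \<epsilon> \<or> norm (?v - P j) \<le> 2 * \<epsilon>" if "j < 3" for j
    unfolding P_def
    by (rule close_to_common_cluster_value[OF t _ _ M \<eta> \<epsilon> r[unfolded K_def]])
       (use b X[OF that] in auto)
  \<comment> \<open>Three values but only two sides: two of the values are attained nearly at the same point.\<close>
  have far: "\<not> (norm (w - P j) \<le> 2 * \<epsilon> \<and> norm (w - P k) \<le> 2 * \<epsilon>)" if "d \<le> dist (P j) (P k)" for w j k
    using dist_triangle3[of "P j" "P k" w] that d by (simp add: dist_norm \<epsilon>_def)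
  show False using either[of 0] either[of 1] either[of 2] far[OF d_le(1)] far[OF d_le(2)] far[OF d_le(3)] by auto
qed

text \<open>A cluster set with more than one point contains an arc with rational end angles, and by the preceding
  lemma the arc determines the angle \<open>t\<close>.\<close>

lemma countable_nonsingleton_cluster_sets:
  "countable {t \<in> {0..<2*pi}. \<not> (\<exists>a. cluster_set h (cis t) = {a})}" (is "countable ?E")
proof -
  have ne: "cluster_set h \<zeta> \<noteq> {}" if \<zeta>: "norm \<zeta> = 1" for \<zeta>
    unfolding cluster_set_def
  proof (rule compact_nest)
    fix n :: nat
    let ?S = "ball \<zeta> (inverse (real (Suc n))) \<inter> ball 0 1"
    have "h ` ?S \<subseteq> cball 0 1" using homeomorphism_diskD(1)[OF h] by (intro image_subsetI) (simp add: less_imp_le)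
    then show "compact (closure (h ` ?S))"
      by (rule compact_closure_in_cball)
    have "\<zeta> \<in> closure (ball 0 1)" using \<zeta> by simp
    then have "?S \<noteq> {}" unfolding closure_approachable
      by (metis IntI dist_commute empty_iff inverse_positive_iff_positive mem_ball of_nat_0_less_iff zero_less_Suc)
    then show "closure (h ` ?S) \<noteq> {}" by simp
  next
    fix m n :: nat assume "m \<le> n"
    then have "inverse (real (Suc n)) \<le> inverse (real (Suc m))" by (intro le_imp_inverse_le) auto
    then have "ball \<zeta> (inverse (real (Suc n))) \<subseteq> ball \<zeta> (inverse (real (Suc m)))" by (rule subset_ball)
    then show "closure (h ` (ball \<zeta> (inverse (real (Suc n))) \<inter> ball 0 1)) \<subseteq>
          closure (h ` (ball \<zeta> (inverse (real (Suc m))) \<inter> ball 0 1))"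
      by (intro closure_mono) auto
  qed
  define arc where "arc t ab \<longleftrightarrow> (case ab of (a, b) \<Rightarrow> real_of_rat a < real_of_rat b \<and> real_of_rat b \<le> real_of_rat a + 2 * pi \<and>
      cis ` {real_of_rat a<..<real_of_rat b} \<subseteq> cluster_set h (cis t))" for t ab
  have ex: "\<exists>ab. arc t ab" if t: "t \<in> ?E" for t
  proof -
    let ?C = "cluster_set h (cis t)"
    have sph: "?C \<subseteq> sphere 0 1" by (rule cluster_set_subset_circle[OF h]) simp
    obtain u where u: "u \<in> ?C" using ne[of "cis t"] by auto
    obtain v where v: "v \<in> ?C" "v \<noteq> u" using t u by blast
    define x where "x = Arg2pi u" define y where "y = Arg2pi v"
    have cu: "cis x = u" "cis y = v" unfolding x_def y_def using u v sph
      by (metis Arg2pi_eq cis_conv_exp mem_sphere_0 mult_1 norm_one of_real_1 subsetD complex_norm_eq_1_exp_eq)+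
    have rng: "0 \<le> x" "x < 2 * pi" "0 \<le> y" "y < 2 * pi" unfolding x_def y_def by (auto intro: Arg2pi_ge_0 Arg2pi_lt_2pi)
    have "\<exists>p q. p < q \<and> q \<le> p + 2 * pi \<and> cis ` {p..q} \<subseteq> ?C"
    proof (cases "x < y")
      case True
      then have "cis ` {x..y} \<subseteq> ?C \<or> cis ` {y..x + 2 * pi} \<subseteq> ?C"
        using cu u v rng by (intro connected_on_circle_contains_arc connected_cluster_set[OF h] sph) auto
      then show ?thesis
        using True rng by (elim disjE; intro exI conjI; (assumption | simp))
    next
      case False
      then have yx: "y < x" using cu v by (metis linorder_neqE_linordered_idom)
      then have "cis ` {y..x} \<subseteq> ?C \<or> cis ` {x..y + 2 * pi} \<subseteq> ?C"
        using cu u v rng by (intro connected_on_circle_contains_arc connected_cluster_set[OF h] sph) auto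
      then show ?thesis
        using yx rng by (elim disjE; intro exI conjI; (assumption | simp))
    qed
    then obtain p q where pq: "p < q" "q \<le> p + 2 * pi" "cis ` {p..q} \<subseteq> ?C" by blast
    obtain a where a: "p < real_of_rat a" "real_of_rat a < q" using of_rat_dense[OF pq(1)] by blast
    obtain b where b: "real_of_rat a < real_of_rat b" "real_of_rat b < q" using of_rat_dense[OF a(2)] by blast
    have "arc t (a, b)" unfolding arc_def using a b pq by fastforce
    then show ?thesis ..
  qed
  define f where "f t = (SOME ab. arc t ab)" for t
  have f: "arc t (f t)" if "t \<in> ?E" for t
    using someI_ex[OF ex[OF that]] by (simp add: f_def)
  have inj: "t = t'" if "t \<in> ?E" "t' \<in> ?E" "f t = f t'" for t t'
  proof (rule ccontr)
    obtain a b where ab: "f t = (a, b)" by fastforce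
    have A: "arc t (a, b)" "arc t' (a, b)" using f[OF that(1)] f[OF that(2)] that(3) ab by auto
    assume "t \<noteq> t'"
    then consider "t < t'" | "t' < t" by linarith
    then show False
    proof cases
      case 1 show False
        by (rule no_common_cluster_arc[OF 1, of "real_of_rat a" "real_of_rat b"]) (use A that in \<open>auto simp: arc_def\<close>)
    next
      case 2 show False
        by (rule no_common_cluster_arc[OF 2, of "real_of_rat a" "real_of_rat b"]) (use A that in \<open>auto simp: arc_def\<close>)
    qed
  qed
  then have "inj_on f ?E" by (auto intro!: inj_onI)
  then show ?thesis by (rule countableI') 
qed

end

section \<open>Polygons with vertices at the ends of spokes\<close>

lemma dist_le_sum_of_steps:
  fixes f :: "nat \<Rightarrow> 'a::metric_space"
  assumes "a \<le> b"
  shows "dist (f a) (f b) \<le> (\<Sum>j\<in>{a..<b}. dist (f j) (f (Suc j)))"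
  using assms
proof (induction b rule: dec_induct)
  case base
  then show ?case by simp
next
  case (step b)
  then show ?case using dist_triangle[of "f a" "f (Suc b)" "f b"] by (simp add: sum.atLeastLessThan_Suc)
qed

text \<open>The points of \<open>\<Xi>\<close> cut the circle into small arcs. Each \<open>A i\<close>, being connected, contains all small arcs
  of one of the two ways from \<open>p i\<close> to \<open>q i\<close>, and no small arc is contained in two of the sets.
  So the chords are at most the sums of the chords of disjoint families of small arcs, which
  together form one inscribed polygon.\<close>

lemma chords_of_essentially_disjoint_arcs:
  fixes \<gamma> :: "complex \<Rightarrow> 'a::metric_space" and A :: "nat \<Rightarrow> complex set"
  assumes A: "\<And>i. i < k \<Longrightarrow> connected (A i)" "\<And>i. i < k \<Longrightarrow> A i \<subseteq> sphere 0 1"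
    and pq: "\<And>i. i < k \<Longrightarrow> p i \<in> A i \<inter> \<Xi>" "\<And>i. i < k \<Longrightarrow> q i \<in> A i \<inter> \<Xi>"
    and \<Xi>: "finite \<Xi>"
    and disj: "\<And>i j. i < k \<Longrightarrow> j < k \<Longrightarrow> i \<noteq> j \<Longrightarrow> A i \<inter> A j \<subseteq> \<Xi>"
  shows "(\<Sum>i<k. ennreal (dist (\<gamma> (p i)) (\<gamma> (q i)))) \<le> curve_length {0..2*pi} (\<lambda>t. \<gamma> (cis t))"
proof -
  \<comment> \<open>Cut the circle at the points of \<open>\<Xi>\<close>, and at \<open>1\<close>, where the parameter interval begins and ends.\<close>
  define X where "X = Arg2pi ` \<Xi> \<union> {0, 2*pi}"
  define xs where "xs = sorted_list_of_set X"
  define m where "m = length xs - 1"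
  have finX: "finite X" using \<Xi> by (simp add: X_def)
  have Xrange: "0 \<le> x \<and> x \<le> 2*pi" if "x \<in> X" for x
    using that Arg2pi_ge_0 Arg2pi_lt_2pi by (auto simp: X_def intro: less_imp_le)
  have xs: "sorted xs" "distinct xs" "set xs = X" using finX by (auto simp: xs_def)
  have len: "length xs = Suc m" using xs(3) unfolding m_def X_def by (cases xs) auto
  have xs_mem: "xs ! j \<in> X" if "j \<le> m" for j using that len xs(3) by (metis less_Suc_eq_le nth_mem)
  have xs_mono: "xs ! i \<le> xs ! j" if "i \<le> j" "j \<le> m" for i j
    using that xs(1) len by (intro sorted_nth_mono) auto
  have xs_less: "xs ! j < xs ! Suc j" if "j < m" for j
    using xs_mono[of j "Suc j"] that xs(2) len by (auto simp: less_le nth_eq_iff_index_eq)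
  have index: "\<exists>j\<le>m. xs ! j = x" if "x \<in> X" for x
    using that xs(3) len by (metis in_set_conv_nth less_Suc_eq_le)
  have xs0: "xs ! 0 = 0"
  proof -
    obtain j where "j \<le> m" "xs ! j = 0" using index[of 0] by (auto simp: X_def)
    then show ?thesis using xs_mono[of 0 j] Xrange[OF xs_mem[of 0]] by auto
  qed
  have xsm: "xs ! m = 2*pi"
  proof -
    obtain j where "j \<le> m" "xs ! j = 2*pi" using index[of "2*pi"] by (auto simp: X_def)
    then show ?thesis using xs_mono[of j m] Xrange[OF xs_mem[of m]] by auto
  qed
  have notin: "cis x \<notin> \<Xi>" if "j < m" "xs ! j < x" "x < xs ! Suc j" for j x
  proof
    assume "cis x \<in> \<Xi>"
    moreover have "0 \<le> x" "x < 2*pi" using that Xrange[OF xs_mem[of j]] Xrange[OF xs_mem[of "Suc j"]] by auto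
    then have "Arg2pi (cis x) = x" by (intro Arg2pi_unique[of 1]) (auto simp: cis_conv_exp)
    ultimately have "x \<in> X" unfolding X_def by force
    then obtain l where l: "l \<le> m" "xs ! l = x" using index by blast
    show False
    proof (cases "l \<le> j")
      case True then show False using xs_mono[of l j] l that by auto
    next
      case False then show False using xs_mono[of "Suc j" l] l that by auto
    qed
  qed
  define f where "f j = \<gamma> (cis (xs ! j))" for j
  define e where "e j = dist (f j) (f (Suc j))" for j
  define N where "N i = {j. j < m \<and> cis ` {xs ! j<..<xs ! Suc j} \<subseteq> A i}" for i
  have finN: "finite (N i)" for i by (simp add: N_def)
  have f0m: "f 0 = f m" by (simp add: f_def xs0 xsm)
  have chord: "dist (f a) (f b) \<le> sum e (N i)"
    if i: "i < k" and ab: "a \<le> b" "b \<le> m" "cis (xs ! a) \<in> A i" "cis (xs ! b) \<in> A i" for i a b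
  proof -
    have le: "xs ! a \<le> xs ! b" "xs ! b \<le> xs ! a + 2*pi"
      using xs_mono[OF ab(1,2)] Xrange[OF xs_mem[OF ab(2)]] Xrange[OF xs_mem[of a]] ab by auto
    from connected_on_circle_contains_arc[OF A(1,2)[OF i] ab(3,4) le] show ?thesis
    proof
      assume arc: "cis ` {xs ! a..xs ! b} \<subseteq> A i"
      have "{a..<b} \<subseteq> N i"
      proof
        fix j assume "j \<in> {a..<b}"
        then have "{xs ! j<..<xs ! Suc j} \<subseteq> {xs ! a..xs ! b}" "j < m"
          using xs_mono[of a j] xs_mono[of "Suc j" b] ab by auto
        then show "j \<in> N i" using arc unfolding N_def by blast
      qed
      then have "sum e {a..<b} \<le> sum e (N i)" using finN by (intro sum_mono2) (auto simp: e_def)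
      then show ?thesis using dist_le_sum_of_steps[OF ab(1), of f] by (simp add: e_def)
    next
      assume arc: "cis ` {xs ! b..xs ! a + 2*pi} \<subseteq> A i"
      have "{b..<m} \<subseteq> N i"
      proof
        fix j assume "j \<in> {b..<m}"
        then have "{xs ! j<..<xs ! Suc j} \<subseteq> {xs ! b..xs ! a + 2*pi}" "j < m"
          using xs_mono[of b j] Xrange[OF xs_mem[of "Suc j"]] Xrange[OF xs_mem[of a]] ab by auto
        then show "j \<in> N i" using arc unfolding N_def by blast
      qed
      moreover have "{0..<a} \<subseteq> N i"
      proof
        fix j assume j: "j \<in> {0..<a}"
        have "cis x \<in> A i" if x: "xs ! j < x" "x < xs ! Suc j" for x
        proof -
          have "x + 2*pi \<in> {xs ! b..xs ! a + 2*pi}"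
            using x j ab xs_mono[of "Suc j" a] Xrange[OF xs_mem[of j]] Xrange[OF xs_mem[of b]] by auto
          then have "cis (x + 2*pi) \<in> A i" using arc by blast
          moreover have "cis (x + 2*pi) = cis x" by (simp add: complex_eq_iff)
          ultimately show ?thesis by simp
        qed
        then show "j \<in> N i" using j ab by (auto simp: N_def)
      qed
      ultimately have "sum e ({0..<a} \<union> {b..<m}) \<le> sum e (N i)"
        using finN by (intro sum_mono2) (auto simp: e_def)
      also have "sum e ({0..<a} \<union> {b..<m}) = sum e {0..<a} + sum e {b..<m}"
        using ab by (intro sum.union_disjoint) auto
      finally have "dist (f 0) (f a) + dist (f b) (f m) \<le> sum e (N i)"
        using dist_le_sum_of_steps[of 0 a f] dist_le_sum_of_steps[of b m f] ab by (simp add: e_def)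
      then show ?thesis using dist_triangle2[of "f a" "f b" "f m"] f0m by (simp add: dist_commute)
    qed
  qed
  have each: "dist (\<gamma> (p i)) (\<gamma> (q i)) \<le> sum e (N i)" if i: "i < k" for i
  proof -
    have "\<exists>a\<le>m. cis (xs ! a) = w" if "w \<in> A i \<inter> \<Xi>" for w
    proof -
      have "norm w = 1" using that A(2)[OF i] by auto
      then have "cis (Arg2pi w) = w" using Arg2pi_eq[of w] by (simp add: cis_conv_exp)
      then show ?thesis using index[of "Arg2pi w"] that by (auto simp: X_def)
    qed
    then obtain a b where ab: "a \<le> m" "cis (xs ! a) = p i" "b \<le> m" "cis (xs ! b) = q i"
      using pq[OF i] by metis
    show ?thesis
    proof (cases "a \<le> b")
      case True
      then show ?thesis using chord[OF i True] ab pq[OF i] by (simp add: f_def)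
    next
      case False
      then show ?thesis using chord[OF i, of b a] ab pq[OF i] by (simp add: f_def dist_commute)
    qed
  qed
  have "(\<Sum>i<k. dist (\<gamma> (p i)) (\<gamma> (q i))) \<le> (\<Sum>i<k. sum e (N i))"
    using each by (intro sum_mono) auto
  also have "\<dots> = sum e (\<Union>i<k. N i)"
  proof (rule sum.UNION_disjoint[symmetric])
    show "\<forall>i\<in>{..<k}. \<forall>j\<in>{..<k}. i \<noteq> j \<longrightarrow> N i \<inter> N j = {}"
    proof (intro ballI impI)
      fix i j assume ij: "i \<in> {..<k}" "j \<in> {..<k}" "i \<noteq> j"
      have False if l: "l \<in> N i" "l \<in> N j" for l
      proof -
        have lm: "l < m" using l by (simp add: N_def)
        let ?x = "(xs ! l + xs ! Suc l) / 2"
        have x: "xs ! l < ?x" "?x < xs ! Suc l" using xs_less[OF lm] by auto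
        then have "cis ?x \<in> A i \<inter> A j" using l unfolding N_def by (auto simp: image_subset_iff)
        then show False using disj[of i j] ij notin[OF lm x] by auto
      qed
      then show "N i \<inter> N j = {}" by blast
    qed
  qed (use finN in auto)
  also have "\<dots> \<le> sum e {..<m}" by (intro sum_mono2) (auto simp: N_def e_def)
  finally have "ennreal (\<Sum>i<k. dist (\<gamma> (p i)) (\<gamma> (q i))) \<le> ennreal (sum e {..<m})" by (rule ennreal_leI)
  then have "(\<Sum>i<k. ennreal (dist (\<gamma> (p i)) (\<gamma> (q i)))) \<le> (\<Sum>j<m. ennreal (e j))"
    by (simp add: sum_ennreal e_def)
  also have "\<dots> \<le> curve_length {0..2*pi} (\<lambda>t. \<gamma> (cis t))"
    unfolding curve_length_def
  proof (rule SUP_upper2[of "(m, \<lambda>j. xs ! j)"])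
    show "(m, (!) xs) \<in> {(k, t). mono_on {..k} t \<and> t ` {..k} \<subseteq> {0..2 * pi}}"
      using xs_mono xs_mem Xrange by (auto simp: mono_on_def)
  qed (simp add: e_def f_def)
  finally show ?thesis .
qed

text \<open>A boundary point \<open>w\<close> that is not the end of the image of a spoke has positive distance from the images of
  all spokes. The preimage of a small half-disk at \<open>w\<close> is therefore connected and disjoint from
  the spokes, hence contained in a single sector. For \<open>k \<ge> 3\<close> a sector is the intersection of the disk with
  two half-planes, so that its frontier in the disk consists of two spokes.\<close>

lemma sectors_cluster_set_overlap_only_at_spoke_ends:
  fixes h g :: "complex \<Rightarrow> complex" and \<xi> :: "nat \<Rightarrow> complex" and t \<eta> :: real and k :: nat
  defines "S \<equiv> \<lambda>i n. (\<lambda>(r, \<theta>). rcis r \<theta>) ` ({1 - inverse (real (Suc (Suc n)))<..<1} \<times> {t + real i * \<eta><..<t + real (Suc i) * \<eta>})"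
  assumes h: "homeomorphism (ball 0 1) (ball 0 1) h g"
    and k: "k \<ge> 3" "\<eta> = 2 * pi / real k"
    and \<xi>: "\<And>l. l \<le> k \<Longrightarrow> ((\<lambda>r. h (rcis r (t + real l * \<eta>))) \<longlongrightarrow> \<xi> l) (at_left 1)"
    and ij: "i < k" "j < k" "i \<noteq> j"
    and w: "w \<in> closure (h ` S i 0)" "w \<in> closure (h ` S j 0)" "norm w = 1"
  shows "w \<in> \<xi> ` {..k}"
proof (rule ccontr)
  assume nw: "w \<notin> \<xi> ` {..k}"
  have \<eta>: "0 < \<eta>" "\<eta> < pi" unfolding k(2) using k(1) by (auto simp: divide_less_eq)
  have k\<eta>: "real k * \<eta> = 2 * pi" using k by simp
  note h1 = homeomorphism_diskD(1)[OF h]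
  have "\<exists>\<epsilon>>0. \<forall>r\<in>{0..<1}. \<epsilon> \<le> dist (h (rcis r (t + real l * \<eta>))) w" if l: "l \<le> k" for l
  proof -
    define d where "d = dist w (\<xi> l) / 2"
    have d: "d > 0" using nw l by (auto simp: d_def)
    have "eventually (\<lambda>r. dist (h (rcis r (t + real l * \<eta>))) (\<xi> l) < d) (at_left 1)"
      using tendstoD[OF \<xi>[OF l] d] .
    then obtain r0 where r0: "r0 < 1" "\<And>r. r0 < r \<Longrightarrow> r < 1 \<Longrightarrow> dist (h (rcis r (t + real l * \<eta>))) (\<xi> l) < d"
      unfolding eventually_at_left_field by auto
    obtain \<kappa> where \<kappa>: "\<kappa> < 1" "\<And>v. norm v < 1 \<Longrightarrow> \<kappa> < norm v \<Longrightarrow> r0 < norm (g v)"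
      using homeomorphism_disk_proper[OF homeomorphism_symD[OF h] r0(1)] by metis
    have "min d (1 - \<kappa>) \<le> dist (h (rcis r (t + real l * \<eta>))) w" if r: "r \<in> {0..<1}" for r
    proof (cases "r0 < r")
      case True
      then have "dist (h (rcis r (t + real l * \<eta>))) (\<xi> l) < d" using r0 r by auto
      then show ?thesis
        using dist_triangle[of w "\<xi> l" "h (rcis r (t + real l * \<eta>))"] by (simp add: d_def dist_commute)
    next
      case False
      let ?z = "rcis r (t + real l * \<eta>)"
      have z: "norm ?z < 1" "norm ?z \<le> r0" using r False by auto
      have "g (h ?z) = ?z" using homeomorphism_diskD(2)[OF h z(1)] .
      then have "norm (h ?z) \<le> \<kappa>" using \<kappa>(2)[of "h ?z"] h1[OF z(1)] z by force
      then show ?thesis using norm_triangle_ineq3[of "h ?z" w] w(3) by (simp add: dist_norm)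
    qed
    then show ?thesis using d \<kappa> by (intro exI[of _ "min d (1 - \<kappa>)"]) auto
  qed
  then obtain \<epsilon>l where \<epsilon>l: "\<And>l. l \<le> k \<Longrightarrow> \<epsilon>l l > 0"
      "\<And>l r. l \<le> k \<Longrightarrow> r \<in> {0..<1} \<Longrightarrow> \<epsilon>l l \<le> dist (h (rcis r (t + real l * \<eta>))) w" by metis
  define \<epsilon> where "\<epsilon> = Min (\<epsilon>l ` {..k})"
  have \<epsilon>: "\<epsilon> > 0" unfolding \<epsilon>_def using \<epsilon>l(1) by (subst Min_gr_iff) auto
  have \<epsilon>_le: "\<epsilon> \<le> dist (h (rcis r (t + real l * \<eta>))) w" if "l \<le> k" "r \<in> {0..<1}" for l r
  proof -
    have "\<epsilon> \<le> \<epsilon>l l" unfolding \<epsilon>_def using that by (intro Min_le) auto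
    with \<epsilon>l(2)[OF that] show ?thesis by linarith
  qed
  \<comment> \<open>A half-disk at \<open>w\<close> is free of spokes, so its preimage lies in a single sector.\<close>
  define U where "U = g ` (ball w \<epsilon> \<inter> ball 0 1)"
  have conU: "connected U" unfolding U_def
    by (intro connected_continuous_image convex_connected convex_Int convex_ball
        continuous_on_subset[OF homeomorphism_diskD(6)[OF h]]) auto
  have U: "norm z < 1 \<and> dist (h z) w < \<epsilon>" if "z \<in> U" for z
    using that homeomorphism_diskD(3,4)[OF h] by (auto simp: U_def dist_commute)
  have meets: "\<exists>z\<in>U. \<exists>r \<theta>. 0 < r \<and> r < 1 \<and> z = rcis r \<theta> \<and> t + real i * \<eta> < \<theta> \<and> \<theta> < t + real (Suc i) * \<eta>"
    if wi: "w \<in> closure (h ` S i 0)" for i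
  proof -
    obtain z where z: "z \<in> S i 0" "dist (h z) w < \<epsilon>"
      using wi \<epsilon> unfolding closure_approachable by blast
    then obtain r \<theta> where r: "1/2 < r" "r < 1" "z = rcis r \<theta>" "t + real i * \<eta> < \<theta>" "\<theta> < t + real (Suc i) * \<eta>"
      unfolding S_def by auto
    have "norm z < 1" using r by auto
    then have "z = g (h z)" "h z \<in> ball w \<epsilon> \<inter> ball 0 1" using homeomorphism_diskD(1,2)[OF h] z by (auto simp: dist_commute)
    then have "z \<in> U" unfolding U_def by blast
    then show ?thesis using r by (intro bexI[of _ z] exI[of _ r] exI[of _ \<theta>]) auto
  qed
  define Sec where "Sec = {z. norm z < 1 \<and> 0 < Im (z * cis (- (t + real i * \<eta>))) \<and> Im (z * cis (- (t + real (Suc i) * \<eta>))) < 0}"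
  have Im_rcis: "Im (rcis r \<theta> * cis (- a)) = r * sin (\<theta> - a)" for r \<theta> a
    by (simp add: rcis_def cis_mult mult.assoc)
  have "U \<inter> Sec \<noteq> {}"
  proof -
    obtain r \<theta> where z: "rcis r \<theta> \<in> U" "0 < r" "r < 1" "t + real i * \<eta> < \<theta>" "\<theta> < t + real (Suc i) * \<eta>"
      using meets[OF w(1)] by blast
    have "sin (\<theta> - (t + real i * \<eta>)) > 0" using z \<eta> by (intro sin_gt_zero) (auto simp: algebra_simps)
    moreover have "sin (\<theta> - (t + real (Suc i) * \<eta>)) < 0"
      using sin_gt_zero[of "t + real (Suc i) * \<eta> - \<theta>"] sin_minus[of "\<theta> - (t + real (Suc i) * \<eta>)"] z \<eta>
      by (simp add: algebra_simps)
    ultimately have "rcis r \<theta> \<in> Sec" using z unfolding Sec_def Im_rcis mem_Collect_eq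
      by (simp add: mult_pos_neg)
    with z show ?thesis by blast
  qed
  moreover have "U - Sec \<noteq> {}"
  proof -
    obtain r \<theta> where z: "rcis r \<theta> \<in> U" "0 < r" "r < 1" "t + real j * \<eta> < \<theta>" "\<theta> < t + real (Suc j) * \<eta>"
      using meets[OF w(2)] by blast
    \<comment> \<open>Seen from spoke \<open>i\<close>, the sector \<open>j\<close> lies, modulo \<open>2\<pi>\<close>, at angles \<open>u\<close> between \<open>\<eta>\<close> and \<open>2\<pi>\<close>, whereas
      sector \<open>i\<close> lies between \<open>0\<close> and \<open>\<eta>\<close>.\<close>
    have key: "\<not> (sin u > 0 \<and> sin (u - \<eta>) < 0)" if "\<eta> < u" "u < 2 * pi" for u
    proof
      assume s: "sin u > 0 \<and> sin (u - \<eta>) < 0"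
      have "u < pi"
      proof (rule ccontr)
        assume "\<not> u < pi"
        then have "sin u \<le> 0" using that sin_ge_zero[of "u - pi"] by (simp add: sin_diff)
        with s show False by simp
      qed
      then have "sin (u - \<eta>) > 0" using that \<eta> by (intro sin_gt_zero) auto
      with s show False by simp
    qed
    have "\<not> (sin (\<theta> - (t + real i * \<eta>)) > 0 \<and> sin (\<theta> - (t + real (Suc i) * \<eta>)) < 0)"
    proof (cases "i < j")
      case True
      define u where "u = \<theta> - (t + real i * \<eta>)"
      have "real (Suc i) * \<eta> \<le> real j * \<eta>" using \<eta> True by (intro mult_right_mono) auto
      moreover have "real (Suc i) * \<eta> = real i * \<eta> + \<eta>" by (simp add: algebra_simps)
      moreover have "real (Suc j) * \<eta> \<le> real k * \<eta>" using \<eta> ij by (intro mult_right_mono) auto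
      moreover have "0 \<le> real i * \<eta>" using \<eta> by (intro mult_nonneg_nonneg) auto
      ultimately have u: "\<eta> < u" "u < 2 * pi" "\<theta> - (t + real (Suc i) * \<eta>) = u - \<eta>"
        using z(4,5) k\<eta> unfolding u_def by linarith+
      show ?thesis using key[OF u(1,2)] unfolding u(3) u_def[symmetric] .
    next
      case False
      define u where "u = \<theta> - (t + real i * \<eta>) + 2 * pi"
      have "Suc j \<le> i" using ij False by simp
      then have "real (Suc j) * \<eta> \<le> real i * \<eta>" using \<eta> by (intro mult_right_mono) auto
      moreover have "real (Suc i) * \<eta> = real i * \<eta> + \<eta>" by (simp add: algebra_simps)
      moreover have "real (Suc i) * \<eta> \<le> real (k + j) * \<eta>" using \<eta> ij by (intro mult_right_mono) auto
      moreover have "real (k + j) * \<eta> = 2 * pi + real j * \<eta>" using k\<eta> by (simp add: distrib_right)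
      ultimately have u: "\<eta> < u" "u < 2 * pi" "\<theta> - (t + real (Suc i) * \<eta>) = u - \<eta> - 2 * pi"
          "\<theta> - (t + real i * \<eta>) = u - 2 * pi"
        using z(4,5) unfolding u_def by linarith+
      have "sin (x - 2 * pi) = sin x" for x :: real using sin_periodic[of "x - 2 * pi"] by simp
      then show ?thesis using key[OF u(1,2)] unfolding u(3,4) by simp
    qed
    then have "rcis r \<theta> \<notin> Sec" using z unfolding Sec_def Im_rcis mem_Collect_eq
      by (simp add: zero_less_mult_iff mult_less_0_iff)
    with z show ?thesis by blast
  qed
  ultimately have "U \<inter> frontier Sec \<noteq> {}" by (rule connected_Int_frontier[OF conU])
  then obtain z where z: "z \<in> U" "z \<in> frontier Sec" by blast
  have z1: "norm z < 1" using U[OF z(1)] by simp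
  have Sec_eq: "Sec = ball 0 1 \<inter> {z. 0 < Im (z * cis (- (t + real i * \<eta>)))} \<inter> {z. Im (z * cis (- (t + real (Suc i) * \<eta>))) < 0}"
    by (auto simp: Sec_def)
  have "open Sec" unfolding Sec_eq
    by (intro open_Int open_ball open_Collect_less continuous_intros)
  then have "z \<notin> Sec" using z(2) by (simp add: frontier_def interior_open)
  have "closure Sec \<subseteq> {z. 0 \<le> Im (z * cis (- (t + real i * \<eta>)))} \<inter> {z. Im (z * cis (- (t + real (Suc i) * \<eta>))) \<le> 0}"
    by (intro closure_minimal closed_Int closed_Collect_le continuous_intros) (auto simp: Sec_def)
  then have zIm: "0 \<le> Im (z * cis (- (t + real i * \<eta>)))" "Im (z * cis (- (t + real (Suc i) * \<eta>))) \<le> 0"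
    using z(2) by (auto simp: frontier_def)
  have real_mult: "z = rcis (Re (z * cis (- a))) a" if "Im (z * cis (- a)) = 0" for a
  proof -
    have "z = (z * cis (- a)) * cis a" by (simp add: mult.assoc cis_mult)
    also have "z * cis (- a) = of_real (Re (z * cis (- a)))" using that by (simp add: complex_eq_iff)
    finally show ?thesis by (simp add: rcis_def)
  qed
  have "\<exists>l\<le>k. \<exists>x\<ge>0. z = rcis x (t + real l * \<eta>)"
  proof (cases "Im (z * cis (- (t + real i * \<eta>))) = 0")
    case True
    define x where "x = Re (z * cis (- (t + real i * \<eta>)))"
    have zx: "z = rcis x (t + real i * \<eta>)" using real_mult[OF True] by (simp add: x_def)
    have "Im (z * cis (- (t + real (Suc i) * \<eta>))) = x * sin (- \<eta>)"
      unfolding zx Im_rcis by (simp add: algebra_simps)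
    then have "x * sin \<eta> \<ge> 0" using zIm(2) by simp
    then have "x \<ge> 0" using sin_gt_zero[OF \<eta>] by (simp add: zero_le_mult_iff)
    then show ?thesis using zx ij by (intro exI[of _ i]) auto
  next
    case False
    then have I0: "Im (z * cis (- (t + real (Suc i) * \<eta>))) = 0"
      using zIm z1 \<open>z \<notin> Sec\<close> unfolding Sec_def by auto
    define x where "x = Re (z * cis (- (t + real (Suc i) * \<eta>)))"
    have zx: "z = rcis x (t + real (Suc i) * \<eta>)" using real_mult[OF I0] by (simp add: x_def)
    have "Im (z * cis (- (t + real i * \<eta>))) = x * sin \<eta>"
      unfolding zx Im_rcis by (simp add: algebra_simps)
    then have "x * sin \<eta> \<ge> 0" using zIm(1) by simp
    then have "x \<ge> 0" using sin_gt_zero[OF \<eta>] by (simp add: zero_le_mult_iff)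
    then show ?thesis using zx ij by (intro exI[of _ "Suc i"]) auto
  qed
  then obtain l x where l: "l \<le> k" "x \<ge> 0" "z = rcis x (t + real l * \<eta>)" by blast
  then have "\<epsilon> \<le> dist (h z) w" using \<epsilon>_le[of l x] z1 by auto
  with U[OF z(1)] show False by simp
qed

text \<open>The set \<open>A i\<close> is the cluster set of the \<open>i\<close>-th sector along the whole of its boundary arc. It is connected,
  contains the ends of both bounding spokes, and meets the other \<open>A j\<close> only at ends of spokes.
  No orientation or cyclic order of the ends needs to be discussed.\<close>

lemma spoke_ends_polygon_le_boundary_length:
  fixes h g :: "complex \<Rightarrow> complex" and \<gamma> :: "complex \<Rightarrow> 'a::metric_space"
  assumes h: "homeomorphism (ball 0 1) (ball 0 1) h g"
    and k: "k \<ge> 3" "\<eta> = 2 * pi / real k"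
    and \<xi>: "\<And>l. l \<le> k \<Longrightarrow> ((\<lambda>r. h (rcis r (t + real l * \<eta>))) \<longlongrightarrow> \<xi> l) (at_left 1)"
  shows "(\<Sum>i<k. ennreal (dist (\<gamma> (\<xi> i)) (\<gamma> (\<xi> (Suc i))))) \<le> curve_length {0..2*pi} (\<lambda>t. \<gamma> (cis t))"
proof -
  have \<eta>: "0 < \<eta>" using k by auto
  note h1 = homeomorphism_diskD(1)[OF h]
  note ch = homeomorphism_diskD(5)[OF h]
  define S where "S i n = (\<lambda>(r, \<theta>). rcis r \<theta>) ` ({1 - inverse (real (Suc (Suc n)))<..<1} \<times> {t + real i * \<eta><..<t + real (Suc i) * \<eta>})" for i n
  have inv: "inverse (real (Suc (Suc n))) < 1" "0 < inverse (real (Suc (Suc n)))" for n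
    by (auto simp: field_simps)
  have S1: "norm z < 1 \<and> 1 - inverse (real (Suc (Suc n))) < norm z" if z: "z \<in> S i n" for z i n
  proof -
    obtain r \<theta> where "z = rcis r \<theta>" "1 - inverse (real (Suc (Suc n))) < r" "r < 1" using z unfolding S_def by auto
    then show ?thesis using inv[of n] by auto
  qed
  define A where "A i = (\<Inter>n. closure (h ` S i n))" for i
  have bdd: "h ` S i n \<subseteq> cball 0 1" for i n
    using S1 h1 by (intro image_subsetI) (simp add: less_imp_le)
  have conA: "connected (A i)" for i
    unfolding A_def
  proof (rule connected_nest)
    fix n
    show "compact (closure (h ` S i n))"
      by (rule compact_closure_in_cball[OF bdd])
    have "connected (S i n)" unfolding S_def
    proof (intro connected_continuous_image connected_Times connected_Ioo)
      show "continuous_on ({1 - inverse (real (Suc (Suc n)))<..<1} \<times> {t + real i * \<eta><..<t + real (Suc i) * \<eta>}) (\<lambda>(r, \<theta>). rcis r \<theta>)"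
        unfolding case_prod_unfold rcis_def cis_conv_exp by (intro continuous_intros)
    qed
    moreover have "continuous_on (S i n) h" using S1 by (intro continuous_on_subset[OF ch]) auto
    ultimately show "connected (closure (h ` S i n))"
      by (intro connected_imp_connected_closure connected_continuous_image)
  next
    fix m n :: nat assume "m \<le> n"
    then have "inverse (real (Suc (Suc n))) \<le> inverse (real (Suc (Suc m)))" by (intro le_imp_inverse_le) auto
    then have "x \<in> {1 - inverse (real (Suc (Suc m)))<..<1}" if "x \<in> {1 - inverse (real (Suc (Suc n)))<..<1}" for x :: real
      using that unfolding greaterThanLessThan_iff by (intro conjI; linarith)
    then have "S i n \<subseteq> S i m" unfolding S_def by (intro image_mono Sigma_mono subsetI)
    then show "closure (h ` S i n) \<subseteq> closure (h ` S i m)" by (intro closure_mono image_mono)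
  qed
  have A_circle: "A i \<subseteq> sphere 0 1" for i
  proof
    fix b assume b: "b \<in> A i"
    have le: "norm b \<le> 1"
    proof -
      have "closure (h ` S i 0) \<subseteq> cball 0 1" using bdd by (intro closure_minimal) auto
      then show ?thesis using b by (auto simp: A_def)
    qed
    have ge: "\<rho> \<le> norm b" if \<rho>: "\<rho> < 1" for \<rho>
    proof -
      obtain \<rho>' where \<rho>': "\<rho>' < 1" "\<And>z. norm z < 1 \<Longrightarrow> \<rho>' < norm z \<Longrightarrow> \<rho> < norm (h z)"
        using homeomorphism_disk_proper[OF h \<rho>] by metis
      obtain n where "inverse (real (Suc n)) < 1 - \<rho>'" using reals_Archimedean[of "1 - \<rho>'"] \<rho>' by auto
      moreover have "inverse (real (Suc (Suc n))) \<le> inverse (real (Suc n))" by (intro le_imp_inverse_le) auto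
      ultimately have small: "inverse (real (Suc (Suc n))) < 1 - \<rho>'" by linarith
      have "h ` S i n \<subseteq> - ball 0 \<rho>"
      proof (rule image_subsetI)
        fix z assume "z \<in> S i n"
        then have "norm z < 1" "\<rho>' < norm z" using S1[of z i n] small by linarith+
        from \<rho>'(2)[OF this] show "h z \<in> - ball 0 \<rho>" by simp
      qed
      then have "closure (h ` S i n) \<subseteq> - ball 0 \<rho>" by (intro closure_minimal) (auto simp: closed_def)
      then show ?thesis using b by (force simp: A_def)
    qed
    have "1 \<le> norm b" using ge by (rule dense_le)
    then show "b \<in> sphere 0 1" using le by simp
  qed
  have limit_in: "\<xi> l \<in> A i" if l: "l = i \<or> l = Suc i" "l \<le> k" for l i
    unfolding A_def
  proof
    fix n
    have "h (rcis r (t + real l * \<eta>)) \<in> closure (h ` S i n)" if r: "1 - inverse (real (Suc (Suc n))) < r" "r < 1" for r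
    proof -
      have r0: "0 < r" using r inv[of n] by auto
      have c: "isCont h (rcis r (t + real l * \<eta>))"
        using continuous_on_interior[OF ch] r r0 by simp
      have "isCont (\<lambda>\<theta>. h (rcis r \<theta>)) (t + real l * \<eta>)"
        unfolding rcis_def cis_conv_exp
        using c[unfolded rcis_def cis_conv_exp] by (intro continuous_within_compose3[where f="\<lambda>\<theta>. of_real r * exp (\<i> * of_real \<theta>)" and g=h] continuous_intros) auto
      then have lim: "((\<lambda>\<theta>. h (rcis r \<theta>)) \<longlongrightarrow> h (rcis r (t + real l * \<eta>))) (at (t + real l * \<eta>) within {t + real i * \<eta><..<t + real (Suc i) * \<eta>})"
        unfolding isCont_def by (rule tendsto_mono[rotated]) (simp add: at_le)
      have "t + real i * \<eta> < t + real (Suc i) * \<eta>" using \<eta> by (simp add: algebra_simps)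
      then have nt: "at (t + real l * \<eta>) within {t + real i * \<eta><..<t + real (Suc i) * \<eta>} \<noteq> bot"
        unfolding trivial_limit_within islimpt_greaterThanLessThan1 using l islimpt_greaterThanLessThan1 islimpt_greaterThanLessThan2 by blast
      show ?thesis
      proof (rule Lim_in_closed_set[OF closed_closure _ nt lim])
        show "eventually (\<lambda>\<theta>. h (rcis r \<theta>) \<in> closure (h ` S i n)) (at (t + real l * \<eta>) within {t + real i * \<eta><..<t + real (Suc i) * \<eta>})"
          unfolding eventually_at_filter
        proof (intro always_eventually allI impI)
          fix \<theta> assume "\<theta> \<in> {t + real i * \<eta><..<t + real (Suc i) * \<eta>}"
          then have "rcis r \<theta> \<in> S i n" unfolding S_def using r by force
          then show "h (rcis r \<theta>) \<in> closure (h ` S i n)" by (intro subsetD[OF closure_subset] imageI)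
        qed
      qed
    qed
    then have "eventually (\<lambda>r. h (rcis r (t + real l * \<eta>)) \<in> closure (h ` S i n)) (at_left 1)"
      using inv[of n] by (intro eventually_at_leftI[of "1 - inverse (real (Suc (Suc n)))"]) auto
    then show "\<xi> l \<in> closure (h ` S i n)"
      by (intro Lim_in_closed_set[OF closed_closure _ _ \<xi>[OF l(2)]]) auto
  qed
  show ?thesis
  proof (rule chords_of_essentially_disjoint_arcs[of k A _ "\<xi> ` {..k}"])
    fix i j assume ij: "i < k" "j < k" "i \<noteq> j"
    show "A i \<inter> A j \<subseteq> \<xi> ` {..k}"
    proof
      fix w assume w: "w \<in> A i \<inter> A j"
      then have "w \<in> closure (h ` S i 0)" "w \<in> closure (h ` S j 0)" "norm w = 1"
        using A_circle[of i] unfolding A_def by auto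
      then show "w \<in> \<xi> ` {..k}"
        using sectors_cluster_set_overlap_only_at_spoke_ends[OF h k \<xi> ij, of w] unfolding S_def by blast
    qed
  qed (use conA A_circle limit_in in auto)
qed

section \<open>Angular and radial derivatives\<close>

lemma has_vector_derivative_vec_lambda:
  fixes f :: "'n::finite \<Rightarrow> real \<Rightarrow> real"
  assumes "\<And>i. (f i has_real_derivative f' i) (at x within S)"
  shows "((\<lambda>x. \<chi> i. f i x) has_vector_derivative (\<chi> i. f' i)) (at x within S)"
  unfolding has_vector_derivative_def has_derivative_componentwise_within[of "\<lambda>x. \<chi> i. f i x"]
proof
  fix b :: "real^'n" assume "b \<in> Basis"
  then obtain i where b: "b = axis i 1" by (auto simp: Basis_vec_def)
  have "(f i has_derivative (\<lambda>h. h *\<^sub>R f' i)) (at x within S)"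
    using assms[of i] by (simp add: has_field_derivative_def mult_commute_abs)
  then show "((\<lambda>x. (\<chi> i. f i x) \<bullet> b) has_derivative (\<lambda>h. (h *\<^sub>R (\<chi> i. f' i)) \<bullet> b)) (at x within S)"
    by (simp add: b inner_axis)
qed

lemma has_real_derivative_Re_compose:
  assumes F: "F holomorphic_on ball 0 1" and z: "norm (p x) < 1" and p: "(p has_vector_derivative p') (at x)"
  shows "((\<lambda>x. Re (F (p x))) has_real_derivative Re (p' * deriv F (p x))) (at x)"
proof -
  have "(F has_field_derivative deriv F (p x)) (at (p x))"
    using F z by (intro holomorphic_derivI[of F "ball 0 1"]) auto
  from field_vector_diff_chain_at[OF p this]
  have "(F \<circ> p has_vector_derivative p' * deriv F (p x)) (at x)" .
  from bounded_linear.has_vector_derivative[OF bounded_linear_Re this]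
  show ?thesis by (simp add: has_real_derivative_iff_has_vector_derivative o_def)
qed

lemma has_vector_derivative_rcis_angle:
  "((\<lambda>t. rcis r t) has_vector_derivative \<i> * rcis r t) (at t)"
proof -
  have "((\<lambda>t. of_real r * exp (\<i> * of_real t)) has_vector_derivative of_real r * (\<i> * exp (\<i> * of_real t))) (at t)"
    by (rule has_vector_derivative_real_field) (auto intro!: derivative_eq_intros)
  then show ?thesis by (simp add: rcis_def cis_conv_exp mult_ac)
qed

lemma has_vector_derivative_rcis_radius:
  "((\<lambda>r. rcis r t) has_vector_derivative cis t) (at r)"
  unfolding rcis_def by (rule has_vector_derivative_real_field) (auto intro!: derivative_eq_intros)

context
  fixes F :: "'n::finite \<Rightarrow> complex \<Rightarrow> complex" and \<tau> :: "complex \<Rightarrow> real^'n"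
  assumes F: "\<And>i. F i holomorphic_on ball 0 1"
    and \<tau>: "\<And>z. norm z < 1 \<Longrightarrow> \<tau> z = (\<chi> i. Re (F i z))"
begin

lemma angular_derivative:
  assumes "\<bar>\<rho>\<bar> < 1"
  shows "((\<lambda>t. \<tau> (rcis \<rho> t)) has_vector_derivative (\<chi> i. Re (\<i> * rcis \<rho> t * deriv (F i) (rcis \<rho> t)))) (at t)"
proof -
  have "(\<lambda>t. \<tau> (rcis \<rho> t)) = (\<lambda>t. \<chi> i. Re (F i (rcis \<rho> t)))" using \<tau> assms by simp
  then show ?thesis
    using assms by (simp only:) (intro has_vector_derivative_vec_lambda has_real_derivative_Re_compose F
        has_vector_derivative_rcis_angle, simp)
qed

lemma radial_derivative:
  assumes "\<bar>r\<bar> < 1"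
  shows "((\<lambda>r. \<tau> (rcis r s)) has_vector_derivative (\<chi> i. Re (cis s * deriv (F i) (rcis r s)))) (at r)"
proof -
  have "((\<lambda>r. \<chi> i. Re (F i (rcis r s))) has_vector_derivative (\<chi> i. Re (cis s * deriv (F i) (rcis r s)))) (at r)"
    using assms by (intro has_vector_derivative_vec_lambda has_real_derivative_Re_compose F
        has_vector_derivative_rcis_radius) simp
  then show ?thesis
  proof (rule has_vector_derivative_transform_within_open[where S="{-1<..<1}"])
    show "(\<chi> i. Re (F i (rcis x s))) = \<tau> (rcis x s)" if "x \<in> {-1<..<1}" for x
      using \<tau>[of "rcis x s"] that by (simp add: abs_less_iff)
  qed (use assms in auto)
qed

lemma circle_deriv_integral_eq:
  assumes "\<bar>\<rho>\<bar> < 1"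
  shows "circle_deriv_integral \<tau> \<rho> = integral {0..2*pi} (\<lambda>t. norm ((\<chi> i. Re (\<i> * rcis \<rho> t * deriv (F i) (rcis \<rho> t))) :: real^'n))"
  unfolding circle_deriv_integral_def
  using vector_derivative_at[OF angular_derivative[OF assms]] by simp

text \<open>The angular derivative has the components \<open>Re (\<i> z F\<^sub>i'(z))\<close>, to which the monotonicity of circle means
  applies.\<close>

lemma circle_deriv_integral_mono:
  assumes "0 \<le> \<rho>" "\<rho> < R" "R < 1"
  shows "circle_deriv_integral \<tau> \<rho> \<le> circle_deriv_integral \<tau> R"
proof -
  have "(\<lambda>z. \<i> * z * deriv (F i) z) holomorphic_on ball 0 1" for i by (intro holomorphic_intros F) auto
  from circle_mean_norm_mono[OF this refl assms] show ?thesis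
    using assms circle_deriv_integral_eq[of \<rho>] circle_deriv_integral_eq[of R] by simp
qed

lemma radial_speed_eq:
  assumes "\<bar>r\<bar> < 1"
  shows "radial_speed \<tau> s r = norm ((\<chi> i. Re (cis s * deriv (F i) (rcis r s))) :: real^'n)"
  unfolding radial_speed_def using vector_derivative_at[OF radial_derivative[OF assms]] by simp

lemma continuous_on_radial_speed: "continuous_on {-1<..<1} (radial_speed \<tau> s)"
proof -
  have dF: "deriv (F i) holomorphic_on ball 0 1" for i by (intro holomorphic_deriv F) auto
  have "continuous_on {-1<..<1} (\<lambda>r. norm ((\<chi> i. Re (cis s * deriv (F i) (rcis r s))) :: real^'n))"
    unfolding rcis_def
    by (intro continuous_intros continuous_on_compose2[OF holomorphic_on_imp_continuous_on[OF dF]])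
       (auto simp: norm_mult)
  then show ?thesis by (rule continuous_on_eq) (auto simp: radial_speed_eq)
qed

lemma integral_radial_speed_le:
  assumes L: "\<And>\<rho>. 0 \<le> \<rho> \<Longrightarrow> \<rho> < 1 \<Longrightarrow> circle_deriv_integral \<tau> \<rho> \<le> L" and r: "0 < r" "r < 1"
  shows "integral {-r..r} (radial_speed \<tau> s) \<le> 1/2 * L"
proof -
  define R where "R = (1 + r) / 2"
  have R: "r < R" "R < 1" using r by (auto simp: R_def)
  have "integral {-r..r} (radial_speed \<tau> s) =
      integral {-r..r} (\<lambda>a. norm ((\<chi> i. Re (cis s * deriv (F i) (rcis a s))) :: real^'n))"
  proof (rule integral_cong)
    fix x assume "x \<in> {-r..r}"
    then have "\<bar>x\<bar> < 1" using r by auto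
    then show "radial_speed \<tau> s x = norm ((\<chi> i. Re (cis s * deriv (F i) (rcis x s))) :: real^'n)"
      by (rule radial_speed_eq)
  qed
  also have "\<dots> \<le> 1/2 * integral {0..2*pi} (\<lambda>t. norm ((\<chi> i. Re (\<i> * rcis R t * deriv (F i) (rcis R t))) :: real^'n))"
    by (rule diameter_integral_le[OF F refl refl r(1) R])
  also have "\<dots> = 1/2 * circle_deriv_integral \<tau> R" using R r by (simp add: circle_deriv_integral_eq)
  also have "\<dots> \<le> 1/2 * L" using L[of R] R r by simp
  finally show ?thesis .
qed

text \<open>Monotone convergence along the diameters \<open>[-r, r]\<close> with \<open>r \<rightarrow> 1\<close>.\<close>

lemma radial_speed_integrable_and_bound:
  assumes L: "\<And>\<rho>. 0 \<le> \<rho> \<Longrightarrow> \<rho> < 1 \<Longrightarrow> circle_deriv_integral \<tau> \<rho> \<le> L"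
  shows "radial_speed \<tau> s integrable_on {-1<..<1}" "integral {-1<..<1} (radial_speed \<tau> s) \<le> 1/2 * L"
proof -
  define R where "R n = 1 - inverse (real (Suc (Suc n)))" for n
  have R: "0 < R n" "R n < 1" for n by (auto simp: R_def field_simps)
  have R_mono: "R n \<le> R (Suc n)" for n by (auto simp: R_def intro!: le_imp_inverse_le)
  define f where "f n r = (if r \<in> {-R n..R n} then radial_speed \<tau> s r else 0)" for n r
  have int: "radial_speed \<tau> s integrable_on {-R n..R n}" for n
    using R[of n] by (intro integrable_continuous_interval continuous_on_subset[OF continuous_on_radial_speed]) auto
  have sub: "{-R n..R n} \<inter> {-1<..<1} = {-R n..R n}" for n using R[of n] by auto
  have int_f: "f n integrable_on {-1<..<1}" for n
    unfolding f_def[abs_def] integrable_restrict_Int sub by (rule int)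
  have I_f: "integral {-1<..<1} (f n) = integral {-R n..R n} (radial_speed \<tau> s)" for n
    unfolding f_def[abs_def] integral_restrict_Int sub ..
  have le: "integral {-1<..<1} (f n) \<le> 1/2 * L" for n
    unfolding I_f by (rule integral_radial_speed_le[OF L R])
  have nn: "radial_speed \<tau> s r \<ge> 0" for r by (simp add: radial_speed_def)
  have f0: "0 \<le> integral {-1<..<1} (f n)" for n
    using nn by (intro integral_nonneg int_f) (auto simp: f_def)
  have "radial_speed \<tau> s integrable_on {-1<..<1} \<and>
     (\<lambda>n. integral {-1<..<1} (f n)) \<longlonglongrightarrow> integral {-1<..<1} (radial_speed \<tau> s)"
  proof (rule monotone_convergence_increasing[OF int_f])
    show "f n r \<le> f (Suc n) r" for n r using R_mono[of n] nn[of r] by (auto simp: f_def)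
    show "(\<lambda>n. f n r) \<longlonglongrightarrow> radial_speed \<tau> s r" if "r \<in> {-1<..<1}" for r
    proof (rule tendsto_eventually)
      have "R \<longlonglongrightarrow> 1 - 0" unfolding R_def[abs_def]
        by (intro tendsto_diff tendsto_const LIMSEQ_Suc[OF LIMSEQ_inverse_real_of_nat])
      then have "eventually (\<lambda>n. \<bar>r\<bar> < R n) sequentially"
        by (rule order_tendstoD(1)) (use that in auto)
      then show "eventually (\<lambda>n. f n r = radial_speed \<tau> s r) sequentially"
        by eventually_elim (auto simp: f_def)
    qed
    show "bounded (range (\<lambda>n. integral {-1<..<1} (f n)))"
      using le f0 by (intro boundedI[of _ "1/2 * L"]) (auto simp: abs_of_nonneg)
  qed
  then have "radial_speed \<tau> s integrable_on {-1<..<1}"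
    and lim: "(\<lambda>n. integral {-1<..<1} (f n)) \<longlonglongrightarrow> integral {-1<..<1} (radial_speed \<tau> s)"
    by auto
  then show "radial_speed \<tau> s integrable_on {-1<..<1}" by simp
  show "integral {-1<..<1} (radial_speed \<tau> s) \<le> 1/2 * L"
    using le by (intro LIMSEQ_le_const2[OF lim]) auto
qed

end

section \<open>The limit of the circle lengths and the perimeter\<close>

lemma integral_split_equal_pieces:
  fixes f :: "real \<Rightarrow> real"
  assumes "continuous_on UNIV f" "\<eta> \<ge> 0"
  shows "integral {0..real k * \<eta>} f = integral {0..\<eta>} (\<lambda>t. \<Sum>i<k. f (t + real i * \<eta>))"
proof (induction k)
  case 0
  then show ?case by simp
next
  case (Suc k)
  have int: "f integrable_on {a..b}" for a b
    by (intro integrable_continuous_interval continuous_on_subset[OF assms(1)]) auto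
  have "integral {0..real (Suc k) * \<eta>} f = integral {0..real k * \<eta>} f + integral {real k * \<eta>..real (Suc k) * \<eta>} f"
    using assms(2) by (intro Henstock_Kurzweil_Integration.integral_combine[symmetric] int) (auto intro!: mult_right_mono)
  also have "integral {real k * \<eta>..real (Suc k) * \<eta>} f = integral {0..\<eta>} (\<lambda>t. f (t + real k * \<eta>))"
    using integral_shift_real_ivl[of "real k * \<eta>" "real k * \<eta>" "real (Suc k) * \<eta>" f] by (simp add: algebra_simps)
  also have "integral {0..real k * \<eta>} f + \<dots> = integral {0..\<eta>} (\<lambda>t. (\<Sum>i<k. f (t + real i * \<eta>)) + f (t + real k * \<eta>))"
    unfolding Suc.IH
    by (intro Henstock_Kurzweil_Integration.integral_add[symmetric] integrable_continuous_interval continuous_on_sum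
        continuous_on_compose2[OF assms(1)]) (auto intro!: continuous_intros)
  finally show ?case by simp
qed

lemma countable_angles_from_one_period:
  assumes "countable {t \<in> {0..<2*pi}. P (cis t)}"
  shows "countable {t. P (cis t)}"
proof -
  have "{t. P (cis t)} \<subseteq> (\<Union>m::int. (\<lambda>s. s + 2 * pi * of_int m) ` {t \<in> {0..<2*pi}. P (cis t)})"
  proof
    fix t assume t: "t \<in> {t. P (cis t)}"
    define m where "m = \<lfloor>t / (2*pi)\<rfloor>"
    define s where "s = t - 2 * pi * of_int m"
    have "of_int m \<le> t / (2*pi)" "t / (2*pi) < of_int m + 1" unfolding m_def by linarith+
    then have "0 \<le> s" "s < 2*pi" by (auto simp: s_def field_simps)
    moreover have "cis s = cis t"
    proof -
      have "cis t = cis s * cis (2 * pi * of_int m)" unfolding cis_mult s_def by simp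
      also have "cis (2 * pi * of_int m) = 1" by (intro cis_multiple_2pi) auto
      finally show ?thesis by simp
    qed
    ultimately have "s \<in> {t \<in> {0..<2*pi}. P (cis t)}" using t by simp
    then show "t \<in> (\<Union>m::int. (\<lambda>s. s + 2 * pi * of_int m) ` {t \<in> {0..<2*pi}. P (cis t)})"
      by (intro UN_I[of m] image_eqI[of _ _ s]) (auto simp: s_def)
  qed
  then show ?thesis by (rule countable_subset) (intro countable_UN countable_image assms, simp)
qed

context
  fixes h g :: "complex \<Rightarrow> complex" and \<Phi> \<tau> :: "complex \<Rightarrow> real^'n" and F :: "'n \<Rightarrow> complex \<Rightarrow> complex"
    and l :: real
  assumes h: "homeomorphism (ball 0 1) (ball 0 1) h g"
    and \<Phi>: "continuous_on (cball 0 1) \<Phi>" "inj_on \<Phi> (cball 0 1)"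
    and h\<tau>: "\<And>z. norm z < 1 \<Longrightarrow> \<tau> z = \<Phi> (h z)"
    and F: "\<And>i. F i holomorphic_on ball 0 1"
    and \<tau>: "\<And>z. norm z < 1 \<Longrightarrow> \<tau> z = (\<chi> i. Re (F i z))"
    and l: "boundary_length \<Phi> = ennreal l" "l \<ge> 0"
begin

lemma limit_polygon_le_perimeter:
  assumes k: "k \<ge> 3" "\<eta> = 2 * pi / real k"
    and good: "\<And>i. i \<le> k \<Longrightarrow> \<exists>a. cluster_set h (cis (t + real i * \<eta>)) = {a}"
    and R: "\<And>n. 0 < R n \<and> R n < 1" "R \<longlonglongrightarrow> (1::real)"
  obtains L where "(\<lambda>n. \<Sum>i<k. norm (\<tau> (rcis (R n) (t + real (Suc i) * \<eta>)) - \<tau> (rcis (R n) (t + real i * \<eta>)))) \<longlonglongrightarrow> L" "L \<le> l"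
proof -
  obtain \<xi> where \<xi>: "\<And>i. i \<le> k \<Longrightarrow> cluster_set h (cis (t + real i * \<eta>)) = {\<xi> i}" using good by metis
  have lim: "((\<lambda>r. h (rcis r (t + real i * \<eta>))) \<longlongrightarrow> \<xi> i) (at_left 1)" if "i \<le> k" for i
    by (rule radial_limit_if_singleton_cluster_set[OF h \<xi>[OF that]])
  have R1: "filterlim R (at_left 1) sequentially"
  proof -
    have "R n \<noteq> 1" for n using R(1)[of n] by simp
    then show ?thesis unfolding filterlim_at using R by (auto intro: always_eventually)
  qed
  have \<xi>1: "\<xi> i \<in> cball 0 1" if "i \<le> k" for i
    using cluster_set_subset_circle[OF h, of "cis (t + real i * \<eta>)"] \<xi>[OF that] by auto
  have lim\<tau>: "(\<lambda>n. \<tau> (rcis (R n) (t + real i * \<eta>))) \<longlonglongrightarrow> \<Phi> (\<xi> i)" if i: "i \<le> k" for i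
  proof -
    have "(\<lambda>n. h (rcis (R n) (t + real i * \<eta>))) \<longlonglongrightarrow> \<xi> i"
      using filterlim_compose[OF lim[OF i] R1] .
    then have "(\<lambda>n. \<Phi> (h (rcis (R n) (t + real i * \<eta>)))) \<longlonglongrightarrow> \<Phi> (\<xi> i)"
    proof (rule continuous_on_tendsto_compose[OF \<Phi>(1) _ \<xi>1[OF i]])
      show "\<forall>\<^sub>F n in sequentially. h (rcis (R n) (t + real i * \<eta>)) \<in> cball 0 1"
        using homeomorphism_diskD(1)[OF h] R(1) by (intro always_eventually) (simp add: less_imp_le abs_of_pos)
    qed
    then show ?thesis using h\<tau> R(1) by (simp add: abs_of_pos)
  qed
  show ?thesis
  proof (rule that)
    show "(\<lambda>n. \<Sum>i<k. norm (\<tau> (rcis (R n) (t + real (Suc i) * \<eta>)) - \<tau> (rcis (R n) (t + real i * \<eta>))))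
        \<longlonglongrightarrow> (\<Sum>i<k. norm (\<Phi> (\<xi> (Suc i)) - \<Phi> (\<xi> i)))"
      by (intro tendsto_sum tendsto_norm tendsto_diff lim\<tau>) auto
    have "(\<Sum>i<k. ennreal (dist (\<Phi> (\<xi> i)) (\<Phi> (\<xi> (Suc i))))) \<le> boundary_length \<Phi>"
      unfolding boundary_length_def by (rule spoke_ends_polygon_le_boundary_length[OF h k lim])
    then have "ennreal (\<Sum>i<k. dist (\<Phi> (\<xi> i)) (\<Phi> (\<xi> (Suc i)))) \<le> ennreal l"
      unfolding l by (simp add: sum_ennreal)
    then show "(\<Sum>i<k. norm (\<Phi> (\<xi> (Suc i)) - \<Phi> (\<xi> i))) \<le> l"
      using l(2) by (simp add: dist_norm norm_minus_commute)
  qed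
qed

text \<open>The chord \<open>V(z) = \<tau>(z e\<^sup>i\<^sup>\<eta>) - \<tau>(z)\<close> has components that are real parts of holomorphic functions, so the integral of its norm over the circle
  only increases if \<open>\<rho>\<close> is replaced by a radius close to one. With \<open>k \<eta> = 2\<pi>\<close> that integral is
  the integral over \<open>[0, \<eta>]\<close> of the lengths of \<open>k\<close>-gons, whose limits are at most \<open>l\<close> for all but countably many \<open>t\<close>.\<close>

lemma mean_chord_le_perimeter:
  assumes k: "k \<ge> 3" "\<eta> = 2 * pi / real k" and \<rho>: "0 \<le> \<rho>" "\<rho> < 1"
  shows "integral {0..2*pi} (\<lambda>t. norm (\<tau> (rcis \<rho> (t + \<eta>)) - \<tau> (rcis \<rho> t))) \<le> \<eta> * l"
proof -
  have \<eta>: "\<eta> > 0" "real k * \<eta> = 2 * pi" using k by auto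
  define V where "V z = \<tau> (z * cis \<eta>) - \<tau> z" for z
  define FV where "FV i z = F i (z * cis \<eta>) - F i z" for i z
  have FV: "FV i holomorphic_on ball 0 1" for i
    unfolding FV_def by (intro holomorphic_intros F holomorphic_on_compose_gen[OF _ F, unfolded o_def]) (auto simp: norm_mult)
  have V: "V z = (\<chi> i. Re (FV i z))" if "norm z < 1" for z
    using \<tau>[of z] \<tau>[of "z * cis \<eta>"] that by (simp add: V_def FV_def vec_eq_iff norm_mult)
  have V_rcis: "V (rcis r t) = \<tau> (rcis r (t + \<eta>)) - \<tau> (rcis r t)" for r t
    by (simp add: V_def rcis_mult_cis)
  obtain M where M: "M > 0" "\<And>z. norm z < 1 \<Longrightarrow> norm (\<tau> z) \<le> M"
    using bounded_parametrization[OF h \<Phi>(1) h\<tau>] by metis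
  define R where "R n = 1 - inverse (real (Suc (Suc n)))" for n
  have R: "0 < R n \<and> R n < 1" for n by (auto simp: R_def field_simps)
  have R_lim: "R \<longlonglongrightarrow> 1"
  proof -
    have "(\<lambda>n. 1 - inverse (real (Suc (Suc n)))) \<longlonglongrightarrow> 1 - 0"
      by (intro tendsto_diff tendsto_const LIMSEQ_Suc[OF LIMSEQ_inverse_real_of_nat])
    then show ?thesis by (simp add: R_def[abs_def])
  qed
  define f where "f n t = (\<Sum>i<k. norm (V (rcis (R n) (t + real i * \<eta>))))" for n t
  have cV: "continuous_on UNIV (\<lambda>t. norm (V (rcis (R n) t)))" for n
    using continuous_on_norm_circle[OF FV V, of "R n"] R[of n] by simp
  have I_f: "integral {0..2*pi} (\<lambda>t. norm (V (rcis (R n) t))) = integral {0..\<eta>} (f n)" for n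
    unfolding \<eta>(2)[symmetric] f_def[abs_def] using \<eta>(1) by (intro integral_split_equal_pieces cV) auto
  \<comment> \<open>The angles \<open>t\<close> for which one of the radii at \<open>t + i \<eta>\<close> may fail to have a limit.\<close>
  define E where "E = (\<Union>i\<le>k. (\<lambda>s. s - real i * \<eta>) ` {t. \<not> (\<exists>a. cluster_set h (cis t) = {a})})"
  have cE: "countable E" unfolding E_def
    by (intro countable_UN countable_image countable_angles_from_one_period
        countable_nonsingleton_cluster_sets[OF h \<Phi> h\<tau> F \<tau>]) auto
  have "negligible (\<Union>((\<lambda>x. {x}) ` E))"
    by (rule negligible_countable_Union) (use cE in auto)
  then have nE: "negligible E" by simp
  have good: "\<exists>a. cluster_set h (cis (t + real i * \<eta>)) = {a}" if "t \<notin> E" "i \<le> k" for t i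
  proof (rule ccontr)
    assume "\<not> ?thesis"
    then have "t \<in> E" unfolding E_def using that(2) by (intro UN_I[of i] image_eqI[of _ _ "t + real i * \<eta>"]) auto
    with that show False by simp
  qed
  have "\<exists>L. (\<lambda>n. f n t) \<longlonglongrightarrow> L \<and> L \<le> l" if "t \<notin> E" for t
  proof -
    have ex: "\<exists>L. (\<lambda>n. \<Sum>i<k. norm (\<tau> (rcis (R n) (t + real (Suc i) * \<eta>)) - \<tau> (rcis (R n) (t + real i * \<eta>)))) \<longlonglongrightarrow> L \<and> L \<le> l"
      by (rule limit_polygon_le_perimeter[OF k, of t R]) (use good[OF that] R R_lim in blast)+
    have eq: "t + real i * \<eta> + \<eta> = t + real (Suc i) * \<eta>" for i by (simp add: algebra_simps)
    show ?thesis using ex unfolding f_def V_rcis eq .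
  qed
  then obtain lf where lf: "\<And>t. t \<notin> E \<Longrightarrow> (\<lambda>n. f n t) \<longlonglongrightarrow> lf t" "\<And>t. t \<notin> E \<Longrightarrow> lf t \<le> l" by metis
  let ?S = "{0..\<eta>} - E"
  have spike: "negligible {x \<in> {0..\<eta>} - ?S. u x \<noteq> 0}" "negligible {x \<in> ?S - {0..\<eta>}. u x \<noteq> 0}" for u :: "real \<Rightarrow> real"
    by (auto intro: negligible_subset[OF nE])
  have int_f: "f n integrable_on {0..\<eta>}" for n unfolding f_def
    by (intro integrable_continuous_interval continuous_on_sum continuous_on_compose2[OF cV]) (auto intro!: continuous_intros)
  have dom: "norm (f n t) \<le> real k * (2 * M)" for n t
  proof -
    have "norm (V (rcis (R n) t)) \<le> 2 * M" for t
    proof -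
      have "norm (\<tau> (rcis (R n) (t + \<eta>))) \<le> M" "norm (\<tau> (rcis (R n) t)) \<le> M"
        using R[of n] by (auto intro!: M)
      then show ?thesis unfolding V_rcis using norm_triangle_ineq4[of "\<tau> (rcis (R n) (t + \<eta>))" "\<tau> (rcis (R n) t)"] by linarith
    qed
    then have "f n t \<le> (\<Sum>i<k. 2 * M)" unfolding f_def by (intro sum_mono)
    moreover have "f n t \<ge> 0" unfolding f_def by (intro sum_nonneg) auto
    ultimately show ?thesis by simp
  qed
  have conv: "lf integrable_on ?S" "(\<lambda>n. integral ?S (f n)) \<longlonglongrightarrow> integral ?S lf"
  proof -
    have i1: "f n integrable_on ?S" for n by (rule integrable_spike_set[OF int_f spike])
    have i2: "(\<lambda>_. real k * (2 * M)) integrable_on ?S"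
      by (rule integrable_spike_set[OF _ spike]) (rule integrable_const_ivl)
    note dc = Equivalence_Lebesgue_Henstock_Integration.dominated_convergence[OF i1 i2, where g=lf]
    show "lf integrable_on ?S" by (rule dc(1)) (use dom lf in auto)
    show "(\<lambda>n. integral ?S (f n)) \<longlonglongrightarrow> integral ?S lf" by (rule dc(2)) (use dom lf in auto)
  qed
  have "integral ?S lf \<le> integral ?S (\<lambda>_. l)"
    using lf(2) by (intro integral_le conv integrable_spike_set[OF integrable_const_ivl spike]) auto
  also have "\<dots> = integral {0..\<eta>} (\<lambda>_. l)" by (rule integral_spike_set[OF spike, symmetric])
  also have "\<dots> = \<eta> * l" using \<eta> by simp
  finally have le: "integral ?S lf \<le> \<eta> * l" .
  have "eventually (\<lambda>n. \<rho> < R n) sequentially" using order_tendstoD(1)[OF R_lim \<rho>(2)] .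
  then have "eventually (\<lambda>n. integral {0..2*pi} (\<lambda>t. norm (V (rcis \<rho> t))) \<le> integral ?S (f n)) sequentially"
  proof eventually_elim
    case (elim n)
    have "integral {0..2*pi} (\<lambda>t. norm (V (rcis \<rho> t))) \<le> integral {0..2*pi} (\<lambda>t. norm (V (rcis (R n) t)))"
      using R[of n] by (intro circle_mean_norm_mono[OF FV V \<rho>(1) elim]) auto
    also have "\<dots> = integral ?S (f n)" unfolding I_f by (rule integral_spike_set[OF spike])
    finally show ?case .
  qed
  then have "integral {0..2*pi} (\<lambda>t. norm (V (rcis \<rho> t))) \<le> integral ?S lf"
    by (intro tendsto_lowerbound[OF conv(2)]) auto
  with le show ?thesis unfolding V_rcis by linarith
qed

text \<open>The speed is the uniform limit of \<open>|\<tau>(\<rho> e\<^sup>i\<^sup>(\<^sup>t\<^sup>+\<^sup>\<eta>\<^sup>)) - \<tau>(\<rho> e\<^sup>i\<^sup>t)| / \<eta>\<close> along \<open>\<eta> = 2\<pi>/k\<close>, and the integral of these quotients is at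
  most \<open>l\<close>.\<close>

lemma circle_deriv_integral_le_perimeter:
  assumes \<rho>: "0 \<le> \<rho>" "\<rho> < 1"
  shows "circle_deriv_integral \<tau> \<rho> \<le> l"
proof (rule field_le_epsilon)
  fix \<epsilon> :: real assume \<epsilon>: "\<epsilon> > 0"
  define e where "e = \<epsilon> / (2 * pi)"
  have e: "e > 0" using \<epsilon> by (simp add: e_def)
  define u where "u t = \<tau> (rcis \<rho> t)" for t
  define w :: "real \<Rightarrow> real^'n" where "w t = (\<chi> i. Re (\<i> * rcis \<rho> t * deriv (F i) (rcis \<rho> t)))" for t
  have \<rho>1: "\<bar>\<rho>\<bar> < 1" using \<rho> by simp
  have u: "(u has_vector_derivative w t) (at t)" for t
    unfolding u_def w_def by (rule angular_derivative[OF F \<tau> \<rho>1])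
  have dF: "deriv (F i) holomorphic_on ball 0 1" for i by (intro holomorphic_deriv F) auto
  have cw: "continuous_on UNIV w"
  proof -
    have "continuous_on UNIV (\<lambda>t. deriv (F i) (rcis \<rho> t))" for i
      unfolding rcis_def cis_conv_exp using \<rho>
      by (intro continuous_on_compose2[OF holomorphic_on_imp_continuous_on[OF dF]])
         (auto intro!: continuous_intros simp: norm_mult)
    then show ?thesis unfolding w_def rcis_def cis_conv_exp by (intro continuous_intros)
  qed
  \<comment> \<open>The interval is longer than a period because \<open>t + \<eta>\<close> has to lie in it as well; \<open>\<eta> < 1\<close> below.\<close>
  have "uniformly_continuous_on {0..2*pi + 1} w"
    by (intro compact_uniformly_continuous continuous_on_subset[OF cw]) auto
  then obtain \<delta> where \<delta>: "\<delta> > 0" "\<And>s t. s \<in> {0..2*pi+1} \<Longrightarrow> t \<in> {0..2*pi+1} \<Longrightarrow> dist s t < \<delta> \<Longrightarrow> dist (w s) (w t) < e"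
    using e unfolding uniformly_continuous_on_def by metis
  obtain k0 :: nat where k0: "2 * pi / min \<delta> 1 < real k0" using reals_Archimedean2 by blast
  define k where "k = max 3 k0"
  define \<eta> where "\<eta> = 2 * pi / real k"
  have k: "k \<ge> 3" by (simp add: k_def)
  have "2 * pi / min \<delta> 1 < real k" using k0 by (simp add: k_def)
  then have "2 * pi < real k * min \<delta> 1" using \<delta>(1) by (simp add: pos_divide_less_eq)
  moreover have "0 < real k" using k by simp
  ultimately have "\<eta> < min \<delta> 1" unfolding \<eta>_def by (metis mult.commute pos_divide_less_eq)
  then have \<eta>: "0 < \<eta>" "\<eta> < \<delta>" "\<eta> < 1" using k by (auto simp: \<eta>_def)
  have pt: "\<eta> * norm (w t) \<le> norm (u (t + \<eta>) - u t) + \<eta> * e" if t: "t \<in> {0..2*pi}" for t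
  proof -
    have "norm (u (t + \<eta>) - u t - (t + \<eta> - t) *\<^sub>R w t) \<le> norm (t + \<eta> - t) * e"
    proof (rule vector_differentiable_bound_linearization[where S="{t..t+\<eta>}"])
      show "(u has_vector_derivative w x) (at x within {t..t+\<eta>})" for x
        using u has_vector_derivative_at_within by blast
      show "norm (w x - w t) \<le> e" if "x \<in> {t..t+\<eta>}" for x
        using \<delta>(2)[of x t] that t \<eta> by (auto simp: dist_norm intro: less_imp_le)
    qed (use \<eta> in \<open>auto simp: closed_segment_eq_real_ivl\<close>)
    then have "norm (u (t + \<eta>) - u t - \<eta> *\<^sub>R w t) \<le> \<eta> * e" using \<eta> by simp
    moreover have "norm (\<eta> *\<^sub>R w t) \<le> norm (u (t + \<eta>) - u t) + norm (u (t + \<eta>) - u t - \<eta> *\<^sub>R w t)"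
      using norm_triangle_ineq4[of "u (t + \<eta>) - u t" "u (t + \<eta>) - u t - \<eta> *\<^sub>R w t"] by simp
    ultimately show ?thesis using \<eta> by simp
  qed
  have cu: "continuous_on UNIV u"
    using u by (meson continuous_at_imp_continuous_on has_vector_derivative_continuous)
  have cu': "continuous_on {0..2*pi} (\<lambda>t. u (t + \<eta>) - u t)"
    by (intro continuous_intros continuous_on_compose2[OF cu]) auto
  have "\<eta> * integral {0..2*pi} (\<lambda>t. norm (w t)) = integral {0..2*pi} (\<lambda>t. \<eta> * norm (w t))" by simp
  also have "\<dots> \<le> integral {0..2*pi} (\<lambda>t. norm (u (t + \<eta>) - u t) + \<eta> * e)"
    using pt by (intro integral_le integrable_continuous_interval continuous_on_add continuous_on_mult
        continuous_on_const continuous_on_norm cu' continuous_on_subset[OF cw]) auto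
  also have "\<dots> = integral {0..2*pi} (\<lambda>t. norm (u (t + \<eta>) - u t)) + 2 * pi * (\<eta> * e)"
    by (subst Henstock_Kurzweil_Integration.integral_add)
       (auto intro!: integrable_continuous_interval continuous_on_norm cu' continuous_on_const)
  also have "\<dots> \<le> \<eta> * l + \<eta> * \<epsilon>"
    using mean_chord_le_perimeter[OF k \<eta>_def \<rho>] by (simp add: u_def e_def)
  finally have "\<eta> * integral {0..2*pi} (\<lambda>t. norm (w t)) \<le> \<eta> * (l + \<epsilon>)" by (simp add: distrib_left)
  then have "integral {0..2*pi} (\<lambda>t. norm (w t)) \<le> l + \<epsilon>" using \<eta> by simp
  moreover have "circle_deriv_integral \<tau> \<rho> = integral {0..2*pi} (\<lambda>t. norm (w t))"
    unfolding w_def by (rule circle_deriv_integral_eq[OF F \<tau> \<rho>1])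
  ultimately show "circle_deriv_integral \<tau> \<rho> \<le> l + \<epsilon>" by simp
qed

lemma circle_deriv_integral_limit:
  obtains L where "(circle_deriv_integral \<tau> \<longlongrightarrow> L) (at_left 1)" "L \<le> l"
    "\<And>\<rho>. 0 \<le> \<rho> \<Longrightarrow> \<rho> < 1 \<Longrightarrow> circle_deriv_integral \<tau> \<rho> \<le> L"
proof -
  let ?C = "circle_deriv_integral \<tau>"
  define L where "L = (SUP \<rho>\<in>{0..<1}. ?C \<rho>)"
  have bdd: "bdd_above (?C ` {0..<1})" using circle_deriv_integral_le_perimeter by (intro bdd_aboveI2[of _ _ l]) auto
  have up: "?C \<rho> \<le> L" if "0 \<le> \<rho>" "\<rho> < 1" for \<rho>
    unfolding L_def using that by (intro cSUP_upper bdd) auto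
  have "L \<le> l" unfolding L_def using circle_deriv_integral_le_perimeter by (intro cSUP_least) auto
  moreover have "(?C \<longlongrightarrow> L) (at_left 1)"
  proof (rule order_tendstoI)
    fix a assume "a < L"
    then obtain \<rho> where \<rho>: "\<rho> \<in> {0..<1}" "a < ?C \<rho>"
      unfolding L_def using less_cSUP_iff[OF _ bdd] by auto
    have "a < ?C R" if "\<rho> < R" "R < 1" for R
      using circle_deriv_integral_mono[OF F \<tau>, of \<rho> R] \<rho> that by auto
    then show "eventually (\<lambda>R. a < ?C R) (at_left 1)"
      using \<rho> by (intro eventually_at_leftI[of \<rho>]) auto
  next
    fix a assume "L < a"
    have "?C R < a" if "0 < R" "R < 1" for R using up[of R] that \<open>L < a\<close> by auto
    then show "eventually (\<lambda>R. ?C R < a) (at_left 1)" by (intro eventually_at_leftI[of 0]) auto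
  qed
  ultimately show ?thesis using up that by blast
qed

text \<open>An inscribed polygon is no longer than the integral of the speed between its end parameters.\<close>

lemma diameter_length_le:
  assumes L: "\<And>\<rho>. 0 \<le> \<rho> \<Longrightarrow> \<rho> < 1 \<Longrightarrow> circle_deriv_integral \<tau> \<rho> \<le> L" "L \<le> l"
  shows "curve_length {-1<..<1} (\<lambda>r. \<tau> (rcis r s)) \<le> boundary_length \<Phi> / 2"
  unfolding curve_length_def
proof (rule SUP_least, clarify)
  fix n :: nat and t :: "nat \<Rightarrow> real"
  assume mono: "mono_on {..n} t" and sub: "t ` {..n} \<subseteq> {-1<..<1}"
  have t: "-1 < t i" "t i < 1" if "i \<le> n" for i using sub that by auto
  have tm: "t i \<le> t j" if "i \<le> j" "j \<le> n" for i j using mono that by (auto simp: mono_on_def)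
  have int: "radial_speed \<tau> s integrable_on {a..b}" if "-1 < a" "b < 1" for a b
    using that by (intro integrable_continuous_interval continuous_on_subset[OF continuous_on_radial_speed[OF F \<tau>]]) auto
  have nn: "radial_speed \<tau> s r \<ge> 0" for r by (simp add: radial_speed_def)
  have step: "dist (\<tau> (rcis a s)) (\<tau> (rcis b s)) \<le> integral {a..b} (radial_speed \<tau> s)"
    if ab: "-1 < a" "a \<le> b" "b < 1" for a b
  proof -
    define D :: "real \<Rightarrow> real^'n" where "D r = (\<chi> i. Re (cis s * deriv (F i) (rcis r s)))" for r
    have "(D has_integral (\<tau> (rcis b s) - \<tau> (rcis a s))) {a..b}"
    proof (rule fundamental_theorem_of_calculus[OF ab(2)])
      fix r assume "r \<in> {a..b}"
      then have "\<bar>r\<bar> < 1" using ab by auto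
      then show "((\<lambda>r. \<tau> (rcis r s)) has_vector_derivative D r) (at r within {a..b})"
        unfolding D_def by (intro has_vector_derivative_at_within[OF radial_derivative[OF F \<tau>]])
    qed
    then have D: "D integrable_on {a..b}" "integral {a..b} D = \<tau> (rcis b s) - \<tau> (rcis a s)"
      by (auto simp: integral_unique)
    have "norm (integral {a..b} D) \<le> integral {a..b} (radial_speed \<tau> s)"
      using ab by (intro Henstock_Kurzweil_Integration.integral_norm_bound_integral D int) (auto simp: D_def radial_speed_eq[OF F \<tau>])
    then show ?thesis by (simp add: D(2) dist_norm norm_minus_commute)
  qed
  have "(\<Sum>i<m. dist (\<tau> (rcis (t i) s)) (\<tau> (rcis (t (Suc i)) s))) \<le> integral {t 0..t m} (radial_speed \<tau> s)"
    if "m \<le> n" for m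
    using that
  proof (induction m)
    case 0
    then show ?case by simp
  next
    case (Suc m)
    have "integral {t 0..t m} (radial_speed \<tau> s) + integral {t m..t (Suc m)} (radial_speed \<tau> s) =
        integral {t 0..t (Suc m)} (radial_speed \<tau> s)"
      using Suc.prems t[of 0] t[of "Suc m"] tm[of 0 m] tm[of m "Suc m"]
      by (intro Henstock_Kurzweil_Integration.integral_combine int) auto
    then show ?case using Suc.IH Suc.prems step[of "t m" "t (Suc m)"] t[of m] t[of "Suc m"] tm[of m "Suc m"] by simp
  qed
  from this[of n] have "(\<Sum>i<n. dist (\<tau> (rcis (t i) s)) (\<tau> (rcis (t (Suc i)) s))) \<le> integral {t 0..t n} (radial_speed \<tau> s)"
    by simp
  also have "\<dots> \<le> integral {-1<..<1} (radial_speed \<tau> s)"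
    using nn t[of 0] t[of n] by (intro integral_subset_le int radial_speed_integrable_and_bound[OF F \<tau> L(1)]) auto
  also have "\<dots> \<le> 1/2 * L" by (rule radial_speed_integrable_and_bound[OF F \<tau> L(1)])
  also have "\<dots> \<le> l / 2" using L(2) by simp
  finally have "ennreal (\<Sum>i<n. dist (\<tau> (rcis (t i) s)) (\<tau> (rcis (t (Suc i)) s))) \<le> ennreal (l / 2)"
    by (rule ennreal_leI)
  also have "ennreal (l / 2) = boundary_length \<Phi> / 2"
    unfolding l(1) using l(2) by (simp add: divide_ennreal[symmetric])
  finally show "(\<Sum>i<n. ennreal (dist (\<tau> (rcis (t i) s)) (\<tau> (rcis (t (Suc i)) s)))) \<le> boundary_length \<Phi> / 2"
    by (simp add: sum_ennreal)
qed

end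

section \<open>Diameters of harmonic surfaces\<close>

lemma disk_coordinates_of_parametrization:
  fixes \<Phi> \<tau> :: "complex \<Rightarrow> real^'n"
  assumes J: "jordan_surface \<Phi> \<Sigma>" and P: "harmonic_parametrization \<Phi> \<Sigma> \<tau>"
  obtains h g where "homeomorphism (ball 0 1) (ball 0 1) h g"
    "continuous_on (cball 0 1) \<Phi>" "inj_on \<Phi> (cball 0 1)" "\<And>z. norm z < 1 \<Longrightarrow> \<tau> z = \<Phi> (h z)"
proof -
  obtain \<Psi> where \<Psi>: "homeomorphism (cball 0 1) \<Sigma> \<Phi> \<Psi>" using J by (auto simp: jordan_surface_def)
  obtain \<sigma> where \<sigma>: "homeomorphism (ball 0 1) (\<Sigma> - \<Phi> ` sphere 0 1) \<tau> \<sigma>"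
    using P by (auto simp: harmonic_parametrization_def)
  have inj: "inj_on \<Phi> (cball 0 1)"
    using homeomorphism_apply1[OF \<Psi>] by (rule inj_on_inverseI)
  have img: "\<Phi> ` ball 0 1 = \<Sigma> - \<Phi> ` sphere 0 1"
  proof -
    have "ball 0 1 = cball 0 1 - sphere (0::complex) 1" by auto
    then have "\<Phi> ` ball 0 1 = \<Phi> ` cball 0 1 - \<Phi> ` sphere 0 1"
      using inj_on_image_set_diff[OF inj, of "cball 0 1" "sphere 0 1"] by auto
    then show ?thesis using homeomorphism_image1[OF \<Psi>] by simp
  qed
  have "homeomorphism (ball 0 1) (\<Sigma> - \<Phi> ` sphere 0 1) \<Phi> \<Psi>"
    by (rule homeomorphism_of_subsets[OF \<Psi> _ subset_refl img]) auto
  from homeomorphism_compose[OF \<sigma> homeomorphism_symD[OF this]]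
  have hom: "homeomorphism (ball 0 1) (ball 0 1) (\<Psi> \<circ> \<tau>) (\<sigma> \<circ> \<Phi>)" .
  have "\<tau> z = \<Phi> ((\<Psi> \<circ> \<tau>) z)" if "norm z < 1" for z
  proof -
    have "\<tau> z \<in> \<Sigma>" using homeomorphism_image1[OF \<sigma>] that by force
    then show ?thesis using homeomorphism_apply2[OF \<Psi>] by simp
  qed
  with hom inj show ?thesis using that homeomorphism_cont1[OF \<Psi>] by blast
qed

theorem theorem3p8:
  fixes \<Phi> \<tau> :: "complex \<Rightarrow> real^'n" and \<Sigma> :: "(real^'n) set"
  assumes "harmonic_surface \<Phi> \<Sigma>"
    and "boundary_length \<Phi> < \<infinity>"
    and "harmonic_parametrization \<Phi> \<Sigma> \<tau>"
  shows "\<exists>L::real. (circle_deriv_integral \<tau> \<longlongrightarrow> L) (at_left 1) \<and>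
    (\<forall>s\<in>{0..2*pi}.
       radial_speed \<tau> s integrable_on {-1<..<1} \<and>
       integral {-1<..<1} (radial_speed \<tau> s) \<le> 1/2 * L \<and>
       curve_length {-1<..<1} (\<lambda>r. \<tau> (rcis r s)) \<le> boundary_length \<Phi> / 2)"
proof -
  obtain h g where h: "homeomorphism (ball 0 1) (ball 0 1) h g"
    "continuous_on (cball 0 1) \<Phi>" "inj_on \<Phi> (cball 0 1)" "\<And>z. norm z < 1 \<Longrightarrow> \<tau> z = \<Phi> (h z)"
    using disk_coordinates_of_parametrization assms unfolding harmonic_surface_def by metis
  have "\<exists>G. G holomorphic_on ball 0 1 \<and> (\<forall>z. norm z < 1 \<longrightarrow> \<tau> z $ i = Re (G z))" for i
    using harmonic_on_ball_is_Re_holomorphic[of "\<lambda>z. \<tau> z $ i"] assms(3)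
    unfolding harmonic_parametrization_def by (metis mem_ball_0)
  then obtain F where F: "\<And>i. F i holomorphic_on ball 0 1" "\<And>i z. norm z < 1 \<Longrightarrow> \<tau> z $ i = Re (F i z)" by metis
  then have \<tau>: "\<tau> z = (\<chi> i. Re (F i z))" if "norm z < 1" for z
    using that by (simp add: vec_eq_iff)
  obtain l where l: "boundary_length \<Phi> = ennreal l" "l \<ge> 0"
    using assms(2) by (cases "boundary_length \<Phi>") auto
  note data = h F(1) \<tau> l
  obtain L where L: "(circle_deriv_integral \<tau> \<longlongrightarrow> L) (at_left 1)" "L \<le> l"
    "\<And>\<rho>. 0 \<le> \<rho> \<Longrightarrow> \<rho> < 1 \<Longrightarrow> circle_deriv_integral \<tau> \<rho> \<le> L"
    using circle_deriv_integral_limit[OF data] by metis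
  show ?thesis
    using L(1) radial_speed_integrable_and_bound[OF F(1) \<tau> L(3)] diameter_length_le[OF data L(3,2)] by blast
qed

end
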